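(* Let $n\ge 1$ and let $f\colon\{0,1\}^n\to\{0,1\}$ be arbitrary. Let $F$ denote the communication problem of computing, on input $x,y\in\{0,1\}^n$ (Alice holds $x$, Bob holds $y$), both of the quantities $f(x\wedge y)$ and $f(x\vee y)$. Then $$D(F)\;\ge\; R_{1/3}(F)\;\ge\; Q^*_{1/3}(F)\;\ge\;\Omega\big(\mathrm{bs}(f)^{1/4}\big)\;\ge\;\Omega\big(D(F)^{1/12}\big),$$ where the constants hidden in $\Omega(\cdot)$ are absolute (positive and independent of $n$ and $f$).
   Context: The operations $x\wedge y$, $x\vee y$ are bitwise AND and OR, and $\oplus$ is bitwise XOR. Formally, the communication problem $F$ is expressed as a two-party Boolean function by introducing an additional input bit $b\in\{0,1\}$ indicating the desired output: $F((x,b),y)=f(x\wedge y)$ if $b=0$ and $F((x,b),y)=f(x\vee y)$ if $b=1$. Block sensitivity: for $S\subseteq\{1,\dots,n\}$ let $e_S\in\{0,1\}^n$ be the characteristic vector of $S$. $\mathrm{bs}(f)$ is the largest $k$ for which there exist nonempty pairwise disjoint sets $S_1,\dots,S_k\subseteq\{1,\dots,n\}$ and $z\in\{0,1\}^n$ with $f(z\oplus e_{S_1})=\cdots=f(z\oplus e_{S_k})\ne f(z)$ ($\mathrm{bs}(f)=0$ if $f$ is constant). Communication models, for $F\colon X\times Y\to\{0,1\}$ with $X,Y$ finite; Alice gets an element of $X$, Bob an element of $Y$. $D(F)$ is the deterministic communication complexity: the least worst-case number of bits exchanged by a deterministic protocol computing $F$. $R_{1/3}(F)$ is the least cost (worst-case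 number of bits exchanged) of a classical protocol with an unlimited supply of shared random bits that computes $F$ correctly with probability at least $2/3$ on every input. $Q^*_{1/3}(F)$ is the bounded-error quantum communication complexity with prior entanglement: the least cost of a quantum protocol that computes $F$ correctly with probability at least $2/3$ on every input, where the parties exchange messages through a shared quantum channel, may apply arbitrary unitary operations to their own registers (finite-dimensional private workspace together with the channel qubits currently in their hands), may start with arbitrary (finite but unlimited) prior entanglement independent of the inputs, e.g. $|E|^{-1/2}\sum_{e\in E}|e\rangle|e\rangle$ with $E$ any finite set, and obtain the output by a final measurement; the cost is the total number of qubits exchanged in the worst case. *)

theory Defs
  imports
    "HOL-Probability.Probability"
    "Jordan_Normal_Form.Schur_Decomposition"
begin

section \<open>Bit strings and block sensitivity\<close>

definition bits :: "nat \<Rightarrow> bool list set" where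
  "bits n = {z. length z = n}"

definition bit_and :: "bool list \<Rightarrow> bool list \<Rightarrow> bool list" where
  "bit_and x y = map2 (\<and>) x y"

definition bit_or :: "bool list \<Rightarrow> bool list \<Rightarrow> bool list" where
  "bit_or x y = map2 (\<or>) x y"

definition bit_xor :: "bool list \<Rightarrow> bool list \<Rightarrow> bool list" where
  "bit_xor x y = map2 (\<noteq>) x y"

definition char_vec :: "nat \<Rightarrow> nat set \<Rightarrow> bool list" where
  "char_vec n S = map (\<lambda>i. i \<in> S) [1..<Suc n]"

text \<open>A function on \<open>{0,1}\<^sup>n\<close> is given by a function on all lists, of which only the values
  on \<^term>\<open>bits n\<close> matter. The number \<open>k = 0\<close> of blocks is always possible,
  so the block sensitivity of a constant function is \<open>0\<close>.\<close>

definition block_sensitivity :: "nat \<Rightarrow> (bool list \<Rightarrow> bool) \<Rightarrow> nat" where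
  "block_sensitivity n f = Max {k. \<exists>z \<in> bits n. \<exists>S :: nat \<Rightarrow> nat set.
     (\<forall>i \<in> {1..k}. S i \<noteq> {} \<and> S i \<subseteq> {1..n}) \<and>
     disjoint_family_on S {1..k} \<and>
     (\<forall>i \<in> {1..k}. f (bit_xor z (char_vec n (S i))) \<noteq> f z)}"

section \<open>The communication problem\<close>

definition and_or_problem :: "(bool list \<Rightarrow> bool) \<Rightarrow> bool list \<times> bool \<Rightarrow> bool list \<Rightarrow> bool" where
  "and_or_problem f = (\<lambda>(x, b) y. if b then f (bit_or x y) else f (bit_and x y))"

section \<open>Classical protocols\<close>

text \<open>At an inner node one of the players sends the bit computed from their own input, and the
  protocol continues with the first subtree if the bit is \<^const>\<open>True\<close>.
  The leaf reached gives the output.\<close>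

datatype ('x, 'y) protocol =
    Output bool
  | Alice_Sends "'x \<Rightarrow> bool" "('x, 'y) protocol" "('x, 'y) protocol"
  | Bob_Sends "'y \<Rightarrow> bool" "('x, 'y) protocol" "('x, 'y) protocol"

primrec run :: "('x, 'y) protocol \<Rightarrow> 'x \<Rightarrow> 'y \<Rightarrow> bool" where
  "run (Output v) x y = v"
| "run (Alice_Sends g P Q) x y = (if g x then run P x y else run Q x y)"
| "run (Bob_Sends h P Q) x y = (if h y then run P x y else run Q x y)"

primrec cost :: "('x, 'y) protocol \<Rightarrow> nat" where
  "cost (Output v) = 0"
| "cost (Alice_Sends g P Q) = Suc (max (cost P) (cost Q))"
| "cost (Bob_Sends h P Q) = Suc (max (cost P) (cost Q))"

definition D_cc :: "'x set \<Rightarrow> 'y set \<Rightarrow> ('x \<Rightarrow> 'y \<Rightarrow> bool) \<Rightarrow> nat" where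
  "D_cc X Y F = (LEAST c. \<exists>P. cost P \<le> c \<and> (\<forall>x \<in> X. \<forall>y \<in> Y. run P x y = F x y))"

definition coins :: "bool stream measure" where
  "coins = stream_space (measure_pmf (bernoulli_pmf (1 / 2)))"

definition R_cc :: "real \<Rightarrow> 'x set \<Rightarrow> 'y set \<Rightarrow> ('x \<Rightarrow> 'y \<Rightarrow> bool) \<Rightarrow> nat" where
  "R_cc \<epsilon> X Y F = (LEAST c. \<exists>P :: bool stream \<Rightarrow> ('x, 'y) protocol.
     (\<forall>r. cost (P r) \<le> c) \<and>
     (\<forall>x \<in> X. \<forall>y \<in> Y. {r. run (P r) x y = F x y} \<in> sets coins \<and>
        measure coins {r. run (P r) x y = F x y} \<ge> 1 - \<epsilon>))"

section \<open>Quantum protocols with prior entanglement\<close>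

text \<open>Alice's register (private workspace together with the qubits currently in her hands) has
  some dimension \<open>a\<close> and Bob's register some dimension \<open>b\<close>. The joint pure state
  \<open>\<Sum> i < a. \<Sum> j < b. \<psi>\<^sub>i\<^sub>j |i\<rangle> |j\<rangle>\<close> is represented by its \<open>a \<times> b\<close> coefficient matrix.
  A unitary \<open>U\<close> on Alice's register maps it to \<open>U \<psi>\<close>, a unitary \<open>V\<close> on Bob's register
  maps it to \<open>\<psi> V\<^sup>T\<close>.\<close>

definition is_unitary :: "nat \<Rightarrow> complex mat \<Rightarrow> bool" where
  "is_unitary d U \<longleftrightarrow> U \<in> carrier_mat d d \<and> U * mat_adjoint U = 1\<^sub>m d \<and> mat_adjoint U * U = 1\<^sub>m d"

text \<open>To send a qubit, Alice splits her register, of even dimension \<open>2 m\<close>, as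
  \<open>\<complex>\<^sup>2 \<otimes> \<complex>\<^sup>m\<close> with basis labels \<open>q m + i\<close> for \<open>q < 2\<close>, \<open>i < m\<close>. The first factor becomes
  part of Bob's register \<open>\<complex>\<^sup>2 \<otimes> \<complex>\<^sup>b\<close> with basis labels \<open>q b + j\<close>. Which qubit of a register
  comes first is no restriction, as unitaries may permute basis vectors.\<close>

definition send_qubit :: "complex mat \<Rightarrow> complex mat" where
  "send_qubit \<psi> = (let m = dim_row \<psi> div 2; b = dim_col \<psi> in
     Matrix.mat m (2 * b) (\<lambda>(i, j). \<psi> $$ ((j div b) * m + i, j mod b)))"

datatype ('x, 'y) qstep =
    Alice_Unitary "'x \<Rightarrow> complex mat"
  | Bob_Unitary "'y \<Rightarrow> complex mat"
  | Alice_Qubit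
  | Bob_Qubit

fun apply_qstep :: "'x \<Rightarrow> 'y \<Rightarrow> ('x, 'y) qstep \<Rightarrow> complex mat \<Rightarrow> complex mat" where
  "apply_qstep x y (Alice_Unitary U) \<psi> = U x * \<psi>"
| "apply_qstep x y (Bob_Unitary V) \<psi> = \<psi> * transpose_mat (V y)"
| "apply_qstep x y Alice_Qubit \<psi> = send_qubit \<psi>"
| "apply_qstep x y Bob_Qubit \<psi> = transpose_mat (send_qubit (transpose_mat \<psi>))"

text \<open>\<open>qsteps_ok X Y a b ss\<close>: starting with registers of dimensions \<open>a\<close> and \<open>b\<close>, on all
  inputs every step of \<open>ss\<close> is a unitary of the right dimension or sends an existing qubit.\<close>

fun qsteps_ok :: "'x set \<Rightarrow> 'y set \<Rightarrow> nat \<Rightarrow> nat \<Rightarrow> ('x, 'y) qstep list \<Rightarrow> bool" where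
  "qsteps_ok X Y a b [] = True"
| "qsteps_ok X Y a b (Alice_Unitary U # ss) = ((\<forall>x \<in> X. is_unitary a (U x)) \<and> qsteps_ok X Y a b ss)"
| "qsteps_ok X Y a b (Bob_Unitary V # ss) = ((\<forall>y \<in> Y. is_unitary b (V y)) \<and> qsteps_ok X Y a b ss)"
| "qsteps_ok X Y a b (Alice_Qubit # ss) = (even a \<and> qsteps_ok X Y (a div 2) (2 * b) ss)"
| "qsteps_ok X Y a b (Bob_Qubit # ss) = (even b \<and> qsteps_ok X Y (2 * a) (b div 2) ss)"

text \<open>The initial state is an arbitrary unit vector independent of the inputs (prior
  entanglement, with blank workspace and channel qubits included). After the last step one of the
  players measures their own register in the computational basis and outputs a Boolean function
  of the outcome; as unitaries precede it, this allows any two-outcome measurement by that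
  player.\<close>

record ('x, 'y) qprotocol =
  init_state :: "complex mat"
  steps :: "('x, 'y) qstep list"
  alice_measures :: bool
  decide :: "nat \<Rightarrow> bool"

definition qprotocol_ok :: "'x set \<Rightarrow> 'y set \<Rightarrow> ('x, 'y) qprotocol \<Rightarrow> bool" where
  "qprotocol_ok X Y Q \<longleftrightarrow>
     (\<Sum>i<dim_row (init_state Q). \<Sum>j<dim_col (init_state Q). (cmod (init_state Q $$ (i, j)))\<^sup>2) = 1 \<and>
     qsteps_ok X Y (dim_row (init_state Q)) (dim_col (init_state Q)) (steps Q)"

definition final_state :: "('x, 'y) qprotocol \<Rightarrow> 'x \<Rightarrow> 'y \<Rightarrow> complex mat" where
  "final_state Q x y = fold (apply_qstep x y) (steps Q) (init_state Q)"

definition output_prob :: "('x, 'y) qprotocol \<Rightarrow> 'x \<Rightarrow> 'y \<Rightarrow> bool \<Rightarrow> real" where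
  "output_prob Q x y v = (let \<psi> = final_state Q x y in
     \<Sum>i<dim_row \<psi>. \<Sum>j<dim_col \<psi>.
       if decide Q (if alice_measures Q then i else j) = v then (cmod (\<psi> $$ (i, j)))\<^sup>2 else 0)"

definition qcost :: "('x, 'y) qprotocol \<Rightarrow> nat" where
  "qcost Q = length (filter (\<lambda>s. s = Alice_Qubit \<or> s = Bob_Qubit) (steps Q))"

definition Q_cc :: "real \<Rightarrow> 'x set \<Rightarrow> 'y set \<Rightarrow> ('x \<Rightarrow> 'y \<Rightarrow> bool) \<Rightarrow> nat" where
  "Q_cc \<epsilon> X Y F = (LEAST c. \<exists>Q :: ('x, 'y) qprotocol. qprotocol_ok X Y Q \<and> qcost Q \<le> c \<and>
     (\<forall>x \<in> X. \<forall>y \<in> Y. output_prob Q x y (F x y) \<ge> 1 - \<epsilon>))"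

end

theory Submission
  imports Defs
begin

text \<open>Block sensitivity is at most quadratic in the largest number of sensitive blocks that are pure,
  that is, consist of zeros only or of ones only of the base point: for pairs of half blocks this
  follows from a random walk between the points where one half of each block is flipped. Pure blocks
  of zeros (ones) turn \<open>f\<close> of the AND (OR) into a unique disjointness problem. A protocol exchanging
  \<open>c\<close> qubits has acceptance probabilities that are inner products of vectors of length at most
  \<open>2\<^sup>c\<close>, and pairing them with a pattern matrix built from a dual polynomial of
  pure high degree \<open>\<Omega>(\<surd>s)\<close> shows \<open>c = \<Omega>(\<surd>s)\<close> for \<open>s\<close> pure blocks. The upper bound
  \<open>D \<le> 3 bs\<^sup>3\<close> comes from a decision tree, and randomized protocols are simulated by quantum
  ones with superdense coding.\<close>

section \<open>Decision trees and block sensitivity\<close>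

text \<open>A single gate cannot flip a block that contains both zeros and ones of the base point:
  under AND a block passes from 0 to 1 by joint consent, under OR from 1 to 0. This is why both
  gates occur and why mixed blocks are traded for pure ones. The exponent 1/4 is the product of two
  square-root losses, one in passing to pure blocks and one in the degree \<open>d\<close> of the
  dual polynomial, which needs \<open>41 * d\<^sup>2\<close> points; the cubic decision tree turns
  1/4 into 1/12.

  The reduction determines \<open>f\<close> only if at most one block is flipped. So the dual
  polynomial must put nearly all weight on sets of size 0 and 1, and the rest is bounded by absolute
  values alone.

  Prior entanglement has unbounded dimension. Contractions applied to one fixed unit vector keep all
  estimates free of it.

  As the constants are absolute, the bound must also hold when no qubit is sent, where the
  discrepancy argument only bounds the block sensitivity by a constant. There the reduced state of
  the measuring player does not depend on the other input, and \<open>f\<close> is constant.\<close>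

definition sensitive_blocks :: "'a set \<Rightarrow> ('a set \<Rightarrow> bool) \<Rightarrow> 'a set \<Rightarrow> 'a set set \<Rightarrow> bool" where
  "sensitive_blocks E g A \<B> \<longleftrightarrow> A \<subseteq> E \<and> disjoint \<B> \<and>
     (\<forall>B \<in> \<B>. B \<noteq> {} \<and> B \<subseteq> E \<and> g (sym_diff A B) \<noteq> g A)"

definition blocks_bound :: "'a set \<Rightarrow> ('a set \<Rightarrow> bool) \<Rightarrow> nat \<Rightarrow> bool" where
  "blocks_bound E g k \<longleftrightarrow> (\<forall>A \<B>. sensitive_blocks E g A \<B> \<longrightarrow> card \<B> \<le> k)"

lemma sensitive_blocks_finite:
  "finite E \<Longrightarrow> sensitive_blocks E g A \<B> \<Longrightarrow> finite \<B>"
  unfolding sensitive_blocks_def by (meson Pow_iff finite_Pow_iff finite_subset subsetI)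

lemma sensitive_blocks_insert:
  assumes "sensitive_blocks E g A \<B>" "B \<noteq> {}" "B \<subseteq> E" "g (sym_diff A B) \<noteq> g A" "B \<inter> \<Union>\<B> = {}"
  shows "sensitive_blocks E g A (insert B \<B>)"
  using assms unfolding sensitive_blocks_def disjoint_def by (auto simp: Int_commute)

lemma minimal_sensitive_block:
  assumes "finite B" "B \<noteq> {}" "g (sym_diff A B) \<noteq> g A"
  obtains B' where "B' \<subseteq> B" "B' \<noteq> {}" "g (sym_diff A B') \<noteq> g A"
    "\<And>B''. B'' \<subset> B' \<Longrightarrow> g (sym_diff A B'') = g A"
proof -
  let ?P = "\<lambda>C. C \<subseteq> B \<and> g (sym_diff A C) \<noteq> g A"
  obtain B' where B': "?P B'" and min: "\<And>C. ?P C \<Longrightarrow> card B' \<le> card C"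
    using ex_has_least_nat[of ?P B card] assms by blast
  have "g (sym_diff A B'') = g A" if "B'' \<subset> B'" for B''
  proof (rule ccontr)
    assume "g (sym_diff A B'') \<noteq> g A"
    then have "card B' \<le> card B''" using min B' that by blast
    moreover have "card B'' < card B'"
      using that B' assms(1) by (meson finite_subset psubset_card_mono)
    ultimately show False by simp
  qed
  moreover have "B' \<noteq> {}" using B' by auto
  ultimately show thesis using that B' by blast
qed

text \<open>At the flipped point \<open>sym_diff A B\<close> every single element of a minimal block
  is sensitive, since undoing it leaves a proper subset of \<open>B\<close> flipped. So
  \<open>B\<close> yields \<open>card B\<close> singleton blocks there.\<close>

lemma card_minimal_sensitive_block:
  assumes "finite E" "blocks_bound E g k" "A \<subseteq> E" "B \<subseteq> E"
    and sens: "g (sym_diff A B) \<noteq> g A" and min: "\<And>B'. B' \<subset> B \<Longrightarrow> g (sym_diff A B') = g A"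
  shows "card B \<le> k"
proof -
  let ?\<B> = "(\<lambda>i. {i}) ` B"
  have "g (sym_diff (sym_diff A B) {i}) \<noteq> g (sym_diff A B)" if "i \<in> B" for i
  proof -
    have "sym_diff (sym_diff A B) {i} = sym_diff A (B - {i})" using that by auto
    moreover have "g (sym_diff A (B - {i})) = g A" using that by (intro min) auto
    ultimately show ?thesis using sens by metis
  qed
  then have "sensitive_blocks E g (sym_diff A B) ?\<B>"
    using assms(3,4) unfolding sensitive_blocks_def disjoint_def by (auto 0 3)
  then have "card ?\<B> \<le> k" using assms(2) unfolding blocks_bound_def by blast
  then show ?thesis by (simp add: card_image)
qed

text \<open>The union of a largest family of disjoint minimal sensitive blocks is a certificate. It
  consists of at most \<open>k\<close> blocks of size at most \<open>k\<close>, and a point agreeing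
  with \<open>A\<close> on it but having another value would differ from \<open>A\<close> in a
  further minimal block, disjoint from all others.\<close>

lemma small_certificate:
  assumes fin: "finite E" and bound: "blocks_bound E g k" and A: "A \<subseteq> E"
  obtains C where "C \<subseteq> E" "card C \<le> k * k" "\<And>B. B \<subseteq> E \<Longrightarrow> B \<inter> C = A \<inter> C \<Longrightarrow> g B = g A"
proof -
  let ?min = "\<lambda>B. \<forall>B'. B' \<subset> B \<longrightarrow> g (sym_diff A B') = g A"
  let ?P = "\<lambda>\<B>. sensitive_blocks E g A \<B> \<and> (\<forall>B \<in> \<B>. ?min B)"
  have "?P {}" using A by (auto simp: sensitive_blocks_def disjoint_def)
  moreover have "\<forall>\<B>. ?P \<B> \<longrightarrow> card \<B> < Suc k"
    using bound unfolding blocks_bound_def less_Suc_eq_le by blast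
  ultimately have "\<exists>\<B>. ?P \<B> \<and> (\<forall>\<B>'. ?P \<B>' \<longrightarrow> card \<B>' \<le> card \<B>)"
    by (rule Lattices_Big.ex_has_greatest_nat[of ?P "{}" card "Suc k"])
  then obtain \<B> where opt: "?P \<B> \<and> (\<forall>\<B>'. ?P \<B>' \<longrightarrow> card \<B>' \<le> card \<B>)" ..
  have \<B>: "sensitive_blocks E g A \<B>" and min: "\<And>B. B \<in> \<B> \<Longrightarrow> ?min B"
    using opt by simp_all
  have max: "card \<B>' \<le> card \<B>" if "sensitive_blocks E g A \<B>'" "\<And>B. B \<in> \<B>' \<Longrightarrow> ?min B" for \<B>'
    using opt that by simp
  let ?C = "\<Union>\<B>"
  have fin\<B>: "finite \<B>" using sensitive_blocks_finite[OF fin \<B>] .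
  have "?C \<subseteq> E" using \<B> by (auto simp: sensitive_blocks_def)
  moreover have "card ?C \<le> k * k"
  proof -
    have "card B \<le> k" if "B \<in> \<B>" for B
      using \<B> that min[OF that]
      by (intro card_minimal_sensitive_block[OF fin bound A]) (auto simp: sensitive_blocks_def)
    then have "(\<Sum>B\<in>\<B>. card B) \<le> card \<B> * k"
      using sum_bounded_above[of \<B> card k] by simp
    also have "card \<B> \<le> k" using \<B> bound unfolding blocks_bound_def by simp
    finally have "(\<Sum>B\<in>\<B>. card B) \<le> k * k" by simp
    then show ?thesis using card_Union_le_sum_card[of \<B>] by linarith
  qed
  moreover have "g B = g A" if B: "B \<subseteq> E" "B \<inter> ?C = A \<inter> ?C" for B
  proof (rule ccontr)
    assume ne: "g B \<noteq> g A"
    have eq: "sym_diff A (sym_diff A B) = B" by auto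
    have fd: "finite (sym_diff A B)" using A B fin by (meson finite_subset finite_Un finite_Diff)
    have nonempty: "sym_diff A B \<noteq> {}" using ne by auto
    obtain B' where B': "B' \<subseteq> sym_diff A B" "B' \<noteq> {}" "g (sym_diff A B') \<noteq> g A" "?min B'"
      using minimal_sensitive_block[OF fd nonempty, of g A] ne unfolding eq by blast
    have dis: "B' \<inter> ?C = {}" using B'(1) B(2) by auto
    have "sensitive_blocks E g A (insert B' \<B>)"
      using sensitive_blocks_insert[of E g A \<B> B'] \<B> B' A B dis by auto
    then have "card (insert B' \<B>) \<le> card \<B>" using min B'(4) by (intro max) blast+
    moreover have "B' \<notin> \<B>" using dis B'(2) by auto
    ultimately show False using fin\<B> by simp
  qed
  ultimately show thesis using that by blast
qed

text \<open>\<open>\<Phi>\<close> collects what is known about the inputs, so that the induction can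
  add the answer to one query. Each query costs two bits: Alice sends \<open>\<alpha> x\<close>, Bob
  sends \<open>\<beta> y\<close>, and \<open>op\<close> combines them.\<close>

lemma protocol_query_set:
  fixes z :: "'x \<Rightarrow> 'y \<Rightarrow> 'a set"
  assumes "finite C"
    and query: "\<And>i. i \<in> C \<Longrightarrow> \<exists>\<alpha> \<beta> op. \<forall>x y. (i \<in> z x y) = op (\<alpha> x :: bool) (\<beta> y :: bool)"
    and "\<And>W. \<exists>P. cost P \<le> c \<and> (\<forall>x y. \<Phi> x y \<and> z x y \<inter> C = W \<longrightarrow> run P x y = h x y)"
  shows "\<exists>P. cost P \<le> c + 2 * card C \<and> (\<forall>x y. \<Phi> x y \<longrightarrow> run P x y = h x y)"
  using assms
proof (induction C arbitrary: \<Phi> rule: finite_induct)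
  case empty
  from empty(2)[of "{}"] show ?case by simp
next
  case (insert i C)
  have "\<exists>P. cost P \<le> c + 2 * card C \<and>
      (\<forall>x y. \<Phi> x y \<and> (i \<in> z x y) = v \<longrightarrow> run P x y = h x y)" for v
  proof (rule insert.IH)
    show "\<exists>\<alpha> \<beta> op. \<forall>x y. (j \<in> z x y) = op (\<alpha> x :: bool) (\<beta> y :: bool)" if "j \<in> C" for j
      using insert.prems(1) that by blast
    fix W
    \<comment> \<open>The answers on \<open>C\<close> and the answer \<open>v\<close> on
      \<open>i\<close> combine to answers on \<open>insert i C\<close>; intersecting with
      \<open>C\<close> removes an \<open>i\<close> that \<open>W\<close> might contain.\<close>
    obtain P where "cost P \<le> c" and
      P: "\<forall>x y. \<Phi> x y \<and> z x y \<inter> insert i C = (if v then insert i (W \<inter> C) else W \<inter> C)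
        \<longrightarrow> run P x y = h x y"
      using insert.prems(2)[of "if v then insert i (W \<inter> C) else W \<inter> C"] by (elim exE conjE)
    moreover have "z x y \<inter> insert i C = (if v then insert i (W \<inter> C) else W \<inter> C)"
      if "(i \<in> z x y) = v" "z x y \<inter> C = W" for x y
      using that by auto
    ultimately show "\<exists>P. cost P \<le> c \<and>
        (\<forall>x y. (\<Phi> x y \<and> (i \<in> z x y) = v) \<and> z x y \<inter> C = W \<longrightarrow> run P x y = h x y)"
      by (intro exI[of _ P]) simp
  qed
  then have "\<exists>P. \<forall>v. cost (P v) \<le> c + 2 * card C \<and>
      (\<forall>x y. \<Phi> x y \<and> (i \<in> z x y) = v \<longrightarrow> run (P v) x y = h x y)"
    by (intro choice allI)
  then obtain P where P: "\<And>v. cost (P v) \<le> c + 2 * card C"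
    "\<And>v x y. \<Phi> x y \<Longrightarrow> (i \<in> z x y) = v \<Longrightarrow> run (P v) x y = h x y"
    by blast
  obtain \<alpha> \<beta> op where q: "\<And>x y. (i \<in> z x y) = op (\<alpha> x :: bool) (\<beta> y :: bool)"
    using insert.prems(1)[of i] by blast
  let ?R = "Alice_Sends \<alpha> (Bob_Sends \<beta> (P (op True True)) (P (op True False)))
     (Bob_Sends \<beta> (P (op False True)) (P (op False False)))"
  have "cost ?R \<le> c + 2 * card (insert i C)"
    using P(1)[of "op True True"] P(1)[of "op True False"] P(1)[of "op False True"]
      P(1)[of "op False False"] insert.hyps by simp
  moreover have "run ?R x y = h x y" if "\<Phi> x y" for x y
    using P(2)[OF that q] by auto
  ultimately show ?case by blast
qed

text \<open>The decision tree of Beals, Buhrman, Cleve, Mosca and de Wolf: each round queries a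
  certificate of a consistent point where \<open>g\<close> is true, and provides every consistent point where
  \<open>g\<close> is false with a further sensitive block.\<close>

lemma protocol_rounds:
  fixes z :: "'x \<Rightarrow> 'y \<Rightarrow> 'a set"
  assumes fin: "finite E" and bound: "blocks_bound E g k" and z: "\<And>x y. z x y \<subseteq> E"
    and query: "\<And>i. i \<in> E \<Longrightarrow> \<exists>\<alpha> \<beta> op. \<forall>x y. (i \<in> z x y) = op (\<alpha> x :: bool) (\<beta> y :: bool)"
    and "\<And>y. y \<subseteq> E \<Longrightarrow> y \<inter> Q = a \<inter> Q \<Longrightarrow> \<not> g y \<Longrightarrow>
      \<exists>\<B>. sensitive_blocks E g y \<B> \<and> \<Union>\<B> \<subseteq> Q \<and> k \<le> card \<B> + j"
  shows "\<exists>P. cost P \<le> 2 * (k * k) * j \<and>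
    (\<forall>x y. z x y \<inter> Q = a \<inter> Q \<longrightarrow> run P x y = g (z x y))"
  using assms(5)
proof (induction j arbitrary: Q a)
  \<comment> \<open>The new block consists of the positions of the certificate \<open>C\<close> of
    \<open>y'\<close> where \<open>y\<close> and \<open>y'\<close> differ. Flipping it in
    \<open>y\<close> produces the certificate, so the value becomes true. It misses
    \<open>Q\<close>, where both points agree with \<open>a\<close>, and with \<open>Q\<close> all
    earlier blocks.\<close>
  have extend: "\<exists>\<B>. sensitive_blocks E g y \<B> \<and> \<Union>\<B> \<subseteq> Q \<union> C \<and> Suc k \<le> card \<B> + j"
    if y: "y \<subseteq> E" "y \<inter> Q = a \<inter> Q" "\<not> g y"
      and fam: "\<exists>\<B>. sensitive_blocks E g y \<B> \<and> \<Union>\<B> \<subseteq> Q \<and> k \<le> card \<B> + j"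
      and y': "y' \<subseteq> E" "y' \<inter> Q = a \<inter> Q" "g y'"
      and C: "C \<subseteq> E" "\<And>B. B \<subseteq> E \<Longrightarrow> B \<inter> C = y' \<inter> C \<Longrightarrow> g B = g y'" for Q a y y' j C
  proof -
    obtain \<B> where \<B>: "sensitive_blocks E g y \<B>" "\<Union>\<B> \<subseteq> Q" "k \<le> card \<B> + j" using fam by blast
    let ?B = "C \<inter> sym_diff y y'"
    have B: "?B \<noteq> {}"
    proof
      assume "?B = {}"
      then have "y \<inter> C = y' \<inter> C" by auto
      then show False using C(2)[of y] y y' by auto
    qed
    have dis: "?B \<inter> Q = {}" using y(2) y'(2) by auto
    have "g (sym_diff y ?B) = g y'"
    proof (rule C(2))
      show "sym_diff y ?B \<subseteq> E" using y(1) C(1) by auto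
      show "sym_diff y ?B \<inter> C = y' \<inter> C" by auto
    qed
    then have "sensitive_blocks E g y (insert ?B \<B>)"
      using sensitive_blocks_insert[OF \<B>(1) B] C(1) y(3) y'(3) dis \<B>(2) by blast
    moreover have "\<Union>(insert ?B \<B>) \<subseteq> Q \<union> C" using \<B>(2) by auto
    moreover have "card (insert ?B \<B>) = Suc (card \<B>)"
      using dis B \<B>(2) sensitive_blocks_finite[OF fin \<B>(1)] by (subst card_insert_disjoint) auto
    ultimately show ?thesis using \<B>(3) by (metis Suc_le_mono add_Suc)
  qed
  {
    \<comment> \<open>Every consistent false point now has \<open>k\<close> blocks, and a consistent
      true point would give it one block more than \<open>blocks_bound\<close> allows. So
      \<open>g\<close> is constant on the consistent points.\<close>
    case 0
    show ?case
    proof (cases "(\<exists>y\<subseteq>E. y \<inter> Q = a \<inter> Q \<and> \<not> g y) \<and> (\<exists>y\<subseteq>E. y \<inter> Q = a \<inter> Q \<and> g y)")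
      case True
      then obtain y y' where y: "y \<subseteq> E" "y \<inter> Q = a \<inter> Q" "\<not> g y"
        and y': "y' \<subseteq> E" "y' \<inter> Q = a \<inter> Q" "g y'" by blast
      obtain C where C: "C \<subseteq> E" "\<And>B. B \<subseteq> E \<Longrightarrow> B \<inter> C = y' \<inter> C \<Longrightarrow> g B = g y'"
        using small_certificate[OF fin bound y'(1)] by metis
      from extend[OF y 0[OF y] y' C] obtain \<B> where "sensitive_blocks E g y \<B>" "Suc k \<le> card \<B>"
        by auto
      then have False using bound unfolding blocks_bound_def by fastforce
      then show ?thesis ..
    next
      case False
      then have "\<exists>v. \<forall>y\<subseteq>E. y \<inter> Q = a \<inter> Q \<longrightarrow> g y = v" by metis
      then obtain v where "\<forall>y\<subseteq>E. y \<inter> Q = a \<inter> Q \<longrightarrow> g y = v" ..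
      then show ?thesis using z by (intro exI[of _ "Output v"]) auto
    qed
  next
    case (Suc j)
    show ?case
    proof (cases "\<exists>y\<subseteq>E. y \<inter> Q = a \<inter> Q \<and> g y")
      case False
      then show ?thesis using z by (intro exI[of _ "Output False"]) auto
    next
      case True
      then obtain y' where y': "y' \<subseteq> E" "y' \<inter> Q = a \<inter> Q" "g y'" by blast
      obtain C where C: "C \<subseteq> E" "\<And>B. B \<subseteq> E \<Longrightarrow> B \<inter> C = y' \<inter> C \<Longrightarrow> g B = g y'"
        and cardC: "card C \<le> k * k"
        using small_certificate[OF fin bound y'(1)] by metis
      have "\<exists>P. cost P \<le> 2 * (k * k) * j + 2 * card C \<and>
          (\<forall>x y. z x y \<inter> Q = a \<inter> Q \<longrightarrow> run P x y = g (z x y))"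
      proof (rule protocol_query_set)
        show "finite C" using C(1) fin finite_subset by blast
        show "\<exists>\<alpha> \<beta> op. \<forall>x y. (i \<in> z x y) = op (\<alpha> x :: bool) (\<beta> y :: bool)" if "i \<in> C" for i
          using query C(1) that by blast
        fix W
        show "\<exists>P. cost P \<le> 2 * (k * k) * j \<and>
          (\<forall>x y. z x y \<inter> Q = a \<inter> Q \<and> z x y \<inter> C = W \<longrightarrow> run P x y = g (z x y))"
        proof (cases "\<exists>b. b \<inter> Q = a \<inter> Q \<and> b \<inter> C = W")
          case True
          then obtain b where b: "b \<inter> Q = a \<inter> Q" "b \<inter> C = W" by blast
          have "\<exists>P. cost P \<le> 2 * (k * k) * j \<and>
             (\<forall>x y. z x y \<inter> (Q \<union> C) = b \<inter> (Q \<union> C) \<longrightarrow> run P x y = g (z x y))"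
          proof (rule Suc.IH)
            fix y assume y: "y \<subseteq> E" "y \<inter> (Q \<union> C) = b \<inter> (Q \<union> C)" "\<not> g y"
            have yQ: "y \<inter> Q = a \<inter> Q" using y(2) b(1) by blast
            show "\<exists>\<B>. sensitive_blocks E g y \<B> \<and> \<Union>\<B> \<subseteq> Q \<union> C \<and> k \<le> card \<B> + j"
              using extend[OF y(1) yQ y(3) Suc.prems[OF y(1) yQ y(3)] y' C] by simp
          qed
          moreover have "z x y \<inter> (Q \<union> C) = b \<inter> (Q \<union> C)"
            if "z x y \<inter> Q = a \<inter> Q \<and> z x y \<inter> C = W" for x y
            using that b by blast
          ultimately show ?thesis by (elim ex_forward conj_forward) simp_all
        next
          \<comment> \<open>No point consistent with \<open>a\<close> gives the answers
            \<open>W\<close>, so any output will do.\<close>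
          case False
          then show ?thesis by (intro exI[of _ "Output False"]) auto
        qed
      qed
      moreover have "2 * (k * k) * j + 2 * card C \<le> 2 * (k * k) * Suc j" using cardC by simp
      ultimately show ?thesis using le_trans by blast
    qed
  }
qed

text \<open>There are \<open>k\<close> rounds, each querying at most \<open>k * k\<close> elements
  at two bits per element. Before the first round no block is required, so the empty family
  serves.\<close>

lemma protocol_from_blocks_bound:
  fixes z :: "'x \<Rightarrow> 'y \<Rightarrow> 'a set"
  assumes "finite E" and "blocks_bound E g k" and "\<And>x y. z x y \<subseteq> E"
    and "\<And>i. i \<in> E \<Longrightarrow> \<exists>\<alpha> \<beta> op. \<forall>x y. (i \<in> z x y) = op (\<alpha> x :: bool) (\<beta> y :: bool)"
  shows "\<exists>P. cost P \<le> 2 * k ^ 3 \<and> (\<forall>x y. run P x y = g (z x y))"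
proof -
  have "\<exists>P. cost P \<le> 2 * (k * k) * k \<and> (\<forall>x y. z x y \<inter> {} = {} \<inter> {} \<longrightarrow> run P x y = g (z x y))"
  proof (rule protocol_rounds[OF assms])
    show "\<exists>\<B>. sensitive_blocks E g y \<B> \<and> \<Union>\<B> \<subseteq> {} \<and> k \<le> card \<B> + k" if "y \<subseteq> E" for y
      using that by (intro exI[of _ "{}"]) (auto simp: sensitive_blocks_def disjoint_def)
  qed
  then show ?thesis by (simp add: power3_eq_cube mult.assoc)
qed

section \<open>Pure blocks\<close>

lemma Suc_times_choose_Suc: "Suc m * (k choose Suc m) = (k - m) * (k choose m)"
  by (metis binomial_absorb_comp binomial_absorption)

text \<open>Double counting of the pairs \<open>(P, j)\<close> with \<open>P\<close> a deviating set
  of size \<open>Suc m\<close> and \<open>j\<close> in \<open>P\<close>. Without \<open>j\<close>,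
  either the smaller set deviates already, or \<open>j\<close> is sensitive there, for which there
  are at most \<open>s\<close> choices.\<close>

lemma deviation_recurrence:
  fixes u :: "'a set \<Rightarrow> bool"
  assumes fin: "finite J"
    and sens: "\<And>P. P \<subseteq> J \<Longrightarrow> card {j \<in> J - P. u (insert j P) \<noteq> u P} \<le> s"
  defines "N \<equiv> \<lambda>m. card {P. P \<subseteq> J \<and> card P = m \<and> u P \<noteq> u {}}"
  shows "Suc m * N (Suc m) \<le> N m * (card J - m) + (card J choose m) * s"
proof -
  let ?L = "\<lambda>m. {P. P \<subseteq> J \<and> card P = m}"
  let ?bad = "\<lambda>m. {P. P \<subseteq> J \<and> card P = m \<and> u P \<noteq> u {}}"
  let ?next = "\<lambda>P. {j \<in> J - P. u (insert j P) \<noteq> u {}}"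
  have finL: "finite (?L m)" "finite (?bad m)" for m
    using fin by (auto intro: finite_subset[OF _ finite_Pow_iff[THEN iffD2, OF fin]])
  have "Suc m * N (Suc m) = (\<Sum>P\<in>?bad (Suc m). card P)"
    unfolding N_def by simp
  also have "\<dots> = card (SIGMA P:?bad (Suc m). P)"
    using fin by (subst card_SigmaI) (auto simp: finL intro: finite_subset)
  also have "\<dots> \<le> card (SIGMA P:?L m. ?next P)"
  proof (rule card_inj_on_le)
    show "inj_on (\<lambda>(P, j). (P - {j}, j)) (SIGMA P:?bad (Suc m). P)"
      by (auto simp: inj_on_def)
    show "(\<lambda>(P, j). (P - {j}, j)) ` (SIGMA P:?bad (Suc m). P) \<subseteq> (SIGMA P:?L m. ?next P)"
      using fin by (auto simp: insert_absorb)
    show "finite (SIGMA P:?L m. ?next P)"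
      using fin finL by auto
  qed
  also have "\<dots> = (\<Sum>P\<in>?L m. card (?next P))"
    using fin finL by (subst card_SigmaI) auto
  also have "\<dots> \<le> (\<Sum>P\<in>?L m. (if u P \<noteq> u {} then card J - m else 0) + s)"
  proof (rule sum_mono)
    fix P assume P: "P \<in> ?L m"
    show "card (?next P) \<le> (if u P \<noteq> u {} then card J - m else 0) + s"
    proof (cases "u P = u {}")
      case True
      then show ?thesis using sens[of P] P by simp
    next
      case False
      have "card (?next P) \<le> card (J - P)" using fin by (intro card_mono) auto
      also have "\<dots> = card J - m" using P fin by (auto simp: card_Diff_subset finite_subset)
      finally show ?thesis using False by simp
    qed
  qed
  also have "\<dots> = (\<Sum>P\<in>?L m. if u P \<noteq> u {} then card J - m else 0) + card (?L m) * s"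
    by (simp add: sum.distrib)
  also have "(\<Sum>P\<in>?L m. if u P \<noteq> u {} then card J - m else 0) = N m * (card J - m)"
    using finL by (subst sum.inter_filter[symmetric]) (auto simp: N_def conj_assoc)
  also have "card (?L m) = card J choose m" by (simp add: n_subsets[OF fin])
  finally show ?thesis .
qed

text \<open>A random set of size \<open>m\<close> arises by \<open>m\<close> random enlargements,
  each of which changes the value with probability at most \<open>s / (card J - M)\<close>. The
  bound \<open>M\<close> keeps the denominator fixed along the induction.\<close>

lemma deviation_bound:
  fixes u :: "'a set \<Rightarrow> bool"
  assumes fin: "finite J"
    and sens: "\<And>P. P \<subseteq> J \<Longrightarrow> card {j \<in> J - P. u (insert j P) \<noteq> u P} \<le> s"
    and "m \<le> M" "M < card J"
  shows "real (card {P. P \<subseteq> J \<and> card P = m \<and> u P \<noteq> u {}})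
    \<le> real (card J choose m) * (real m * real s / (real (card J) - real M))"
  using assms(3)
proof (induction m)
  case 0
  have "{P. P \<subseteq> J \<and> card P = 0 \<and> u P \<noteq> u {}} = {}"
    using fin by (auto dest: finite_subset)
  then have "card {P. P \<subseteq> J \<and> card P = 0 \<and> u P \<noteq> u {}} = 0" by (simp only: card.empty)
  then show ?case by simp
next
  case (Suc m)
  let ?N = "\<lambda>m. real (card {P. P \<subseteq> J \<and> card P = m \<and> u P \<noteq> u {}})"
  let ?k = "real (card J)" and ?C = "\<lambda>m. real (card J choose m)"
  define D where "D = ?k - real M"
  have D: "D > 0" "D \<le> ?k - real m" using assms(4) Suc.prems by (auto simp: D_def)
  have "real (Suc m * card {P. P \<subseteq> J \<and> card P = Suc m \<and> u P \<noteq> u {}})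
      \<le> real (card {P. P \<subseteq> J \<and> card P = m \<and> u P \<noteq> u {}} * (card J - m) + (card J choose m) * s)"
    using deviation_recurrence[OF fin sens, of m] by (simp only: of_nat_le_iff)
  then have "real (Suc m) * ?N (Suc m) \<le> ?N m * (?k - real m) + ?C m * real s"
    unfolding of_nat_mult of_nat_add using Suc.prems assms(4) by (simp only: of_nat_diff)
  also have "\<dots> \<le> ?C m * (real m * real s / D) * (?k - real m) + ?C m * (real s / D) * (?k - real m)"
  proof (rule add_mono)
    show "?N m * (?k - real m) \<le> ?C m * (real m * real s / D) * (?k - real m)"
      using Suc D by (intro mult_right_mono) (auto simp: D_def)
    have "real s * D \<le> real s * (?k - real m)" using D by (intro mult_left_mono) auto
    then have "real s \<le> real s / D * (?k - real m)" using D by (simp add: field_simps)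
    then have "?C m * real s \<le> ?C m * (real s / D * (?k - real m))"
      by (rule mult_left_mono) simp
    then show "?C m * real s \<le> ?C m * (real s / D) * (?k - real m)"
      by (simp only: mult.assoc)
  qed
  also have "\<dots> = (?C m * (?k - real m)) * (real (Suc m) * real s / D)"
    by (simp add: algebra_simps add_divide_distrib diff_divide_distrib)
  also have "?C m * (?k - real m) = real ((card J - m) * (card J choose m))"
    using Suc.prems assms(4) by (simp add: of_nat_diff)
  also have "\<dots> = real (Suc m) * ?C (Suc m)"
    by (metis Suc_times_choose_Suc of_nat_mult)
  finally have "real (Suc m) * ?N (Suc m) \<le> real (Suc m) * (?C (Suc m) * (real (Suc m) * real s / D))"
    by (simp add: mult.assoc)
  then show ?case unfolding D_def by (subst (asm) mult_le_cancel_left_pos) auto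
qed

text \<open>Starting from \<open>({}, {})\<close> or \<open>({i}, {i})\<close> and enlarging the first argument at random, the value
  of \<open>h\<close> rarely changes, so at a random \<open>(P, {})\<close> almost every \<open>i \<in> P\<close> is sensitive in the second
  argument.\<close>

lemma pair_sensitivity_bound:
  fixes h :: "'a set \<Rightarrow> 'a set \<Rightarrow> bool"
  assumes fin: "finite I" and s: "s \<ge> 1"
    and sens1: "\<And>P R. P \<subseteq> I \<Longrightarrow> R \<subseteq> I \<Longrightarrow> card {j \<in> I - P. h (insert j P) R \<noteq> h P R} \<le> s"
    and sens2: "\<And>P R. P \<subseteq> I \<Longrightarrow> R \<subseteq> I \<Longrightarrow> card {j \<in> I - R. h P (insert j R) \<noteq> h P R} \<le> s"
    and base: "\<And>i. i \<in> I \<Longrightarrow> h {i} {i} \<noteq> h {} {}"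
  shows "card I \<le> 10 * s * s"
proof (rule ccontr)
  assume neg: "\<not> card I \<le> 10 * s * s"
  \<comment> \<open>For \<open>m = 2 * s\<close> at most half of all pairs \<open>(P, i)\<close>
    with \<open>i\<close> in \<open>P\<close> are sensitive in the second argument. The others must
    come from deviations, which is impossible once \<open>card I\<close> is large compared with
    \<open>s * s\<close>.\<close>
  define k m where "k = card I" and "m = 2 * s"
  have k: "k > 10 * s * s" using neg by (simp add: k_def)
  moreover have "10 * s * s \<ge> 10 * s" using s by simp
  ultimately have mk: "m < k" "m \<ge> 2" using s unfolding m_def by linarith+
  let ?L = "{P. P \<subseteq> I \<and> card P = m}"
  define C where "C = real (k choose m)"
  have C: "C > 0" using mk by (simp add: C_def)
  have finP: "finite P" if "P \<subseteq> I" for P using fin that finite_subset by blast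
  have finL: "finite ?L" using fin by (auto intro: finite_subset[OF _ finite_Pow_iff[THEN iffD2, OF fin]])
  have cardL: "card ?L = k choose m" by (simp add: n_subsets[OF fin] k_def)
  \<comment> \<open>The three possible changes on the way from \<open>h {} {}\<close> over
    \<open>h P {}\<close> and \<open>h P {i}\<close> to \<open>h {i} {i}\<close>. As the two ends
    differ, every pair shows at least one of them.\<close>
  define S S1 S2 S3 where "S = (SIGMA P:?L. P)"
    and "S1 = (SIGMA P:?L. {i \<in> P. h P {i} \<noteq> h P {}})"
    and "S2 = (SIGMA P:{P. P \<subseteq> I \<and> card P = m \<and> h P {} \<noteq> h {} {}}. P)"
    and "S3 = (SIGMA P:?L. {i \<in> P. h P {i} \<noteq> h {i} {i}})"
  have finS: "finite S" unfolding S_def using finL finP by auto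
  have sub: "S1 \<subseteq> S" "S2 \<subseteq> S" "S3 \<subseteq> S" unfolding S_def S1_def S2_def S3_def by auto
  have cardS: "real (card S) = real m * C"
  proof -
    have "card S = (\<Sum>P\<in>?L. card P)" unfolding S_def using finL finP by (subst card_SigmaI) auto
    also have "\<dots> = card ?L * m" by simp
    finally show ?thesis by (simp add: cardL C_def mult.commute)
  qed
  have "S \<subseteq> S1 \<union> S2 \<union> S3"
  proof
    fix p assume "p \<in> S"
    then obtain P i where p: "p = (P, i)" "P \<subseteq> I" "card P = m" "i \<in> P" by (auto simp: S_def)
    then have "h {i} {i} \<noteq> h {} {}" using base by blast
    then show "p \<in> S1 \<union> S2 \<union> S3" using p by (auto simp: S1_def S2_def S3_def)
  qed
  then have "card S \<le> card (S1 \<union> S2 \<union> S3)"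
    using sub finS by (intro card_mono) (auto intro: finite_subset)
  also have "\<dots> \<le> card S1 + card S2 + card S3"
    by (meson add_mono card_Un_le le_refl le_trans)
  finally have total: "real (card S) \<le> real (card S1) + real (card S2) + real (card S3)" by linarith
  have c1: "real (card S1) \<le> C * real s"
  proof -
    have "card S1 = (\<Sum>P\<in>?L. card {i \<in> P. h P {i} \<noteq> h P {}})"
      unfolding S1_def using finL finP by (subst card_SigmaI) auto
    also have "\<dots> \<le> (\<Sum>P\<in>?L. s)"
    proof (rule sum_mono)
      fix P assume P: "P \<in> ?L"
      have "card {i \<in> P. h P {i} \<noteq> h P {}} \<le> card {j \<in> I - {}. h P (insert j {}) \<noteq> h P {}}"
        using fin P by (intro card_mono) auto
      also have "\<dots> \<le> s" using P by (intro sens2) auto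
      finally show "card {i \<in> P. h P {i} \<noteq> h P {}} \<le> s" .
    qed
    also have "\<dots> = (k choose m) * s" by (simp add: cardL)
    finally have "real (card S1) \<le> real ((k choose m) * s)" by (simp only: of_nat_le_iff)
    then show ?thesis unfolding C_def by (simp only: of_nat_mult)
  qed
  define r where "r = real s / (real k - real m)"
  have kk: "real k - real m > 0" using mk by simp
  have r: "r \<ge> 0" unfolding r_def using kk by simp
  have c2: "real (card S2) \<le> real m * (C * (real m * r))"
  proof -
    have "card S2 = (\<Sum>P\<in>{P. P \<subseteq> I \<and> card P = m \<and> h P {} \<noteq> h {} {}}. card P)"
      unfolding S2_def using finP by (subst card_SigmaI) (auto intro: finite_subset[OF _ finL])
    also have "\<dots> = card {P. P \<subseteq> I \<and> card P = m \<and> h P {} \<noteq> h {} {}} * m" by simp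
    finally have "real (card S2) = real m * real (card {P. P \<subseteq> I \<and> card P = m \<and> h P {} \<noteq> h {} {}})"
      by simp
    also have "real (card {P. P \<subseteq> I \<and> card P = m \<and> h P {} \<noteq> h {} {}})
        \<le> real (card I choose m) * (real m * real s / (real (card I) - real m))"
      using mk sens1 by (intro deviation_bound[OF fin, of "\<lambda>P. h P {}"]) (auto simp: k_def)
    finally show ?thesis unfolding C_def k_def r_def by (simp add: mult_left_mono)
  qed
  have c3: "real (card S3) \<le> real m * (C * (real m * r))"
  proof -
    \<comment> \<open>This walk starts at \<open>h {i} {i}\<close>, so \<open>i\<close> is fixed and
      the other \<open>m - 1\<close> elements are drawn from \<open>I - {i}\<close>.\<close>
    let ?bad = "\<lambda>i. {Q. Q \<subseteq> I - {i} \<and> card Q = m - 1 \<and> h (insert i Q) {i} \<noteq> h (insert i {}) {i}}"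
    have finbad: "finite (?bad i)" for i
      using fin by (auto intro: finite_subset[OF _ finite_Pow_iff[THEN iffD2, OF fin]])
    have "card S3 \<le> card (SIGMA i:I. ?bad i)"
    proof (rule card_inj_on_le)
      show "inj_on (\<lambda>(P, i). (i, P - {i})) S3"
        unfolding S3_def inj_on_def by auto
      show "(\<lambda>(P, i). (i, P - {i})) ` S3 \<subseteq> (SIGMA i:I. ?bad i)"
        unfolding S3_def using finP by (auto simp: insert_absorb)
      show "finite (SIGMA i:I. ?bad i)" using fin finbad by auto
    qed
    also have "\<dots> = (\<Sum>i\<in>I. card (?bad i))" using fin finbad by (subst card_SigmaI) auto
    finally have "real (card S3) \<le> real (\<Sum>i\<in>I. card (?bad i))" by (simp only: of_nat_le_iff)
    also have "\<dots> = (\<Sum>i\<in>I. real (card (?bad i)))" by (rule of_nat_sum)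
    also have "\<dots> \<le> (\<Sum>i\<in>I. real ((k - 1) choose (m - 1)) * (real m * r))"
    proof (rule sum_mono)
      fix i assume i: "i \<in> I"
      have cardJ: "card (I - {i}) = k - 1" using i fin by (simp add: k_def)
      have "card {j \<in> I - {i} - P. h (insert i (insert j P)) {i} \<noteq> h (insert i P) {i}} \<le> s"
        if "P \<subseteq> I - {i}" for P
      proof -
        have "{j \<in> I - {i} - P. h (insert i (insert j P)) {i} \<noteq> h (insert i P) {i}}
          = {j \<in> I - insert i P. h (insert j (insert i P)) {i} \<noteq> h (insert i P) {i}}"
          by (auto simp: insert_commute)
        then show ?thesis using sens1[of "insert i P" "{i}"] that i by auto
      qed
      then have "real (card (?bad i)) \<le> real (card (I - {i}) choose (m - 1)) *
          (real (m - 1) * real s / (real (card (I - {i})) - real (m - 1)))"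
        using fin mk cardJ by (intro deviation_bound[of "I - {i}" "\<lambda>Q. h (insert i Q) {i}"]) auto
      also have "real (m - 1) * real s / (real (card (I - {i})) - real (m - 1)) \<le> real m * r"
      proof -
        have "real (card (I - {i})) - real (m - 1) = real k - real m"
          using mk by (simp add: cardJ of_nat_diff)
        then show ?thesis unfolding r_def using kk by (simp add: divide_right_mono mult_right_mono)
      qed
      finally show "real (card (?bad i)) \<le> real ((k - 1) choose (m - 1)) * (real m * r)"
        by (simp add: cardJ mult_left_mono)
    qed
    also have "\<dots> = real (k * ((k - 1) choose (m - 1))) * (real m * r)" by (simp add: k_def)
    also have "k * ((k - 1) choose (m - 1)) = m * (k choose m)"
      using binomial_absorption[of "m - 1" k] mk by simp
    finally show ?thesis by (simp add: C_def)
  qed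
  \<comment> \<open>After division by \<open>C\<close> and with \<open>m = 2 * s\<close> this
    becomes \<open>k \<le> 8 * s * s + 2 * s\<close>, whence the constant 10.\<close>
  have "real m * C \<le> C * real s + 2 * (real m * (C * (real m * r)))"
    using total c1 c2 c3 cardS by linarith
  then have "C * real m \<le> C * (real s + 2 * (real m * (real m * r)))"
    by (simp add: algebra_simps)
  then have "real m \<le> real s + 2 * (real m * (real m * r))" using C by simp
  then have "real s \<le> 8 * real s * real s * r" by (simp add: m_def)
  then have "real s * (real k - real m) \<le> 8 * real s * real s * real s"
    using kk by (simp add: r_def field_simps)
  then have "real k - real m \<le> 8 * real s * real s" using s by (simp add: mult.commute)
  then have "real k \<le> real (8 * s * s + 2 * s)" by (simp add: m_def)
  then have "k \<le> 8 * s * s + 2 * s" by (simp only: of_nat_le_iff)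
  then show False using k s mult_le_mono1[OF s, of s] by simp
qed

lemma card_image_blocks:
  assumes "disjoint \<B>" "\<C> \<subseteq> \<B>" "\<And>B. B \<in> \<C> \<Longrightarrow> \<phi> B \<noteq> {} \<and> \<phi> B \<subseteq> B"
  shows "disjoint (\<phi> ` \<C>)" "card (\<phi> ` \<C>) = card \<C>"
proof -
  have dis: "\<phi> B \<inter> \<phi> B' = {}" if "B \<in> \<C>" "B' \<in> \<C>" "B \<noteq> B'" for B B'
    using assms(1,2) assms(3)[OF that(1)] assms(3)[OF that(2)] that unfolding disjoint_def by blast
  have "inj_on \<phi> \<C>"
  proof (rule inj_onI, rule ccontr)
    fix B B' assume "B \<in> \<C>" "B' \<in> \<C>" "\<phi> B = \<phi> B'" "B \<noteq> B'"
    then show False using dis assms(3)[of B] by fastforce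
  qed
  then show "card (\<phi> ` \<C>) = card \<C>" by (rule card_image)
  show "disjoint (\<phi> ` \<C>)" unfolding disjoint_def using dis by blast
qed

text \<open>Every block splits into the zeros and the ones of \<open>A\<close> that it contains, and
  flipping these halves independently gives a function of two families of blocks. A half that is
  sensitive at \<open>pt P R\<close> is a pure block there, so \<open>s\<close> bounds the
  sensitivity in each argument separately.\<close>

lemma sensitive_blocks_le_pure:
  assumes fin: "finite E" and s: "s \<ge> 1" and \<B>: "sensitive_blocks E g A \<B>"
    and pure: "\<And>A \<C>. sensitive_blocks E g A \<C> \<Longrightarrow> \<Union>\<C> \<inter> A = {} \<or> \<Union>\<C> \<subseteq> A \<Longrightarrow> card \<C> \<le> s"
  shows "card \<B> \<le> 10 * s * s"
proof (rule pair_sensitivity_bound[OF _ s])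
  \<comment> \<open>The zero halves of the blocks in \<open>P\<close> and the one halves of the
    blocks in \<open>R\<close> are flipped.\<close>
  define pt where "pt = (\<lambda>P R. (A \<union> \<Union>P) - (\<Union>R \<inter> A))"
  let ?h = "\<lambda>P R. g (pt P R)"
  note defs = \<B>[unfolded sensitive_blocks_def]
  have A: "A \<subseteq> E" and dis: "disjoint \<B>" and sub: "\<And>B. B \<in> \<B> \<Longrightarrow> B \<subseteq> E"
    and sens: "\<And>B. B \<in> \<B> \<Longrightarrow> g (sym_diff A B) \<noteq> g A" using defs by auto
  have disj: "B \<inter> \<Union>P = {}" if "B \<in> \<B>" "P \<subseteq> \<B>" "B \<notin> P" for B P
  proof -
    have "B \<inter> C = {}" if "C \<in> P" for C
      using disjointD[OF dis, of B C] that \<open>B \<in> \<B>\<close> \<open>P \<subseteq> \<B>\<close> \<open>B \<notin> P\<close> by auto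
    then show ?thesis by auto
  qed
  have ptE: "pt P R \<subseteq> E" if "P \<subseteq> \<B>" for P R using A sub that unfolding pt_def by blast
  show "finite \<B>" using sensitive_blocks_finite[OF fin \<B>] .
  show "card {j \<in> \<B> - P. ?h (insert j P) R \<noteq> ?h P R} \<le> s" if PR: "P \<subseteq> \<B>" "R \<subseteq> \<B>" for P R
  proof -
    let ?\<C> = "{j \<in> \<B> - P. ?h (insert j P) R \<noteq> ?h P R}"
    have eq: "sym_diff (pt P R) (j - A) = pt (insert j P) R" if "j \<in> \<B> - P" for j
      using disj[of j P] that PR unfolding pt_def by auto
    have ne: "j - A \<noteq> {} \<and> j - A \<subseteq> j" if "j \<in> ?\<C>" for j using eq[of j] that by fastforce
    have im: "disjoint ((\<lambda>j. j - A) ` ?\<C>)" "card ((\<lambda>j. j - A) ` ?\<C>) = card ?\<C>"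
      using card_image_blocks[OF dis, of ?\<C> "\<lambda>j. j - A"] ne by blast+
    have "B \<noteq> {} \<and> B \<subseteq> E \<and> g (sym_diff (pt P R) B) \<noteq> g (pt P R)"
      if B: "B \<in> (\<lambda>j. j - A) ` ?\<C>" for B
    proof -
      obtain j where j: "j \<in> ?\<C>" "B = j - A" using B by blast
      then show ?thesis using ne[OF j(1)] sub[of j] eq[of j] by auto
    qed
    then have "sensitive_blocks E g (pt P R) ((\<lambda>j. j - A) ` ?\<C>)"
      unfolding sensitive_blocks_def using ptE[OF PR(1)] im(1) by blast
    moreover have "\<Union>((\<lambda>j. j - A) ` ?\<C>) \<inter> pt P R = {}"
      using disj PR unfolding pt_def by blast
    ultimately have "card ((\<lambda>j. j - A) ` ?\<C>) \<le> s" using pure by blast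
    then show ?thesis using im(2) by simp
  qed
  show "card {j \<in> \<B> - R. ?h P (insert j R) \<noteq> ?h P R} \<le> s" if PR: "P \<subseteq> \<B>" "R \<subseteq> \<B>" for P R
  proof -
    let ?\<C> = "{j \<in> \<B> - R. ?h P (insert j R) \<noteq> ?h P R}"
    have inpt: "j \<inter> A \<subseteq> pt P R" if "j \<in> \<B> - R" for j
      using disj[of j R] that PR unfolding pt_def by auto
    have eq: "sym_diff (pt P R) (j \<inter> A) = pt P (insert j R)" if "j \<in> \<B> - R" for j
      using inpt[OF that] unfolding pt_def by auto
    have ne: "j \<inter> A \<noteq> {} \<and> j \<inter> A \<subseteq> j" if "j \<in> ?\<C>" for j using eq[of j] that by fastforce
    have im: "disjoint ((\<lambda>j. j \<inter> A) ` ?\<C>)" "card ((\<lambda>j. j \<inter> A) ` ?\<C>) = card ?\<C>"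
      using card_image_blocks[OF dis, of ?\<C> "\<lambda>j. j \<inter> A"] ne by blast+
    have "B \<noteq> {} \<and> B \<subseteq> E \<and> g (sym_diff (pt P R) B) \<noteq> g (pt P R)"
      if B: "B \<in> (\<lambda>j. j \<inter> A) ` ?\<C>" for B
    proof -
      obtain j where j: "j \<in> ?\<C>" "B = j \<inter> A" using B by blast
      then show ?thesis using ne[OF j(1)] sub[of j] eq[of j] by auto
    qed
    then have "sensitive_blocks E g (pt P R) ((\<lambda>j. j \<inter> A) ` ?\<C>)"
      unfolding sensitive_blocks_def using ptE[OF PR(1)] im(1) by blast
    moreover have "\<Union>((\<lambda>j. j \<inter> A) ` ?\<C>) \<subseteq> pt P R" using inpt by blast
    ultimately have "card ((\<lambda>j. j \<inter> A) ` ?\<C>) \<le> s" using pure by blast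
    then show ?thesis using im(2) by simp
  qed
  show "?h {B} {B} \<noteq> ?h {} {}" if "B \<in> \<B>" for B
  proof -
    have "pt {B} {B} = sym_diff A B" "pt {} {} = A" unfolding pt_def by auto
    then show ?thesis using sens[OF that] by simp
  qed
qed

section \<open>Bit strings as sets\<close>

lemma length_char_vec [simp]: "length (char_vec n A) = n"
  by (simp add: char_vec_def)

text \<open>Blocks are subsets of \<open>{1..n}\<close>, while list positions start at 0; hence the
  shift.\<close>

lemma nth_char_vec [simp]: "i < n \<Longrightarrow> char_vec n A ! i \<longleftrightarrow> Suc i \<in> A"
  by (simp add: char_vec_def del: upt_Suc)

lemma char_vec_bits [simp]: "char_vec n A \<in> bits n"
  by (simp add: bits_def)

lemma bits_eq_char_vec: "z \<in> bits n \<Longrightarrow> z = char_vec n {i \<in> {1..n}. z ! (i - 1)}"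
  by (rule nth_equalityI) (auto simp: bits_def)

lemma finite_bits: "finite (bits n)"
  unfolding bits_def using finite_lists_length_eq[of "UNIV :: bool set" n] by simp

lemma bit_xor_char_vec: "bit_xor (char_vec n A) (char_vec n B) = char_vec n (sym_diff A B)"
  unfolding bit_xor_def by (rule nth_equalityI) auto

lemma bit_and_char_vec: "bit_and (char_vec n A) (char_vec n B) = char_vec n (A \<inter> B)"
  unfolding bit_and_def by (rule nth_equalityI) auto

lemma bit_or_char_vec: "bit_or (char_vec n A) (char_vec n B) = char_vec n (A \<union> B)"
  unfolding bit_or_def by (rule nth_equalityI) auto

text \<open>This makes the \<open>Max\<close> in \<open>block_sensitivity\<close> the maximum of a
  finite set.\<close>

lemma card_sensitive_blocks_le:
  fixes g :: "nat set \<Rightarrow> bool"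
  assumes "sensitive_blocks {1..n} g A \<B>"
  shows "card \<B> \<le> n"
proof -
  have fin: "finite \<B>" using sensitive_blocks_finite assms by blast
  have B: "B \<subseteq> {1..n} \<and> card B \<ge> 1" if "B \<in> \<B>" for B
  proof -
    have "B \<subseteq> {1..n}" "B \<noteq> {}" using assms that by (auto simp: sensitive_blocks_def)
    then show ?thesis by (metis One_nat_def Suc_leI card_gt_0_iff finite_atLeastAtMost finite_subset)
  qed
  have "card \<B> \<le> (\<Sum>B\<in>\<B>. card B)" using B sum_mono[of \<B> "\<lambda>_. 1" card] by simp
  also have "\<dots> = card (\<Union>\<B>)"
  proof (rule card_Union_disjoint[symmetric])
    show "disjoint \<B>" using assms by (simp add: sensitive_blocks_def)
    show "finite B" if "B \<in> \<B>" for B using B[OF that] by (simp add: finite_subset[of B "{1..n}"])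
  qed
  also have "\<dots> \<le> card {1..n}" using B by (intro card_mono) auto
  finally show ?thesis by simp
qed

definition cube_fun :: "nat \<Rightarrow> (bool list \<Rightarrow> bool) \<Rightarrow> nat set \<Rightarrow> bool" where
  "cube_fun n f A = f (char_vec n A)"

text \<open>Passes from the indexed families of the definition to sets of blocks. No block is lost:
  nonempty disjoint blocks are distinct, so the indexing is injective.\<close>

lemma block_family_iff:
  "(\<exists>z \<in> bits n. \<exists>S :: nat \<Rightarrow> nat set.
     (\<forall>i \<in> {1..k}. S i \<noteq> {} \<and> S i \<subseteq> {1..n}) \<and> disjoint_family_on S {1..k} \<and>
     (\<forall>i \<in> {1..k}. f (bit_xor z (char_vec n (S i))) \<noteq> f z)) \<longleftrightarrow>
   (\<exists>A \<B>. sensitive_blocks {1..n} (cube_fun n f) A \<B> \<and> card \<B> = k)"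
  (is "?L = ?R")
proof
  assume ?L
  then obtain z S where z: "z \<in> bits n"
    and S: "\<And>i. i \<in> {1..k} \<Longrightarrow> S i \<noteq> {} \<and> S i \<subseteq> {1..n}" "disjoint_family_on S {1..k}"
    and ne: "\<And>i. i \<in> {1..k} \<Longrightarrow> f (bit_xor z (char_vec n (S i))) \<noteq> f z" by blast
  define A where "A = {i \<in> {1..n}. z ! (i - 1)}"
  have zA: "z = char_vec n A" unfolding A_def by (rule bits_eq_char_vec[OF z])
  have inj: "inj_on S {1..k}"
  proof (rule inj_onI, rule ccontr)
    fix i j assume "i \<in> {1..k}" "j \<in> {1..k}" "S i = S j" "i \<noteq> j"
    then show False using S(1)[of i] disjoint_family_onD[OF S(2), of i j] by auto
  qed
  have "sensitive_blocks {1..n} (cube_fun n f) A (S ` {1..k})"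
    unfolding sensitive_blocks_def
  proof (intro conjI ballI)
    show "A \<subseteq> {1..n}" by (auto simp: A_def)
    show "disjoint (S ` {1..k})" using S(2) by (rule disjoint_family_on_disjoint_image)
    fix B assume "B \<in> S ` {1..k}"
    then obtain i where i: "i \<in> {1..k}" "B = S i" by blast
    show "B \<noteq> {}" "B \<subseteq> {1..n}" using S(1)[OF i(1)] i(2) by auto
    show "cube_fun n f (sym_diff A B) \<noteq> cube_fun n f A"
      using ne[OF i(1)] i(2) unfolding zA cube_fun_def bit_xor_char_vec by simp
  qed
  moreover have "card (S ` {1..k}) = k" using inj by (simp add: card_image)
  ultimately show ?R by blast
next
  assume ?R
  then obtain A \<B> where s: "sensitive_blocks {1..n} (cube_fun n f) A \<B>" and k: "card \<B> = k" by blast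
  have "finite \<B>" using sensitive_blocks_finite s by blast
  then obtain S where S: "bij_betw S {1..k} \<B>"
    using k by (metis card_atLeastAtMost diff_Suc_1 finite_atLeastAtMost finite_same_card_bij)
  have in\<B>: "S i \<in> \<B>" if "i \<in> {1..k}" for i using S that by (auto simp: bij_betw_def)
  note defs = s[unfolded sensitive_blocks_def]
  have dis: "disjoint \<B>" using defs by simp
  show ?L
  proof (rule bexI[of _ "char_vec n A"], rule exI[of _ S], intro conjI ballI)
    show "char_vec n A \<in> bits n" by simp
    show "disjoint_family_on S {1..k}"
      unfolding disjoint_family_on_def
    proof (intro ballI impI)
      fix i j assume ij: "i \<in> {1..k}" "j \<in> {1..k}" "i \<noteq> j"
      then have "S i \<noteq> S j" using inj_onD[OF bij_betw_imp_inj_on[OF S], of i j] by blast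
      with ij show "S i \<inter> S j = {}"
        using disjointD[OF dis, of "S i" "S j"] in\<B>[of i] in\<B>[of j] by simp
    qed
    fix i assume i: "i \<in> {1..k}"
    show "S i \<noteq> {}" "S i \<subseteq> {1..n}" using defs in\<B>[OF i] by auto
    show "f (bit_xor (char_vec n A) (char_vec n (S i))) \<noteq> f (char_vec n A)"
      using defs in\<B>[OF i] unfolding bit_xor_char_vec cube_fun_def by blast
  qed
qed

lemma block_sensitivity_eq:
  "block_sensitivity n f =
     Max {k. \<exists>A \<B>. sensitive_blocks {1..n} (cube_fun n f) A \<B> \<and> card \<B> = k}"
  unfolding block_sensitivity_def block_family_iff ..

lemma finite_block_counts:
  fixes g :: "nat set \<Rightarrow> bool"
  shows "finite {k. \<exists>A \<B>. sensitive_blocks {1..n} g A \<B> \<and> card \<B> = k}"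
  by (rule finite_subset[of _ "{..n}"]) (auto simp: card_sensitive_blocks_le)

lemma blocks_bound_block_sensitivity:
  "blocks_bound {1..n} (cube_fun n f) (block_sensitivity n f)"
  unfolding blocks_bound_def block_sensitivity_eq by (intro allI impI Max_ge finite_block_counts) blast

lemma block_sensitivity_attained:
  obtains A \<B> where "sensitive_blocks {1..n} (cube_fun n f) A \<B>" "card \<B> = block_sensitivity n f"
proof -
  have "sensitive_blocks {1..n} (cube_fun n f) {} {}"
    by (simp add: sensitive_blocks_def)
  then have "{k. \<exists>A \<B>. sensitive_blocks {1..n} (cube_fun n f) A \<B> \<and> card \<B> = k} \<noteq> {}" by blast
  from Max_in[OF finite_block_counts this] show thesis
    using that unfolding block_sensitivity_eq[symmetric] by blast
qed

text \<open>Otherwise the set of all ones of \<open>z\<close> would be a sensitive block at the zero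
  string.\<close>

lemma block_sensitivity_0_constant:
  assumes "block_sensitivity n f = 0" "z \<in> bits n"
  shows "f z = f (char_vec n {})"
proof (rule ccontr)
  assume ne: "f z \<noteq> f (char_vec n {})"
  define A where "A = {i \<in> {1..n}. z ! (i - 1)}"
  have zA: "z = char_vec n A" unfolding A_def by (rule bits_eq_char_vec[OF assms(2)])
  then have "A \<noteq> {}" using ne by auto
  moreover have "A \<subseteq> {1..n}" unfolding A_def by auto
  ultimately have "sensitive_blocks {1..n} (cube_fun n f) {} {A}"
    using ne zA by (auto simp: sensitive_blocks_def cube_fun_def)
  then have "card {A} \<le> block_sensitivity n f"
    using blocks_bound_block_sensitivity unfolding blocks_bound_def by blast
  then show False using assms(1) by simp
qed

section \<open>The deterministic upper bound\<close>

lemma bit_and_nth: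
  "length (bit_and x y) = min (length x) (length y)"
  "i < length x \<Longrightarrow> i < length y \<Longrightarrow> bit_and x y ! i = (x ! i \<and> y ! i)"
  by (simp_all add: bit_and_def)

lemma bit_or_nth:
  "length (bit_or x y) = min (length x) (length y)"
  "i < length x \<Longrightarrow> i < length y \<Longrightarrow> bit_or x y ! i = (x ! i \<or> y ! i)"
  by (simp_all add: bit_or_def)

text \<open>A decision tree for \<open>f\<close> queries coordinates of the string
  \<open>gate x y\<close>, and each of them is a function of one bit of Alice and one bit of
  Bob.\<close>

lemma protocol_gate:
  assumes gate: "\<And>x y. length (gate x y) = min (length x) (length y)"
    "\<And>x y i. i < length x \<Longrightarrow> i < length y \<Longrightarrow> gate x y ! i = op (x ! i) (y ! i)"
  shows "\<exists>P :: (bool list \<times> bool, bool list) protocol.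
    cost P \<le> 2 * block_sensitivity n f ^ 3 \<and>
    (\<forall>x \<in> bits n. \<forall>b. \<forall>y \<in> bits n. run P (x, b) y = f (gate x y))"
proof -
  define z where "z = (\<lambda>(x :: bool list, b :: bool) y. {i \<in> {1..n}. op (x ! (i - 1)) (y ! (i - 1))})"
  have "\<exists>P. cost P \<le> 2 * block_sensitivity n f ^ 3 \<and> (\<forall>x y. run P x y = cube_fun n f (z x y))"
  proof (rule protocol_from_blocks_bound[OF _ blocks_bound_block_sensitivity])
    show "\<exists>\<alpha> \<beta> op. \<forall>x y. (i \<in> z x y) = op (\<alpha> x :: bool) (\<beta> y :: bool)" if "i \<in> {1..n}" for i
      using that unfolding z_def
      by (intro exI[of _ "\<lambda>x. fst x ! (i - 1)"] exI[of _ "\<lambda>y. y ! (i - 1)"] exI[of _ op]) auto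
  qed (auto simp: z_def)
  then obtain P where P: "cost P \<le> 2 * block_sensitivity n f ^ 3"
    "\<And>x y. run P x y = cube_fun n f (z x y)" by blast
  have "cube_fun n f (z (x, b) y) = f (gate x y)" if "x \<in> bits n" "y \<in> bits n" for x b y
  proof -
    have "char_vec n (z (x, b) y) = gate x y"
      by (rule nth_equalityI) (use that in \<open>auto simp: gate bits_def z_def\<close>)
    then show ?thesis by (simp add: cube_fun_def)
  qed
  then show ?thesis using P by (intro exI[of _ P]) auto
qed

text \<open>Alice first announces which gate is wanted. This additional bit fits into the bound only
  for positive block sensitivity; otherwise \<open>f\<close> is constant and nothing is
  sent.\<close>

lemma and_or_protocol:
  obtains P where "real (cost P) \<le> 3 * real (block_sensitivity n f) ^ 3"
    "\<And>x y. x \<in> bits n \<times> UNIV \<Longrightarrow> y \<in> bits n \<Longrightarrow> run P x y = and_or_problem f x y"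
proof (cases "block_sensitivity n f = 0")
  case True
  have "and_or_problem f (x, b) y = f (char_vec n {})" if "x \<in> bits n" "y \<in> bits n" for x b y
  proof -
    have "bit_and x y \<in> bits n" "bit_or x y \<in> bits n"
      using that by (auto simp: bits_def bit_and_def bit_or_def)
    then show ?thesis
      using block_sensitivity_0_constant[OF True, of "bit_and x y"]
        block_sensitivity_0_constant[OF True, of "bit_or x y"]
      unfolding and_or_problem_def by (simp only: prod.case split: if_split) simp
  qed
  then show thesis by (intro that[of "Output (f (char_vec n {}))"]) auto
next
  case False
  let ?s = "block_sensitivity n f"
  have "\<exists>P :: (bool list \<times> bool, bool list) protocol. cost P \<le> 2 * ?s ^ 3 \<and>
      (\<forall>x \<in> bits n. \<forall>b. \<forall>y \<in> bits n. run P (x, b) y = f (bit_and x y))"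
    by (rule protocol_gate[where op = "(\<and>)"]) (simp_all add: bit_and_nth)
  then obtain P :: "(bool list \<times> bool, bool list) protocol" where P: "cost P \<le> 2 * ?s ^ 3"
    "\<forall>x \<in> bits n. \<forall>b. \<forall>y \<in> bits n. run P (x, b) y = f (bit_and x y)" by blast
  have "\<exists>P :: (bool list \<times> bool, bool list) protocol. cost P \<le> 2 * ?s ^ 3 \<and>
      (\<forall>x \<in> bits n. \<forall>b. \<forall>y \<in> bits n. run P (x, b) y = f (bit_or x y))"
    by (rule protocol_gate[where op = "(\<or>)"]) (simp_all add: bit_or_nth)
  then obtain Q :: "(bool list \<times> bool, bool list) protocol" where Q: "cost Q \<le> 2 * ?s ^ 3"
    "\<forall>x \<in> bits n. \<forall>b. \<forall>y \<in> bits n. run Q (x, b) y = f (bit_or x y)" by blast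
  have "cost (Alice_Sends snd Q P) \<le> 1 + 2 * ?s ^ 3" using P Q by simp
  also have "\<dots> \<le> 3 * ?s ^ 3" using False by simp
  finally have "real (cost (Alice_Sends snd Q P)) \<le> 3 * real ?s ^ 3"
    by (metis of_nat_le_iff of_nat_mult of_nat_numeral of_nat_power)
  then show thesis
    using P(2) Q(2) by (intro that[of "Alice_Sends snd Q P"]) (auto simp: and_or_problem_def)
qed

section \<open>A dual polynomial\<close>

text \<open>The sum is the coefficient of degree \<open>card N - 1\<close> in the Lagrange
  interpolant of \<open>p\<close> on \<open>N\<close>, which is \<open>p\<close> itself and has
  smaller degree.\<close>

lemma divided_difference_eq_0:
  fixes p :: "real poly"
  assumes fin: "finite N" and deg: "Suc (degree p) < card N"
  shows "(\<Sum>k\<in>N. poly p k / (\<Prod>j\<in>N - {k}. k - j)) = 0"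
proof -
  define lag where "lag = (\<lambda>k. \<Prod>j\<in>N - {k}. [:- j, 1:])"
  define c where "c = (\<lambda>k. poly p k / (\<Prod>j\<in>N - {k}. k - j))"
  define L where "L = (\<Sum>k\<in>N. Polynomial.smult (c k) (lag k))"
  have lag_poly: "poly (lag k) x = (\<Prod>j\<in>N - {k}. x - j)" for k x
    by (simp add: lag_def poly_prod)
  have lag_deg: "degree (lag k) = card N - 1" if "k \<in> N" for k
  proof -
    have "degree (lag k) = (\<Sum>j\<in>N - {k}. degree [:- j, 1:])"
      unfolding lag_def by (rule degree_prod_eq_sum_degree) auto
    then show ?thesis using that fin by simp
  qed
  have lag_lead: "coeff (lag k) (card N - 1) = 1" if "k \<in> N" for k
  proof -
    have "lead_coeff (lag k) = (\<Prod>j\<in>N - {k}. lead_coeff [:- j, 1:])"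
      unfolding lag_def by (rule lead_coeff_prod)
    then show ?thesis using lag_deg[OF that] by simp
  qed
  have "p = L"
  proof (rule poly_eqI_degree[of N])
    show "card N > degree p" using deg by simp
    have "degree L \<le> card N - 1"
      unfolding L_def using lag_deg by (intro degree_sum_le[OF fin]) (simp add: order_trans[OF degree_smult_le])
    then show "card N > degree L" using deg by simp
    fix x assume x: "x \<in> N"
    have "poly L x = (\<Sum>k\<in>N. c k * poly (lag k) x)"
      by (simp add: L_def poly_sum)
    also have "\<dots> = (\<Sum>k\<in>{x}. c k * poly (lag k) x)"
      using fin x by (intro sum.mono_neutral_right) (auto simp: lag_poly)
    also have "\<dots> = poly p x"
      using fin by (simp add: c_def lag_poly)
    finally show "poly p x = poly L x" by simp
  qed
  then have "0 = coeff L (card N - 1)" using deg by (metis coeff_eq_0 less_diff_conv add.commute plus_1_eq_Suc)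
  also have "\<dots> = (\<Sum>k\<in>N. c k)" unfolding L_def coeff_sum using lag_lead by simp
  finally show ?thesis by (simp add: c_def)
qed

text \<open>Log-convexity of the factorial.\<close>

lemma fact_square_le: "i \<le> d \<Longrightarrow> (fact d :: real) * fact d \<le> fact (d - i) * fact (d + i)"
proof (induction i)
  case (Suc i)
  obtain e where e: "d = Suc i + e" using Suc.prems le_Suc_ex by blast
  have "(fact d :: real) * fact d \<le> fact (d - i) * fact (d + i)" using Suc by simp
  also have "\<dots> = fact (d - Suc i) * fact (d + i) * real (Suc e)"
    by (simp add: e algebra_simps)
  also have "\<dots> \<le> fact (d - Suc i) * fact (d + i) * real (d + Suc i)"
    by (intro mult_left_mono) (auto simp: e)
  also have "\<dots> = fact (d - Suc i) * fact (d + Suc i)" by (simp add: algebra_simps)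
  finally show ?case .
qed simp

text \<open>Since \<open>j\<^sup>2 - i\<^sup>2 = (j - i) * (j + i)\<close>, the product is a
  quotient of factorials, stated here with the denominators cleared.\<close>

lemma prod_square_quotient_above:
  assumes "i \<le> d"
  shows "(\<Prod>j\<in>{i<..d}. (real j)\<^sup>2 / \<bar>(real i)\<^sup>2 - (real j)\<^sup>2\<bar>) * (fact (d - i) * fact (d + i) * (fact i)\<^sup>2)
    = (fact d)\<^sup>2 * fact (2 * i)"
  using assms
proof (induction d rule: dec_induct)
  case base
  then show ?case by (simp add: mult_2)
next
  case (step d)
  have ins: "{i<..Suc d} = insert (Suc d) {i<..d}" using step by auto
  have pos: "(real (Suc d))\<^sup>2 - (real i)\<^sup>2 = real (Suc d - i) * real (Suc d + i)"
    using step by (simp add: of_nat_diff power2_eq_square algebra_simps)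
  have nz: "real (Suc d - i) * real (Suc d + i) > 0" using step by simp
  have fa: "fact (Suc d - i) = real (Suc d - i) * fact (d - i)"
    "fact (Suc d + i) = real (Suc d + i) * fact (d + i)" "fact (Suc d) = real (Suc d) * fact d"
    using step by (simp_all add: Suc_diff_le algebra_simps)
  have abs: "\<bar>(real i)\<^sup>2 - (real (Suc d))\<^sup>2\<bar> = real (Suc d - i) * real (Suc d + i)"
    using pos nz by linarith
  let ?P = "\<Prod>j\<in>{i<..d}. (real j)\<^sup>2 / \<bar>(real i)\<^sup>2 - (real j)\<^sup>2\<bar>"
  have "(\<Prod>j\<in>{i<..Suc d}. (real j)\<^sup>2 / \<bar>(real i)\<^sup>2 - (real j)\<^sup>2\<bar>)
      = (real (Suc d))\<^sup>2 / (real (Suc d - i) * real (Suc d + i)) * ?P"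
    unfolding ins abs[symmetric] by (subst prod.insert) auto
  then have "(\<Prod>j\<in>{i<..Suc d}. (real j)\<^sup>2 / \<bar>(real i)\<^sup>2 - (real j)\<^sup>2\<bar>) *
       (fact (Suc d - i) * fact (Suc d + i) * (fact i)\<^sup>2)
     = (real (Suc d))\<^sup>2 / (real (Suc d - i) * real (Suc d + i)) * (real (Suc d - i) * real (Suc d + i)) *
       (?P * (fact (d - i) * fact (d + i) * (fact i)\<^sup>2))"
    unfolding fa by (simp only: mult_ac)
  also have "(real (Suc d))\<^sup>2 / (real (Suc d - i) * real (Suc d + i)) * (real (Suc d - i) * real (Suc d + i))
      = (real (Suc d))\<^sup>2"
    using nz by (metis less_numeral_extra(3) nonzero_eq_divide_eq)
  also have "?P * (fact (d - i) * fact (d + i) * (fact i)\<^sup>2) = (fact d)\<^sup>2 * fact (2 * i)"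
    by (rule step.IH)
  finally show ?case unfolding fa by (simp only: power_mult_distrib mult_ac)
qed

text \<open>The counterpart for the factors below the distinguished index \<open>Suc i\<close>. For
  the induction the product is cut off at \<open>m\<close> while that index stays fixed.\<close>

lemma prod_square_quotient_below:
  "(\<Prod>j\<in>{1..<Suc i}. (real j)\<^sup>2 / \<bar>(real (Suc i))\<^sup>2 - (real j)\<^sup>2\<bar>) * fact (2 * Suc i) = 2 * (fact (Suc i))\<^sup>2"
proof -
  have "m \<le> i \<Longrightarrow> (\<Prod>j\<in>{1..<Suc m}. (real j)\<^sup>2 / \<bar>(real (Suc i))\<^sup>2 - (real j)\<^sup>2\<bar>) * (fact i * fact (Suc i + m))
     = fact (i - m) * fact (Suc i) * (fact m)\<^sup>2" for m
  proof (induction m)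
    case (Suc m)
    let ?P = "\<Prod>j\<in>{1..<Suc m}. (real j)\<^sup>2 / \<bar>(real (Suc i))\<^sup>2 - (real j)\<^sup>2\<bar>"
    have pos: "(real (Suc i))\<^sup>2 - (real (Suc m))\<^sup>2 = real (i - m) * real (Suc i + Suc m)"
      using Suc by (simp add: of_nat_diff power2_eq_square algebra_simps)
    have nz: "real (i - m) * real (Suc i + Suc m) > 0" using Suc by simp
    have abs: "\<bar>(real (Suc i))\<^sup>2 - (real (Suc m))\<^sup>2\<bar> = real (i - m) * real (Suc i + Suc m)"
      using pos nz by linarith
    obtain e where e: "i = Suc m + e" using Suc.prems le_Suc_ex by blast
    have fa: "fact (Suc i + Suc m) = real (Suc i + Suc m) * fact (Suc i + m)"
      "fact (i - m) = real (i - m) * fact (i - Suc m)"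
      "fact (Suc m) = real (Suc m) * fact m"
      by (simp_all add: e algebra_simps)
    have "(\<Prod>j\<in>{1..<Suc (Suc m)}. (real j)\<^sup>2 / \<bar>(real (Suc i))\<^sup>2 - (real j)\<^sup>2\<bar>)
        = ?P * ((real (Suc m))\<^sup>2 / (real (i - m) * real (Suc i + Suc m)))"
      unfolding abs[symmetric] by (subst prod.atLeastLessThan_Suc) auto
    then have "(\<Prod>j\<in>{1..<Suc (Suc m)}. (real j)\<^sup>2 / \<bar>(real (Suc i))\<^sup>2 - (real j)\<^sup>2\<bar>) * (fact i * fact (Suc i + Suc m))
      = (real (Suc m))\<^sup>2 / (real (i - m) * real (Suc i + Suc m)) * real (Suc i + Suc m) *
        (?P * (fact i * fact (Suc i + m)))"
      unfolding fa by (simp only: mult_ac)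
    also have "?P * (fact i * fact (Suc i + m)) = fact (i - m) * fact (Suc i) * (fact m)\<^sup>2"
      using Suc by simp
    also have "(real (Suc m))\<^sup>2 / (real (i - m) * real (Suc i + Suc m)) * real (Suc i + Suc m) *
        (fact (i - m) * fact (Suc i) * (fact m)\<^sup>2)
      = fact (i - Suc m) * fact (Suc i) * (real (Suc m) * fact m)\<^sup>2"
    proof -
      have "real (i - m) > 0" "real (Suc i + Suc m) > 0" using Suc.prems by auto
      then show ?thesis unfolding fa(2) by (simp add: field_simps power2_eq_square del: of_nat_Suc of_nat_add)
    qed
    finally show ?case unfolding fa(3) .
  qed simp
  from this[of i] have "(\<Prod>j\<in>{1..<Suc i}. (real j)\<^sup>2 / \<bar>(real (Suc i))\<^sup>2 - (real j)\<^sup>2\<bar>) * fact (Suc i + i)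
     = fact (Suc i) * fact i" by (simp add: power2_eq_square del: of_nat_Suc fact_Suc)
  moreover have "fact (2 * Suc i) = 2 * real (Suc i) * fact (Suc i + i)"
  proof -
    have eq: "2 * Suc i = Suc (Suc i + i)" by simp
    have "fact (2 * Suc i) = real (Suc (Suc i + i)) * fact (Suc i + i)"
      unfolding eq by (rule fact_Suc)
    also have "real (Suc (Suc i + i)) = 2 * real (Suc i)" by simp
    finally show ?thesis .
  qed
  moreover have "(fact (Suc i) :: real)\<^sup>2 = fact (Suc i) * (real (Suc i) * fact i)"
    by (simp only: power2_eq_square fact_Suc)
  ultimately show ?thesis by (simp only: mult_ac)
qed

text \<open>The two closed forms multiply to
  \<open>2 * (fact d)\<^sup>2 / (fact (d - i) * fact (d + i))\<close>. That the bound is free of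
  \<open>d\<close> keeps the tail of the dual polynomial small for every degree.\<close>

lemma prod_square_quotient_le:
  assumes i: "i \<in> {1..d}"
  shows "(\<Prod>j\<in>{1..d} - {i}. (real j)\<^sup>2 / \<bar>(real i)\<^sup>2 - (real j)\<^sup>2\<bar>) \<le> 2"
proof -
  let ?q = "\<lambda>j. (real j)\<^sup>2 / \<bar>(real i)\<^sup>2 - (real j)\<^sup>2\<bar>"
  have split: "{1..d} - {i} = {1..<i} \<union> {i<..d}" using i by auto
  have "prod ?q ({1..d} - {i}) = prod ?q {1..<i} * prod ?q {i<..d}"
    unfolding split by (intro prod.union_disjoint) auto
  then have "prod ?q ({1..d} - {i}) * (fact (d - i) * fact (d + i)) * (fact (2 * i) * (fact i)\<^sup>2)
      = (prod ?q {1..<i} * fact (2 * i)) * (prod ?q {i<..d} * (fact (d - i) * fact (d + i) * (fact i)\<^sup>2))"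
    by (simp only: mult_ac)
  also have "prod ?q {1..<i} * fact (2 * i) = 2 * (fact i)\<^sup>2"
  proof -
    obtain i' where "i = Suc i'" using i by (cases i) auto
    then show ?thesis using prod_square_quotient_below[of i'] by simp
  qed
  also have "prod ?q {i<..d} * (fact (d - i) * fact (d + i) * (fact i)\<^sup>2) = (fact d)\<^sup>2 * fact (2 * i)"
    using i by (intro prod_square_quotient_above) auto
  finally have "prod ?q ({1..d} - {i}) * (fact (d - i) * fact (d + i)) * (fact (2 * i) * (fact i)\<^sup>2)
      = 2 * (fact d)\<^sup>2 * (fact (2 * i) * (fact i)\<^sup>2)" by (simp only: mult_ac)
  then have "prod ?q ({1..d} - {i}) * (fact (d - i) * fact (d + i)) = 2 * (fact d)\<^sup>2"
    by simp
  also have "\<dots> \<le> 2 * (fact (d - i) * fact (d + i))"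
    using fact_square_le[of i d] i by (simp add: power2_eq_square)
  finally show ?thesis by (subst (asm) mult_le_cancel_right_pos) auto
qed

text \<open>Comparison with a telescoping sum; the subtracted \<open>1 / real (Suc d)\<close>
  carries the induction.\<close>

lemma sum_inverse_squares_le: "(\<Sum>i\<in>{1..Suc d}. 1 / (real i)\<^sup>2) \<le> 2 - 1 / real (Suc d)"
proof (induction d)
  case (Suc d)
  have "1 / (real (Suc (Suc d)))\<^sup>2 \<le> 1 / real (Suc d) - 1 / real (Suc (Suc d))"
  proof -
    have "1 / real (Suc d) - 1 / real (Suc (Suc d)) = 1 / (real (Suc d) * real (Suc (Suc d)))"
      by (simp add: field_simps)
    also have "\<dots> \<ge> 1 / (real (Suc (Suc d)))\<^sup>2"
      unfolding power2_eq_square by (intro divide_left_mono mult_right_mono) auto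
    finally show ?thesis .
  qed
  then show ?case using Suc by (simp del: of_nat_Suc) 
qed simp

text \<open>The functional \<open>p \<mapsto> \<Sum>k. \<omega> k * p k\<close> is the divided difference at the nodes \<open>0\<close>, \<open>1\<close> and
  \<open>41 i\<^sup>2\<close>, so it kills low degree; the quadratic spacing makes almost all of its weight sit on
  \<open>0\<close> and \<open>1\<close>.\<close>

lemma dual_polynomial:
  assumes m: "41 * d\<^sup>2 \<le> m" "1 \<le> m"
  obtains \<omega> :: "nat \<Rightarrow> real" where "\<omega> 0 = 1" "(\<Sum>k\<in>{2..m}. \<bar>\<omega> k\<bar>) \<le> 1 / 10"
    "\<And>p :: real poly. degree p \<le> d \<Longrightarrow> (\<Sum>k\<le>m. \<omega> k * poly p (real k)) = 0"
proof -
  \<comment> \<open>The factor 41 leaves \<open>41 * i\<^sup>2 - 1 \<ge> 40 * i\<^sup>2\<close>, so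
    the weight at the node of \<open>i\<close> is at most \<open>2 / (40 * i\<^sup>2)\<close>.
    Summed over \<open>i\<close> this is at most 1/10.\<close>
  define sq where "sq = (\<lambda>i::nat. 41 * i\<^sup>2)"
  define Q where "Q = sq ` {1..d}"
  define N where "N = {0, 1} \<union> Q"
  have inj: "inj_on sq {1..d}" by (auto simp: inj_on_def sq_def)
  have Q2: "k \<ge> 2 \<and> k \<le> m" if k: "k \<in> Q" for k
  proof -
    obtain i where i: "i \<in> {1..d}" "k = 41 * i\<^sup>2" using k by (auto simp: Q_def sq_def)
    then have "1 \<le> i\<^sup>2" "i\<^sup>2 \<le> d\<^sup>2" by (auto simp: power_mono)
    then show ?thesis using i m by linarith
  qed
  then have Q01: "0 \<notin> Q" "1 \<notin> Q" by force+
  have finN: "finite N" "finite Q" by (auto simp: N_def Q_def)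
  have cardN: "card N = d + 2"
    using Q01 finN inj by (simp add: N_def Q_def card_image)
  have NM: "N \<subseteq> {..m}" using Q2 m by (auto simp: N_def)
  \<comment> \<open>\<open>W\<close> scales the divided difference so that the weight at 0 is 1. The
    \<open>d + 2\<close> nodes are just enough to kill degree \<open>d\<close>.\<close>
  define W where "W = (\<Prod>j\<in>N - {0}. - real j)"
  define \<omega> where "\<omega> = (\<lambda>k. if k \<in> N then W / (\<Prod>j\<in>N - {k}. real k - real j) else 0)"
  have W0: "W \<noteq> 0" using finN by (auto simp: W_def)
  have zero: "\<omega> 0 = 1" using W0 by (simp add: \<omega>_def N_def W_def)
  have ortho: "(\<Sum>k\<le>m. \<omega> k * poly p (real k)) = 0" if p: "degree p \<le> d" for p
  proof -
    have "(\<Sum>k\<le>m. \<omega> k * poly p (real k)) = (\<Sum>k\<in>N. \<omega> k * poly p (real k))"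
      using NM by (intro sum.mono_neutral_right) (auto simp: \<omega>_def)
    also have "\<dots> = W * (\<Sum>k\<in>N. poly p (real k) / (\<Prod>j\<in>N - {k}. real k - real j))"
      by (simp add: \<omega>_def sum_distrib_left)
    also have "(\<Sum>k\<in>N. poly p (real k) / (\<Prod>j\<in>N - {k}. real k - real j))
        = (\<Sum>k\<in>real ` N. poly p k / (\<Prod>j\<in>real ` N - {k}. k - j))"
    proof (subst sum.reindex)
      show "inj_on real N" by (auto simp: inj_on_def)
      have "(\<Prod>j\<in>real ` N - {real k}. real k - j) = (\<Prod>j\<in>N - {k}. real k - real j)" for k
      proof -
        have "real ` N - {real k} = real ` (N - {k})" by auto
        then show ?thesis by (simp add: prod.reindex inj_on_def)
      qed
      then show "(\<Sum>k\<in>N. poly p (real k) / (\<Prod>j\<in>N - {k}. real k - real j))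
        = sum ((\<lambda>k. poly p k / (\<Prod>j\<in>real ` N - {k}. k - j)) \<circ> real) N" by simp
    qed
    also have "\<dots> = 0"
      using p cardN finN by (intro divided_difference_eq_0) (auto simp: card_image inj_on_def)
    finally show ?thesis by simp
  qed
  have tail: "(\<Sum>k\<in>{2..m}. \<bar>\<omega> k\<bar>) \<le> 1 / 10"
  proof -
    have bound: "\<bar>\<omega> (sq i)\<bar> \<le> (1 / 20) * (1 / (real i)\<^sup>2)" if i: "i \<in> {1..d}" for i
    proof -
      let ?k = "real (sq i)" and ?I = "{1..d} - {i}"
      have ii: "(real i)\<^sup>2 \<ge> 1" "i > 0" using i by simp_all
      have k: "?k = 41 * (real i)\<^sup>2" by (simp add: sq_def)
      have k1: "?k - 1 > 0" "?k - 1 \<ge> 40 * (real i)\<^sup>2" unfolding k using ii(1) by linarith+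
      have kQ: "sq i \<in> Q" using i by (auto simp: Q_def)
      have "N - {0} = insert 1 Q" using Q01 by (auto simp: N_def)
      then have "\<bar>W\<bar> = (\<Prod>j\<in>Q. real j)" using Q01 finN by (simp add: W_def abs_prod)
      also have "\<dots> = (\<Prod>j\<in>{1..d}. 41 * (real j)\<^sup>2)"
        unfolding Q_def using inj by (subst prod.reindex) (auto simp: sq_def)
      also have "\<dots> = 41 * (real i)\<^sup>2 * (\<Prod>j\<in>?I. 41 * (real j)\<^sup>2)"
        using i by (subst prod.remove[of _ i]) auto
      finally have W: "\<bar>W\<bar> = ?k * (\<Prod>j\<in>?I. 41 * (real j)\<^sup>2)" by (simp add: k)
      have "N - {sq i} = insert 0 (insert 1 (Q - {sq i}))" using Q01 kQ by (auto simp: N_def)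
      then have "\<bar>\<Prod>j\<in>N - {sq i}. ?k - real j\<bar> = \<bar>?k\<bar> * (\<bar>?k - 1\<bar> * (\<Prod>j\<in>Q - {sq i}. \<bar>?k - real j\<bar>))"
        using Q01 finN by (simp add: abs_prod abs_mult)
      also have "Q - {sq i} = sq ` ?I"
        unfolding Q_def using inj_on_image_set_diff[OF inj, of "{1..d}" "{i}"] i by simp
      also have "(\<Prod>j\<in>sq ` ?I. \<bar>?k - real j\<bar>) = (\<Prod>j\<in>?I. 41 * \<bar>(real i)\<^sup>2 - (real j)\<^sup>2\<bar>)"
      proof (subst prod.reindex)
        show "inj_on sq ?I" using inj by (rule inj_on_subset) auto
        have "\<bar>?k - real (sq j)\<bar> = 41 * \<bar>(real i)\<^sup>2 - (real j)\<^sup>2\<bar>" for j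
        proof -
          have "?k - real (sq j) = 41 * ((real i)\<^sup>2 - (real j)\<^sup>2)" by (simp add: sq_def algebra_simps)
          then show ?thesis by (simp only: abs_mult abs_numeral)
        qed
        then show "prod ((\<lambda>j. \<bar>?k - real j\<bar>) \<circ> sq) ?I = (\<Prod>j\<in>?I. 41 * \<bar>(real i)\<^sup>2 - (real j)\<^sup>2\<bar>)" by simp
      qed
      finally have D: "\<bar>\<Prod>j\<in>N - {sq i}. ?k - real j\<bar>
          = ?k * ((?k - 1) * (\<Prod>j\<in>?I. 41 * \<bar>(real i)\<^sup>2 - (real j)\<^sup>2\<bar>))"
        using ii by (simp add: k)
      have "\<bar>\<omega> (sq i)\<bar> = \<bar>W\<bar> / \<bar>\<Prod>j\<in>N - {sq i}. ?k - real j\<bar>"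
        using kQ by (simp add: \<omega>_def N_def)
      also have "\<dots> = 1 / (?k - 1) * ((\<Prod>j\<in>?I. 41 * (real j)\<^sup>2) / (\<Prod>j\<in>?I. 41 * \<bar>(real i)\<^sup>2 - (real j)\<^sup>2\<bar>))"
        unfolding W D using ii by (simp add: k)
      also have "(\<Prod>j\<in>?I. 41 * (real j)\<^sup>2) / (\<Prod>j\<in>?I. 41 * \<bar>(real i)\<^sup>2 - (real j)\<^sup>2\<bar>)
          = (\<Prod>j\<in>?I. (real j)\<^sup>2 / \<bar>(real i)\<^sup>2 - (real j)\<^sup>2\<bar>)"
        by (simp add: prod_dividef[symmetric])
      also have "1 / (?k - 1) * (\<Prod>j\<in>?I. (real j)\<^sup>2 / \<bar>(real i)\<^sup>2 - (real j)\<^sup>2\<bar>) \<le> 1 / (?k - 1) * 2"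
        using prod_square_quotient_le[OF i] k1 by (intro mult_left_mono) simp_all
      also have "1 / (?k - 1) * 2 = 2 / (?k - 1)" by simp
      also have "\<dots> \<le> 2 / (40 * (real i)\<^sup>2)"
        by (intro frac_le k1(2)) (use ii in simp_all)
      finally show ?thesis by simp
    qed
    have "(\<Sum>k\<in>{2..m}. \<bar>\<omega> k\<bar>) = (\<Sum>k\<in>Q. \<bar>\<omega> k\<bar>)"
      using Q2 by (intro sum.mono_neutral_right) (auto simp: \<omega>_def N_def)
    also have "\<dots> = (\<Sum>i\<in>{1..d}. \<bar>\<omega> (sq i)\<bar>)"
      unfolding Q_def using inj by (simp add: sum.reindex)
    also have "\<dots> \<le> (\<Sum>i\<in>{1..d}. (1 / 20) * (1 / (real i)\<^sup>2))"
      using bound by (rule sum_mono)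
    also have "\<dots> = 1 / 20 * (\<Sum>i\<in>{1..d}. 1 / (real i)\<^sup>2)" by (rule sum_distrib_left[symmetric])
    also have "(\<Sum>i\<in>{1..d}. 1 / (real i)\<^sup>2) \<le> 2"
    proof (cases d)
      case (Suc e)
      have "2 - 1 / real (Suc e) \<le> 2" by simp
      then show ?thesis using sum_inverse_squares_le[of e] unfolding Suc by linarith
    qed simp
    finally show ?thesis by simp
  qed
  show thesis by (rule that[OF zero tail ortho])
qed

section \<open>Fourier analysis on the cube\<close>

definition chi :: "'a set \<Rightarrow> 'a set \<Rightarrow> real" where
  "chi S z = (- 1) ^ card (S \<inter> z)"

lemma chi_empty [simp]: "chi {} z = 1" "chi S {} = 1"
  by (simp_all add: chi_def)

lemma chi_prod: "finite S \<Longrightarrow> chi S z = (\<Prod>i\<in>S. if i \<in> z then - 1 else 1)"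
  unfolding chi_def by (simp add: prod.If_cases)

lemma abs_chi [simp]: "\<bar>chi S z\<bar> = 1"
  by (simp add: chi_def power_abs)

lemma sum_Pow_prod:
  fixes e :: "'a \<Rightarrow> 'b :: comm_semiring_1"
  shows "finite J \<Longrightarrow> (\<Sum>S\<in>Pow J. \<Prod>i\<in>S. e i) = (\<Prod>i\<in>J. e i + 1)"
  by (simp add: prod_add)

text \<open>The sum factors over the coordinates, and a coordinate in which \<open>x\<close> and
  \<open>y\<close> differ contributes the factor 0.\<close>

lemma chi_orthogonal:
  assumes "finite J" "x \<subseteq> J" "y \<subseteq> J"
  shows "(\<Sum>S\<in>Pow J. chi S x * chi S y) = (if x = y then 2 ^ card J else 0)"
proof -
  let ?e = "\<lambda>i. if (i \<in> x) = (i \<in> y) then 1 else - 1 :: real"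
  have "chi S x * chi S y = (\<Prod>i\<in>S. ?e i)" if "S \<in> Pow J" for S
  proof -
    have "finite S" using that assms(1) finite_subset by blast
    then show ?thesis unfolding chi_prod[OF \<open>finite S\<close>] prod.distrib[symmetric]
      by (intro prod.cong) auto
  qed
  then have "(\<Sum>S\<in>Pow J. chi S x * chi S y) = (\<Sum>S\<in>Pow J. \<Prod>i\<in>S. ?e i)"
    by (rule sum.cong[OF refl])
  also have "\<dots> = (\<Prod>i\<in>J. ?e i + 1)" by (rule sum_Pow_prod[OF assms(1)])
  also have "\<dots> = (if x = y then 2 ^ card J else 0)"
  proof (cases "x = y")
    case False
    then obtain i where "i \<in> J" "(i \<in> x) \<noteq> (i \<in> y)" using assms by blast
    then have "\<exists>i\<in>J. ?e i + 1 = 0" by (intro bexI[of _ i]) auto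
    then have "(\<Prod>i\<in>J. ?e i + 1) = 0" by (rule prod_zero[OF assms(1)])
    then show ?thesis using False by simp
  qed simp
  finally show ?thesis .
qed

lemma chi_inversion:
  assumes fin: "finite J" and z: "z \<subseteq> J"
  shows "\<psi> z = (\<Sum>S\<in>Pow J. (\<Sum>y\<in>Pow J. \<psi> y * chi S y) / 2 ^ card J * chi S z)"
proof -
  have "(\<Sum>S\<in>Pow J. (\<Sum>y\<in>Pow J. \<psi> y * chi S y) / 2 ^ card J * chi S z)
      = (\<Sum>S\<in>Pow J. \<Sum>y\<in>Pow J. \<psi> y / 2 ^ card J * (chi S y * chi S z))"
    by (simp add: sum_divide_distrib sum_distrib_left sum_distrib_right mult_ac)
  also have "\<dots> = (\<Sum>y\<in>Pow J. \<Sum>S\<in>Pow J. \<psi> y / 2 ^ card J * (chi S y * chi S z))"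
    by (rule sum.swap)
  also have "\<dots> = (\<Sum>y\<in>Pow J. \<psi> y / 2 ^ card J * (if y = z then 2 ^ card J else 0))"
    using z by (intro sum.cong refl) (simp only: sum_distrib_left[symmetric] chi_orthogonal[OF fin] Pow_iff)
  also have "\<dots> = (\<Sum>y\<in>Pow J. if y = z then \<psi> y else 0)"
    by (intro sum.cong) auto
  also have "\<dots> = \<psi> z" using fin z by simp
  finally show ?thesis by simp
qed

text \<open>By orthogonality only the diagonal of the expanded square survives. The values are
  complex because the lemma is applied to entries of transformed quantum states.\<close>

lemma chi_parseval:
  fixes a :: "'a set \<Rightarrow> complex"
  assumes fin: "finite J"
  shows "(\<Sum>S\<in>Pow J. (cmod (\<Sum>x\<in>Pow J. a x * of_real (chi S x)))\<^sup>2)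
    = 2 ^ card J * (\<Sum>x\<in>Pow J. (cmod (a x))\<^sup>2)"
proof -
  have "complex_of_real (\<Sum>S\<in>Pow J. (cmod (\<Sum>x\<in>Pow J. a x * of_real (chi S x)))\<^sup>2)
      = (\<Sum>S\<in>Pow J. (\<Sum>x\<in>Pow J. a x * of_real (chi S x)) * cnj (\<Sum>x\<in>Pow J. a x * of_real (chi S x)))"
    by (simp only: of_real_sum complex_norm_square)
  also have "\<dots> = (\<Sum>S\<in>Pow J. \<Sum>x\<in>Pow J. \<Sum>y\<in>Pow J. a x * cnj (a y) * of_real (chi S x * chi S y))"
    by (simp add: sum_product mult_ac)
  also have "\<dots> = (\<Sum>x\<in>Pow J. \<Sum>S\<in>Pow J. \<Sum>y\<in>Pow J. a x * cnj (a y) * of_real (chi S x * chi S y))"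
    by (rule sum.swap)
  also have "\<dots> = (\<Sum>x\<in>Pow J. \<Sum>y\<in>Pow J. \<Sum>S\<in>Pow J. a x * cnj (a y) * of_real (chi S x * chi S y))"
    by (intro sum.cong refl sum.swap)
  also have "\<dots> = (\<Sum>x\<in>Pow J. \<Sum>y\<in>Pow J. a x * cnj (a y) * of_real (if x = y then 2 ^ card J else 0))"
    by (intro sum.cong refl)
      (simp only: sum_distrib_left[symmetric] of_real_sum[symmetric] chi_orthogonal[OF fin] Pow_iff)
  also have "\<dots> = (\<Sum>x\<in>Pow J. \<Sum>y\<in>Pow J. if x = y then 2 ^ card J * (a x * cnj (a x)) else 0)"
    by (intro sum.cong refl) auto
  also have "\<dots> = (\<Sum>x\<in>Pow J. 2 ^ card J * (a x * cnj (a x)))"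
    using fin by simp
  also have "\<dots> = complex_of_real (2 ^ card J * (\<Sum>x\<in>Pow J. (cmod (a x))\<^sup>2))"
    unfolding sum_distrib_left[symmetric] of_real_mult of_real_sum complex_norm_square by simp
  finally show ?thesis by (simp only: of_real_eq_iff)
qed

section \<open>Symmetrization: from polynomials in the size to functions on the cube\<close>

lemma sum_Pow_by_card:
  assumes "finite T"
  shows "(\<Sum>z\<in>Pow T. h z) = (\<Sum>k\<le>card T. \<Sum>z | z \<subseteq> T \<and> card z = k. h z)"
proof -
  have "(\<Sum>k\<in>{..card T}. sum h {z. z \<in> Pow T \<and> card z = k}) = sum h (Pow T)"
    using assms by (intro sum.group) (auto intro: card_mono)
  then show ?thesis by simp
qed

text \<open>Equivalently, a random \<open>k\<close>-subset of \<open>T\<close> contains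
  \<open>U\<close> with probability \<open>(k choose card U) / (card T choose card U)\<close>, a
  polynomial in \<open>k\<close> of degree \<open>card U\<close>. This is the core of Minsky-Papert
  symmetrization.\<close>

lemma card_supersets:
  assumes fin: "finite T" and U: "U \<subseteq> T" and k: "k \<le> card T"
  shows "card {z. z \<subseteq> T \<and> card z = k \<and> U \<subseteq> z} * (card T choose card U) = (card T choose k) * (k choose card U)"
proof -
  have finU: "finite U" using U fin finite_subset by blast
  show ?thesis
  proof (cases "card U \<le> k")
    case True
    have "bij_betw (\<lambda>z. z - U) {z. z \<subseteq> T \<and> card z = k \<and> U \<subseteq> z} {y. y \<subseteq> T - U \<and> card y = k - card U}"
    proof (rule bij_betw_byWitness[where f' = "\<lambda>y. y \<union> U"])
      show "(\<lambda>z. z - U) ` {z. z \<subseteq> T \<and> card z = k \<and> U \<subseteq> z} \<subseteq> {y. y \<subseteq> T - U \<and> card y = k - card U}"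
        using finU by (auto simp: card_Diff_subset)
      show "(\<lambda>y. y \<union> U) ` {y. y \<subseteq> T - U \<and> card y = k - card U} \<subseteq> {z. z \<subseteq> T \<and> card z = k \<and> U \<subseteq> z}"
      proof
        fix z assume "z \<in> (\<lambda>y. y \<union> U) ` {y. y \<subseteq> T - U \<and> card y = k - card U}"
        then obtain y where y: "z = y \<union> U" "y \<subseteq> T - U" "card y = k - card U" by blast
        then have "card z = k"
          using True finU fin finite_subset[of y T] by (subst y(1), subst card_Un_disjoint) auto
        then show "z \<in> {z. z \<subseteq> T \<and> card z = k \<and> U \<subseteq> z}" using y U by auto
      qed
    qed auto
    then have "card {z. z \<subseteq> T \<and> card z = k \<and> U \<subseteq> z} = (card T - card U) choose (k - card U)"
      using fin finU U by (simp add: bij_betw_same_card n_subsets card_Diff_subset)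
    then show ?thesis using choose_mult[OF True k] by simp
  next
    case False
    then have "{z. z \<subseteq> T \<and> card z = k \<and> U \<subseteq> z} = {}"
      using fin by (auto dest: card_mono[rotated] intro: finite_subset)
    then have "card {z. z \<subseteq> T \<and> card z = k \<and> U \<subseteq> z} = 0" by (simp only: card.empty)
    then show ?thesis using False by (simp add: binomial_eq_0)
  qed
qed

text \<open>Turns a character into monomials, whose averages over the sets of one size are
  polynomials in that size.\<close>

lemma chi_expand:
  assumes "finite S"
  shows "chi S z = (\<Sum>U\<in>Pow S. (- 2) ^ card U * (if U \<subseteq> z then 1 else 0))"
proof -
  have "chi S z = (\<Prod>i\<in>S. (if i \<in> z then - 2 else 0) + 1)"
    unfolding chi_prod[OF assms] by (intro prod.cong) auto
  also have "\<dots> = (\<Sum>U\<in>Pow S. \<Prod>i\<in>U. if i \<in> z then - 2 else 0)"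
    by (rule sum_Pow_prod[OF assms, symmetric])
  also have "\<dots> = (\<Sum>U\<in>Pow S. (- 2) ^ card U * (if U \<subseteq> z then 1 else 0))"
  proof (rule sum.cong[OF refl])
    fix U assume "U \<in> Pow S"
    then have U: "finite U" using assms finite_subset by blast
    show "(\<Prod>i\<in>U. if i \<in> z then - 2 else 0) = (- 2) ^ card U * (if U \<subseteq> z then 1 else 0 :: real)"
    proof (cases "U \<subseteq> z")
      case True
      then have "(\<Prod>i\<in>U. if i \<in> z then - 2 else 0 :: real) = (\<Prod>i\<in>U. - 2)"
        by (intro prod.cong) auto
      then show ?thesis using True by simp
    next
      case False
      then have "(\<Prod>i\<in>U. if i \<in> z then - 2 else 0 :: real) = 0"
        using U by (intro prod_zero) auto
      then show ?thesis using False by simp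
    qed
  qed
  finally show ?thesis .
qed

lemma binomial_poly:
  obtains p :: "real poly" where "degree p \<le> u" "\<And>k. poly p (real k) = real (k choose u)"
proof
  let ?p = "Polynomial.smult (1 / fact u) (\<Prod>i\<in>{0..<u}. [:- real i, 1:])"
  show "degree ?p \<le> u"
    by (rule order_trans[OF degree_smult_le], subst degree_prod_eq_sum_degree) auto
  show "poly ?p (real k) = real (k choose u)" for k
    by (simp add: poly_prod binomial_gbinomial gbinomial_prod_rev)
qed

text \<open>\<open>\<psi>\<close> spreads the weight \<open>\<omega> k\<close> evenly over the sets
  of size \<open>k\<close>, so its pairing with a character of low degree is a pairing of
  \<open>\<omega>\<close> with a polynomial of low degree. The last property asks of
  \<open>F\<close> on larger sets only values in \<open>[0, 1]\<close>: there several blocks are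
  flipped and nothing is known about \<open>f\<close>.\<close>

lemma dual_cube:
  assumes fin: "finite T" and d: "41 * d\<^sup>2 \<le> card T" "1 \<le> card T"
  obtains \<psi> :: "'a set \<Rightarrow> real" where
    "\<And>S. S \<subseteq> T \<Longrightarrow> card S \<le> d \<Longrightarrow> (\<Sum>z\<in>Pow T. \<psi> z * chi S z) = 0"
    "(\<Sum>z\<in>Pow T. \<bar>\<psi> z\<bar>) \<le> 3"
    "\<And>F. (\<And>z. z \<subseteq> T \<Longrightarrow> 0 \<le> F z \<and> F z \<le> 1) \<Longrightarrow> 2 / 3 \<le> F {} \<Longrightarrow> (\<And>i. i \<in> T \<Longrightarrow> F {i} \<le> 1 / 3) \<Longrightarrow>
       1 / 4 \<le> (\<Sum>z\<in>Pow T. \<psi> z * F z)"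
proof -
  let ?t = "card T"
  obtain \<omega> where \<omega>0: "\<omega> 0 = 1" and tail: "(\<Sum>k\<in>{2..?t}. \<bar>\<omega> k\<bar>) \<le> 1 / 10"
    and ortho: "\<And>p :: real poly. degree p \<le> d \<Longrightarrow> (\<Sum>k\<le>?t. \<omega> k * poly p (real k)) = 0"
    using dual_polynomial[OF d] by blast
  define \<psi> where "\<psi> = (\<lambda>z :: 'a set. \<omega> (card z) / real (?t choose card z))"
  have lay: "card {z. z \<subseteq> T \<and> card z = k} = ?t choose k" for k by (rule n_subsets[OF fin])
  have split: "(\<Sum>k\<le>?t. h k) = h 0 + h 1 + (\<Sum>k\<in>{2..?t}. h k)" for h :: "nat \<Rightarrow> real"
  proof -
    have "{..?t} = insert 0 (insert 1 {2..?t})" using d(2) by auto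
    then show ?thesis by simp
  qed
  \<comment> \<open>Orthogonality to the constant polynomial forces \<open>\<omega> 1\<close> to lie
    within 1/10 of -1.\<close>
  have sum\<omega>: "(\<Sum>k\<le>?t. \<omega> k) = 0" using ortho[of 1] by simp
  have "\<bar>\<Sum>k\<in>{2..?t}. \<omega> k\<bar> \<le> 1 / 10" using tail sum_abs[of \<omega> "{2..?t}"] by linarith
  then have \<omega>1: "\<omega> 1 \<le> - 9 / 10" "\<omega> 1 \<ge> - 11 / 10"
    using sum\<omega> \<omega>0 unfolding split by linarith+
  have abs_lay: "(\<Sum>z | z \<subseteq> T \<and> card z = k. \<bar>\<psi> z\<bar>) = \<bar>\<omega> k\<bar>" if "k \<le> ?t" for k
  proof -
    have "(\<Sum>z | z \<subseteq> T \<and> card z = k. \<bar>\<psi> z\<bar>) = (\<Sum>z | z \<subseteq> T \<and> card z = k. \<bar>\<omega> k\<bar> / real (?t choose k))"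
      by (intro sum.cong) (auto simp: \<psi>_def)
    then show ?thesis using that by (simp add: lay)
  qed
  have "(\<Sum>z\<in>Pow T. \<psi> z * chi S z) = 0" if S: "S \<subseteq> T" "card S \<le> d" for S
  proof -
    have finS: "finite S" using S fin finite_subset by blast
    have "(\<Sum>z\<in>Pow T. \<psi> z * (if U \<subseteq> z then 1 else 0)) = 0" if U: "U \<subseteq> S" for U
    proof -
      obtain p :: "real poly" where p: "degree p \<le> card U" "\<And>k. poly p (real k) = real (k choose card U)"
        using binomial_poly by blast
      have UT: "U \<subseteq> T" using U S by blast
      have C: "real (?t choose card U) > 0" using UT fin by (simp add: card_mono)
      have "(\<Sum>z | z \<subseteq> T \<and> card z = k. \<psi> z * (if U \<subseteq> z then 1 else 0))
          = \<omega> k * poly p (real k) / real (?t choose card U)" if k: "k \<le> ?t" for k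
      proof -
        have finl: "finite {z. z \<subseteq> T \<and> card z = k}"
          using fin by (auto intro: finite_subset[OF _ finite_Pow_iff[THEN iffD2, OF fin]])
        have "(\<Sum>z | z \<subseteq> T \<and> card z = k. \<psi> z * (if U \<subseteq> z then 1 else 0))
            = (\<Sum>z | z \<subseteq> T \<and> card z = k. if U \<subseteq> z then \<omega> k / real (?t choose k) else 0)"
          by (intro sum.cong) (auto simp: \<psi>_def)
        also have "\<dots> = real (card {z. z \<subseteq> T \<and> card z = k \<and> U \<subseteq> z}) * (\<omega> k / real (?t choose k))"
          using finl by (subst sum.inter_filter[symmetric]) (auto simp: conj_assoc)
        also have "real (card {z. z \<subseteq> T \<and> card z = k \<and> U \<subseteq> z})
            = real (?t choose k) * real (k choose card U) / real (?t choose card U)"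
          using arg_cong[OF card_supersets[OF fin UT k], of real] C by (simp add: field_simps)
        finally show ?thesis using k by (simp add: p)
      qed
      then have "(\<Sum>z\<in>Pow T. \<psi> z * (if U \<subseteq> z then 1 else 0))
          = (\<Sum>k\<le>?t. \<omega> k * poly p (real k) / real (?t choose card U))"
        unfolding sum_Pow_by_card[OF fin] by (intro sum.cong) auto
      also have "\<dots> = (\<Sum>k\<le>?t. \<omega> k * poly p (real k)) / real (?t choose card U)"
        by (rule sum_divide_distrib[symmetric])
      also have "\<dots> = 0"
        using ortho[of p] p(1) card_mono[OF finS U] S(2) by simp
      finally show ?thesis .
    qed
    then have *: "(- 2) ^ card U * (\<Sum>z\<in>Pow T. \<psi> z * (if U \<subseteq> z then 1 else 0)) = 0" if "U \<in> Pow S" for U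
      using that by simp
    have "(\<Sum>z\<in>Pow T. \<psi> z * chi S z)
        = (\<Sum>z\<in>Pow T. \<Sum>U\<in>Pow S. (- 2) ^ card U * (\<psi> z * (if U \<subseteq> z then 1 else 0)))"
      unfolding chi_expand[OF finS] sum_distrib_left by (intro sum.cong refl) simp
    also have "\<dots> = (\<Sum>U\<in>Pow S. \<Sum>z\<in>Pow T. (- 2) ^ card U * (\<psi> z * (if U \<subseteq> z then 1 else 0)))"
      by (rule sum.swap)
    also have "\<dots> = 0" unfolding sum_distrib_left[symmetric] using * by simp
    finally show ?thesis .
  qed
  moreover have "(\<Sum>z\<in>Pow T. \<bar>\<psi> z\<bar>) \<le> 3"
  proof -
    have "(\<Sum>z\<in>Pow T. \<bar>\<psi> z\<bar>) = (\<Sum>k\<le>?t. \<bar>\<omega> k\<bar>)"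
      unfolding sum_Pow_by_card[OF fin] by (intro sum.cong abs_lay) auto
    then show ?thesis using tail \<omega>0 \<omega>1 unfolding split by simp
  qed
  moreover have "1 / 4 \<le> (\<Sum>z\<in>Pow T. \<psi> z * F z)"
    if F: "\<And>z. z \<subseteq> T \<Longrightarrow> 0 \<le> F z \<and> F z \<le> 1" "2 / 3 \<le> F {}" "\<And>i. i \<in> T \<Longrightarrow> F {i} \<le> 1 / 3" for F
  proof -
    have zero: "(\<Sum>z\<in>Pow T. \<psi> z) = 0" using calculation(1)[of "{}"] by simp
    \<comment> \<open>As \<open>\<psi>\<close> sums to 0, \<open>F\<close> may be centered at 1/2.
      Then layer 0 contributes at least 1/6, layer 1 at least 3/20 and all others together at least
      -1/20; the total 4/15 exceeds 1/4.\<close>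
    define G where "G = (\<lambda>k. \<Sum>z | z \<subseteq> T \<and> card z = k. \<psi> z * (F z - 1 / 2))"
    have "(\<Sum>z\<in>Pow T. \<psi> z * F z) = (\<Sum>z\<in>Pow T. \<psi> z * (F z - 1 / 2)) + (\<Sum>z\<in>Pow T. \<psi> z) / 2"
      by (simp add: algebra_simps sum.distrib sum_subtractf sum_divide_distrib)
    also have "\<dots> = (\<Sum>k\<le>?t. G k)"
      by (simp only: zero) (simp add: sum_Pow_by_card[OF fin] G_def)
    finally have eq: "(\<Sum>z\<in>Pow T. \<psi> z * F z) = G 0 + G 1 + (\<Sum>k\<in>{2..?t}. G k)" unfolding split .
    have "{z. z \<subseteq> T \<and> card z = 0} = {{}}" using fin by (auto dest: finite_subset)
    then have G0: "G 0 \<ge> 1 / 6" using F(2) by (simp add: G_def \<psi>_def \<omega>0)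
    have G1: "G 1 \<ge> 3 / 20"
    proof -
      have "\<psi> z * (F z - 1 / 2) \<ge> 9 / 10 / real ?t * (1 / 6)" if z1: "z \<in> {z. z \<subseteq> T \<and> card z = 1}" for z
      proof -
        obtain i where z: "z = {i}" "i \<in> T" using z1 by (auto simp: card_1_singleton_iff)
        have "9 / 10 / real ?t * (1 / 6) \<le> (- \<psi> z) * (1 / 2 - F z)"
          using \<omega>1 F(3)[OF z(2)] z d(2) by (intro mult_mono) (auto simp: \<psi>_def divide_right_mono divide_simps)
        then show ?thesis by (simp add: algebra_simps)
      qed
      then have "G 1 \<ge> (\<Sum>z | z \<subseteq> T \<and> card z = 1. 9 / 10 / real ?t * (1 / 6))"
        unfolding G_def by (rule sum_mono)
      also have "(\<Sum>z | z \<subseteq> T \<and> card z = 1. 9 / 10 / real ?t * (1 / 6)) = 3 / 20"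
        using d(2) lay[of 1] by simp
      finally show ?thesis .
    qed
    have "\<bar>\<Sum>k\<in>{2..?t}. G k\<bar> \<le> (\<Sum>k\<in>{2..?t}. \<bar>\<omega> k\<bar> / 2)"
    proof (rule order_trans[OF sum_abs sum_mono])
      fix k assume k: "k \<in> {2..?t}"
      have "\<bar>G k\<bar> \<le> (\<Sum>z | z \<subseteq> T \<and> card z = k. \<bar>\<psi> z * (F z - 1 / 2)\<bar>)" unfolding G_def by (rule sum_abs)
      also have "\<dots> \<le> (\<Sum>z | z \<subseteq> T \<and> card z = k. \<bar>\<psi> z\<bar> * (1 / 2))"
      proof (rule sum_mono)
        fix z assume "z \<in> {z. z \<subseteq> T \<and> card z = k}"
        then have "0 \<le> F z" "F z \<le> 1" using F(1)[of z] by auto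
        then have "\<bar>F z - 1 / 2\<bar> \<le> 1 / 2" by linarith
        then show "\<bar>\<psi> z * (F z - 1 / 2)\<bar> \<le> \<bar>\<psi> z\<bar> * (1 / 2)"
          unfolding abs_mult by (rule mult_left_mono) simp
      qed
      also have "\<dots> = \<bar>\<omega> k\<bar> / 2" unfolding sum_distrib_right[symmetric] using abs_lay[of k] k by simp
      finally show "\<bar>G k\<bar> \<le> \<bar>\<omega> k\<bar> / 2" .
    qed
    also have "\<dots> \<le> 1 / 20" using tail by (simp add: sum_divide_distrib[symmetric])
    finally show ?thesis using eq G0 G1 by linarith
  qed
  ultimately show thesis by (rule that)
qed

section \<open>Pattern matrices\<close>

text \<open>Alice's string \<open>x\<close> has two bits for each \<open>i\<close>; Bob selects one of them by \<open>V\<close> and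
  possibly negates it by \<open>w\<close>.\<close>

definition coord :: "nat set \<Rightarrow> nat \<Rightarrow> nat" where
  "coord V i = 2 * i + of_bool (i \<in> V)"

definition pattern :: "nat set \<Rightarrow> nat set \<Rightarrow> nat set \<Rightarrow> nat set \<Rightarrow> nat set" where
  "pattern T x V w = {i \<in> T. (coord V i \<in> x) \<noteq> (i \<in> w)}"

lemma coord_div [simp]: "coord V i div 2 = i"
  by (simp add: coord_def)

lemma coord_less: "i < t \<Longrightarrow> coord V i < 2 * t"
  by (simp add: coord_def)

lemma inj_coord: "inj_on (coord V) S"
  by (metis coord_div inj_onI)

lemma pattern_subset: "pattern T x V w \<subseteq> T"
  by (auto simp: pattern_def)

text \<open>The selected bit and the mask are combined by XOR, so characters of the pattern factor
  into one of Alice's string and one of Bob's mask.\<close>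

lemma chi_pattern:
  assumes "finite T" "S \<subseteq> T"
  shows "chi S (pattern T x V w) = chi (coord V ` S) x * chi S w"
proof -
  have fin: "finite S" using assms finite_subset by blast
  have "chi (coord V ` S) x = (\<Prod>i\<in>S. if coord V i \<in> x then - 1 else 1)"
    using fin inj_coord by (simp add: chi_prod prod.reindex)
  moreover have "chi S (pattern T x V w)
      = (\<Prod>i\<in>S. (if coord V i \<in> x then - 1 else 1) * (if i \<in> w then - 1 else 1))"
    unfolding chi_prod[OF fin]
  proof (rule prod.cong[OF refl])
    fix i assume "i \<in> S"
    then have "i \<in> T" using assms(2) by blast
    then show "(if i \<in> pattern T x V w then - 1 else 1)
        = (if coord V i \<in> x then - 1 else 1) * (if i \<in> w then - 1 else 1 :: real)"
      by (simp add: pattern_def)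
  qed
  ultimately show ?thesis unfolding chi_prod[OF fin] by (simp only: prod.distrib)
qed

text \<open>For fixed \<open>x\<close> and \<open>V\<close>, the map from the mask to the pattern is
  an involution.\<close>

lemma sum_pattern_eq:
  assumes "finite T"
  shows "(\<Sum>w\<in>Pow T. h (pattern T x V w)) = (\<Sum>z\<in>Pow T. h z)"
  by (rule sum.reindex_bij_witness[where i = "pattern T x V" and j = "pattern T x V"])
    (auto simp: pattern_def)

text \<open>The image of \<open>S\<close> under \<open>coord V\<close> determines \<open>S\<close>
  and \<open>V \<inter> S\<close>, so every \<open>Y\<close> comes from at most one such pair, and
  each pair from only \<open>2 ^ card (T - S)\<close> selections \<open>V\<close>. The gain for
  large \<open>S\<close> takes the place of a bound on the spectral norm of the pattern
  matrix.\<close>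

lemma sum_selections_le:
  fixes G :: "nat set \<Rightarrow> real" and t d :: nat
  assumes G: "\<And>Y. G Y \<ge> 0"
  defines "T \<equiv> {..<t}"
  shows "(\<Sum>S | S \<subseteq> T \<and> d < card S. \<Sum>V\<in>Pow T. G (coord V ` S))
    \<le> 2 ^ t / 2 ^ Suc d * (\<Sum>Y\<in>Pow {..<2 * t}. G Y)"
proof -
  have finT: "finite T" "card T = t" by (auto simp: T_def)
  let ?\<S> = "{S. S \<subseteq> T \<and> d < card S}"
  have fin\<S>: "finite ?\<S>" using finT by (auto intro: finite_subset[of _ "Pow T"])
  have finS: "finite S" if "S \<subseteq> T" for S using that finT finite_subset by blast
  have "(\<Sum>V\<in>Pow T. G (coord V ` S)) \<le> 2 ^ t / 2 ^ Suc d * (\<Sum>V\<in>Pow S. G (coord V ` S))"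
    if S: "S \<in> ?\<S>" for S
  proof -
    have "(\<Sum>V\<in>Pow T. G (coord V ` S)) = (\<Sum>(V, V')\<in>Pow S \<times> Pow (T - S). G (coord V ` S))"
    proof (rule sum.reindex_bij_witness[where i = "\<lambda>(V, V'). V \<union> V'" and j = "\<lambda>V. (V \<inter> S, V - S)"])
      fix V assume "V \<in> Pow T"
      have "coord (V \<inter> S) ` S = coord V ` S" by (intro image_cong) (auto simp: coord_def)
      then show "(case (V \<inter> S, V - S) of (V, V') \<Rightarrow> G (coord V ` S)) = G (coord V ` S)" by simp
    qed (use S in auto)
    also have "\<dots> = (\<Sum>V\<in>Pow S. \<Sum>V'\<in>Pow (T - S). G (coord V ` S))"
      by (rule sum.cartesian_product[symmetric])
    also have "\<dots> = 2 ^ card (T - S) * (\<Sum>V\<in>Pow S. G (coord V ` S))"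
      using finT by (simp add: sum_distrib_left card_Pow)
    also have "(2 :: real) ^ card (T - S) \<le> 2 ^ t / 2 ^ Suc d"
    proof -
      have "Suc d + card (T - S) \<le> t"
      proof -
        have "card (T - S) = t - card S" using S finT finS by (simp add: card_Diff_subset)
        moreover have "card S \<le> t" using S finT card_mono[of T S] by simp
        moreover have "d < card S" using S by simp
        ultimately show ?thesis by linarith
      qed
      then have "(2 :: real) ^ (Suc d + card (T - S)) \<le> 2 ^ t" by (rule power_increasing) simp
      then show ?thesis by (simp add: field_simps power_add)
    qed
    finally show ?thesis using G by (simp add: mult_right_mono sum_nonneg)
  qed
  then have "(\<Sum>S\<in>?\<S>. \<Sum>V\<in>Pow T. G (coord V ` S))
      \<le> (\<Sum>S\<in>?\<S>. 2 ^ t / 2 ^ Suc d * (\<Sum>V\<in>Pow S. G (coord V ` S)))"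
    by (rule sum_mono)
  also have "\<dots> = 2 ^ t / 2 ^ Suc d * (\<Sum>S\<in>?\<S>. \<Sum>V\<in>Pow S. G (coord V ` S))"
    by (rule sum_distrib_left[symmetric])
  also have "(\<Sum>S\<in>?\<S>. \<Sum>V\<in>Pow S. G (coord V ` S)) = (\<Sum>(S, V)\<in>(SIGMA S:?\<S>. Pow S). G (coord V ` S))"
    using fin\<S> finS by (intro sum.Sigma) auto
  also have "\<dots> = sum (G \<circ> (\<lambda>(S, V). coord V ` S)) (SIGMA S:?\<S>. Pow S)"
    by (intro sum.cong) auto
  also have "\<dots> = (\<Sum>Y\<in>(\<lambda>(S, V). coord V ` S) ` (SIGMA S:?\<S>. Pow S). G Y)"
  proof (rule sum.reindex[symmetric], rule inj_onI, clarify)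
    fix S V S' V' assume V: "V \<subseteq> S" "V' \<subseteq> S'" and eq: "coord V ` S = coord V' ` S'"
    \<comment> \<open>Halving the elements of the image recovers \<open>S\<close>; their parity
      recovers \<open>V\<close>.\<close>
    have "(\<lambda>k. k div 2) ` coord V ` S = (\<lambda>k. k div 2) ` coord V' ` S'" using eq by simp
    then have SS: "S = S'" by (simp add: image_image)
    have mem: "i \<in> V \<longleftrightarrow> 2 * i + 1 \<in> coord V ` S" if "V \<subseteq> S" for i V and S :: "nat set"
    proof -
      have "2 * i + 1 = coord V x \<longleftrightarrow> x = i \<and> i \<in> V" for x
        unfolding coord_def by (cases "x \<in> V") (auto dest: arg_cong[of _ _ even])
      then show ?thesis using that by (auto simp: image_iff)
    qed
    have "V = V'"
      unfolding set_eq_iff mem[OF V(1)] mem[OF V(2)] eq by simp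
    with SS show "S = S' \<and> V = V'" by simp
  qed
  also have "2 ^ t / 2 ^ Suc d * (\<Sum>Y\<in>(\<lambda>(S, V). coord V ` S) ` (SIGMA S:?\<S>. Pow S). G Y)
      \<le> 2 ^ t / 2 ^ Suc d * (\<Sum>Y\<in>Pow {..<2 * t}. G Y)"
    using G by (intro mult_left_mono sum_mono2) (auto simp: T_def coord_less subset_iff)
  finally show ?thesis .
qed

text \<open>The Fourier expansion of \<open>\<psi>\<close> contains only sets with more than
  \<open>d\<close> elements, and each character splits the sum into a transform of \<open>u\<close>
  and one of \<open>v\<close>. Cauchy-Schwarz and Parseval bound these by \<open>K\<close>, whatever
  the size of \<open>R\<close>; the factor \<open>2 ^ Suc d\<close> comes from
  \<open>sum_selections_le\<close>.\<close>

lemma pattern_discrepancy: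
  fixes u :: "'r \<Rightarrow> nat set \<Rightarrow> complex" and v :: "'r \<Rightarrow> nat set \<Rightarrow> nat set \<Rightarrow> complex"
    and t d :: nat
  defines "T \<equiv> {..<t}" and "X \<equiv> Pow {..<2 * t}"
  assumes finR: "finite R"
    and u: "\<And>x. x \<in> X \<Longrightarrow> (\<Sum>r\<in>R. (cmod (u r x))\<^sup>2) \<le> K"
    and v: "\<And>V w. V \<subseteq> T \<Longrightarrow> w \<subseteq> T \<Longrightarrow> (\<Sum>r\<in>R. (cmod (v r V w))\<^sup>2) \<le> K"
    and \<psi>: "\<And>S. S \<subseteq> T \<Longrightarrow> card S \<le> d \<Longrightarrow> (\<Sum>z\<in>Pow T. \<psi> z * chi S z) = 0"
    and L: "(\<Sum>z\<in>Pow T. \<bar>\<psi> z\<bar>) \<le> L"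
  shows "cmod (\<Sum>x\<in>X. \<Sum>V\<in>Pow T. \<Sum>w\<in>Pow T. of_real (\<psi> (pattern T x V w)) * (\<Sum>r\<in>R. u r x * v r V w))
    \<le> L * K * 8 ^ t / sqrt (2 ^ Suc d)"
proof -
  have finT: "finite T" "card T = t" by (auto simp: T_def)
  have finX: "finite X" "card X = 4 ^ t" by (auto simp: X_def card_Pow power_mult)
  have K: "K \<ge> 0" by (rule order_trans[OF _ u[of "{}"]]) (auto simp: X_def sum_nonneg)
  define c where "c = (\<lambda>S. (\<Sum>z\<in>Pow T. \<psi> z * chi S z) / 2 ^ t)"
  let ?\<S> = "{S. S \<subseteq> T \<and> d < card S}"
  have fin\<S>: "finite ?\<S>" using finT by (auto intro: finite_subset[of _ "Pow T"])
  have L0: "L \<ge> 0" by (rule order_trans[OF _ L]) (simp add: sum_nonneg)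
  have c: "\<bar>c S\<bar> \<le> L / 2 ^ t" for S
  proof -
    have "\<bar>\<Sum>z\<in>Pow T. \<psi> z * chi S z\<bar> \<le> (\<Sum>z\<in>Pow T. \<bar>\<psi> z * chi S z\<bar>)" by (rule sum_abs)
    also have "\<dots> \<le> L" using L by (simp add: abs_mult)
    finally show ?thesis by (simp add: c_def divide_right_mono)
  qed
  have \<psi>_eq: "\<psi> z = (\<Sum>S\<in>?\<S>. c S * chi S z)" if "z \<subseteq> T" for z
  proof -
    have "\<psi> z = (\<Sum>S\<in>Pow T. c S * chi S z)"
      using chi_inversion[OF finT(1) that, of \<psi>] by (simp add: c_def finT)
    also have "\<dots> = (\<Sum>S\<in>?\<S>. c S * chi S z)"
      using finT \<psi> by (intro sum.mono_neutral_right) (auto simp: c_def not_less)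
    finally show ?thesis .
  qed
  define \<alpha> where "\<alpha> = (\<lambda>r Y. \<Sum>x\<in>X. u r x * of_real (chi Y x))"
  define \<beta> where "\<beta> = (\<lambda>r V S. \<Sum>w\<in>Pow T. v r V w * of_real (chi S w))"
  let ?I = "?\<S> \<times> Pow T \<times> R"
  have \<psi>_pattern: "\<psi> (pattern T x V w) = (\<Sum>S\<in>?\<S>. c S * (chi (coord V ` S) x * chi S w))" for x V w
    unfolding \<psi>_eq[OF pattern_subset] by (intro sum.cong) (auto simp: chi_pattern[OF finT(1)])
  have "(\<Sum>x\<in>X. \<Sum>V\<in>Pow T. \<Sum>w\<in>Pow T. of_real (\<psi> (pattern T x V w)) * (\<Sum>r\<in>R. u r x * v r V w))
      = (\<Sum>x\<in>X. \<Sum>V\<in>Pow T. \<Sum>w\<in>Pow T. \<Sum>S\<in>?\<S>. \<Sum>r\<in>R. of_real (c S) *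
          ((u r x * of_real (chi (coord V ` S) x)) * (v r V w * of_real (chi S w))))"
    by (intro sum.cong refl) (simp add: \<psi>_pattern sum_distrib_left sum_distrib_right mult_ac)
  also have "\<dots> = (\<Sum>(x, V, w, S, r)\<in>X \<times> Pow T \<times> Pow T \<times> ?\<S> \<times> R. of_real (c S) *
          ((u r x * of_real (chi (coord V ` S) x)) * (v r V w * of_real (chi S w))))"
    by (simp only: sum.cartesian_product split_def fst_conv snd_conv)
  also have "\<dots> = (\<Sum>(S, V, r, x, w)\<in>?\<S> \<times> Pow T \<times> R \<times> X \<times> Pow T. of_real (c S) *
          ((u r x * of_real (chi (coord V ` S) x)) * (v r V w * of_real (chi S w))))"
    by (rule sum.reindex_bij_witness[where i = "\<lambda>(S, V, r, x, w). (x, V, w, S, r)"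
          and j = "\<lambda>(x, V, w, S, r). (S, V, r, x, w)"]) auto
  also have "\<dots> = (\<Sum>S\<in>?\<S>. \<Sum>V\<in>Pow T. \<Sum>r\<in>R. \<Sum>x\<in>X. \<Sum>w\<in>Pow T. of_real (c S) *
          ((u r x * of_real (chi (coord V ` S) x)) * (v r V w * of_real (chi S w))))"
    by (simp only: sum.cartesian_product split_def fst_conv snd_conv)
  also have "\<dots> = (\<Sum>S\<in>?\<S>. \<Sum>V\<in>Pow T. \<Sum>r\<in>R. of_real (c S) * (\<alpha> r (coord V ` S) * \<beta> r V S))"
    unfolding \<alpha>_def \<beta>_def sum_product unfolding sum_distrib_left ..
  also have "\<dots> = (\<Sum>(S, V, r)\<in>?I. of_real (c S) * (\<alpha> r (coord V ` S) * \<beta> r V S))"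
    by (simp only: sum.cartesian_product split_def fst_conv snd_conv)
  finally have eq: "(\<Sum>x\<in>X. \<Sum>V\<in>Pow T. \<Sum>w\<in>Pow T.
      of_real (\<psi> (pattern T x V w)) * (\<Sum>r\<in>R. u r x * v r V w)) = \<dots>" .
  have "cmod (\<Sum>x\<in>X. \<Sum>V\<in>Pow T. \<Sum>w\<in>Pow T.
        of_real (\<psi> (pattern T x V w)) * (\<Sum>r\<in>R. u r x * v r V w))
      \<le> (\<Sum>(S, V, r)\<in>?I. L / 2 ^ t * (cmod (\<alpha> r (coord V ` S)) * cmod (\<beta> r V S)))"
    (is "?lhs \<le> _")
    unfolding eq
  proof (rule sum_norm_le, clarify)
    fix S V r
    show "cmod (of_real (c S) * (\<alpha> r (coord V ` S) * \<beta> r V S))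
        \<le> L / 2 ^ t * (cmod (\<alpha> r (coord V ` S)) * cmod (\<beta> r V S))"
      unfolding norm_mult norm_of_real by (intro mult_right_mono c) simp
  qed
  also have "\<dots> = L / 2 ^ t * (\<Sum>(S, V, r)\<in>?I. cmod (\<alpha> r (coord V ` S)) * cmod (\<beta> r V S))"
    by (simp only: split_def sum_distrib_left)
  finally have main: "?lhs \<le> L / 2 ^ t * (\<Sum>(S, V, r)\<in>?I. cmod (\<alpha> r (coord V ` S)) * cmod (\<beta> r V S))" .
  \<comment> \<open>Parseval on the \<open>2 * t\<close> bits of \<open>x\<close> contributes
    \<open>4 ^ t\<close>, and the number of strings \<open>x\<close> another
    \<open>4 ^ t\<close>.\<close>
  have A: "(\<Sum>(S, V, r)\<in>?I. (cmod (\<alpha> r (coord V ` S)))\<^sup>2) \<le> 2 ^ t / 2 ^ Suc d * (16 ^ t * K)"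
  proof -
    have "(\<Sum>(S, V, r)\<in>?I. (cmod (\<alpha> r (coord V ` S)))\<^sup>2)
        = (\<Sum>(r, S, V)\<in>R \<times> ?\<S> \<times> Pow T. (cmod (\<alpha> r (coord V ` S)))\<^sup>2)"
      by (rule sum.reindex_bij_witness[where i = "\<lambda>(r, S, V). (S, V, r)" and j = "\<lambda>(S, V, r). (r, S, V)"]) auto
    also have "\<dots> = (\<Sum>r\<in>R. \<Sum>S\<in>?\<S>. \<Sum>V\<in>Pow T. (cmod (\<alpha> r (coord V ` S)))\<^sup>2)"
      by (simp only: sum.cartesian_product split_def fst_conv snd_conv)
    also have "\<dots> \<le> (\<Sum>r\<in>R. 2 ^ t / 2 ^ Suc d * (\<Sum>Y\<in>X. (cmod (\<alpha> r Y))\<^sup>2))"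
      unfolding X_def T_def by (intro sum_mono sum_selections_le) simp
    also have "\<dots> = (\<Sum>r\<in>R. 2 ^ t / 2 ^ Suc d * (4 ^ t * (\<Sum>x\<in>X. (cmod (u r x))\<^sup>2)))"
      unfolding \<alpha>_def X_def by (simp add: chi_parseval power_mult)
    also have "\<dots> = 2 ^ t / 2 ^ Suc d * (4 ^ t * (\<Sum>x\<in>X. \<Sum>r\<in>R. (cmod (u r x))\<^sup>2))"
      unfolding sum_distrib_left by (rule sum.swap)
    also have "\<dots> \<le> 2 ^ t / 2 ^ Suc d * (4 ^ t * (\<Sum>x\<in>X. K))"
      using u by (intro mult_left_mono sum_mono) auto
    also have "\<dots> = 2 ^ t / 2 ^ Suc d * (16 ^ t * K)"
      by (simp add: finX power_mult_distrib[symmetric])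
    finally show ?thesis .
  qed
  \<comment> \<open>No gain from large \<open>S\<close> is sought here; admitting all subsets of
    \<open>T\<close> makes Parseval in \<open>w\<close> applicable.\<close>
  have B: "(\<Sum>(S, V, r)\<in>?I. (cmod (\<beta> r V S))\<^sup>2) \<le> 8 ^ t * K"
  proof -
    have "(\<Sum>(S, V, r)\<in>?I. (cmod (\<beta> r V S))\<^sup>2) \<le> (\<Sum>(S, V, r)\<in>Pow T \<times> Pow T \<times> R. (cmod (\<beta> r V S))\<^sup>2)"
      using finT finR by (intro sum_mono2) auto
    also have "\<dots> = (\<Sum>(V, r, S)\<in>Pow T \<times> R \<times> Pow T. (cmod (\<beta> r V S))\<^sup>2)"
      by (rule sum.reindex_bij_witness[where i = "\<lambda>(V, r, S). (S, V, r)" and j = "\<lambda>(S, V, r). (V, r, S)"]) auto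
    also have "\<dots> = (\<Sum>V\<in>Pow T. \<Sum>r\<in>R. \<Sum>S\<in>Pow T. (cmod (\<beta> r V S))\<^sup>2)"
      by (simp only: sum.cartesian_product split_def fst_conv snd_conv)
    also have "\<dots> = (\<Sum>V\<in>Pow T. \<Sum>r\<in>R. 2 ^ t * (\<Sum>w\<in>Pow T. (cmod (v r V w))\<^sup>2))"
      unfolding \<beta>_def by (simp add: chi_parseval finT)
    also have "\<dots> = (\<Sum>V\<in>Pow T. 2 ^ t * (\<Sum>w\<in>Pow T. \<Sum>r\<in>R. (cmod (v r V w))\<^sup>2))"
      unfolding sum_distrib_left by (intro sum.cong refl sum.swap)
    also have "\<dots> \<le> (\<Sum>V\<in>Pow T. 2 ^ t * (\<Sum>w\<in>Pow T. K))"
      using v by (intro sum_mono mult_left_mono) auto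
    also have "\<dots> = 8 ^ t * K"
      using finT by (simp add: card_Pow power_mult_distrib[symmetric])
    finally show ?thesis .
  qed
  have "(\<Sum>(S, V, r)\<in>?I. cmod (\<alpha> r (coord V ` S)) * cmod (\<beta> r V S))\<^sup>2
      \<le> (\<Sum>(S, V, r)\<in>?I. (cmod (\<alpha> r (coord V ` S)))\<^sup>2) * (\<Sum>(S, V, r)\<in>?I. (cmod (\<beta> r V S))\<^sup>2)"
    unfolding split_def by (rule Cauchy_Schwarz_ineq_sum)
  also have "\<dots> \<le> (2 ^ t / 2 ^ Suc d * (16 ^ t * K)) * (8 ^ t * K)"
    using A B K by (intro mult_mono) (auto simp: split_def intro!: sum_nonneg)
  also have "\<dots> = (16 ^ t * K / sqrt (2 ^ Suc d))\<^sup>2"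
    by (simp add: power_divide power_mult_distrib power2_eq_square power_mult_distrib[symmetric])
  finally have "(\<Sum>(S, V, r)\<in>?I. cmod (\<alpha> r (coord V ` S)) * cmod (\<beta> r V S)) \<le> 16 ^ t * K / sqrt (2 ^ Suc d)"
    by (rule power2_le_imp_le) (use K in simp)
  then have "?lhs \<le> L / 2 ^ t * (16 ^ t * K / sqrt (2 ^ Suc d))"
    using L0 by (intro order_trans[OF main] mult_left_mono) auto
  also have "\<dots> = L * K * (16 ^ t / 2 ^ t) / sqrt (2 ^ Suc d)" by simp
  also have "(16 :: real) ^ t / 2 ^ t = 8 ^ t" by (simp add: power_divide[symmetric])
  finally show ?thesis .
qed

section \<open>Contractions\<close>

lemma index_mult_mat_sum:
  fixes A B :: "'a :: semiring_0 mat"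
  assumes "A \<in> carrier_mat n m" "B \<in> carrier_mat m k" "i < n" "j < k"
  shows "(A * B) $$ (i, j) = (\<Sum>l<m. A $$ (i, l) * B $$ (l, j))"
  using assms by (simp add: scalar_prod_def lessThan_atLeast0)

definition adj :: "complex mat \<Rightarrow> complex mat" where
  "adj A = Matrix.mat (dim_col A) (dim_row A) (\<lambda>(i, j). cnj (A $$ (j, i)))"

lemma mat_adjoint_eq_adj: "mat_adjoint A = adj A"
  unfolding mat_adjoint_def adj_def
  by (rule eq_matI) (auto simp: mat_of_rows_def)

lemma adj_carrier [simp]: "A \<in> carrier_mat n m \<Longrightarrow> adj A \<in> carrier_mat m n"
  by (simp add: adj_def)

lemma dim_adj [simp]: "dim_row (adj A) = dim_col A" "dim_col (adj A) = dim_row A"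
  by (simp_all add: adj_def)

lemma index_adj: "A \<in> carrier_mat n m \<Longrightarrow> i < m \<Longrightarrow> j < n \<Longrightarrow> adj A $$ (i, j) = cnj (A $$ (j, i))"
  by (simp add: adj_def)

lemma adj_adj: "A \<in> carrier_mat n m \<Longrightarrow> adj (adj A) = A"
  by (rule eq_matI) (auto simp: adj_def)

lemma adj_mult:
  assumes "A \<in> carrier_mat n m" "B \<in> carrier_mat m k"
  shows "adj (A * B) = adj B * adj A"
proof (rule eq_matI)
  fix i j assume "i < dim_row (adj B * adj A)" "j < dim_col (adj B * adj A)"
  then have ij: "i < k" "j < n" using assms by (auto simp: adj_def)
  have "adj (A * B) $$ (i, j) = cnj (\<Sum>l<m. A $$ (j, l) * B $$ (l, i))"
    using assms ij by (simp add: index_adj[of _ n k] index_mult_mat_sum[OF assms] del: index_mult_mat)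
  also have "\<dots> = (\<Sum>l<m. adj B $$ (i, l) * adj A $$ (l, j))"
    using assms ij by (simp add: index_adj[of _ n m] index_adj[of _ m k] mult.commute)
  also have "\<dots> = (adj B * adj A) $$ (i, j)"
    using assms ij by (intro index_mult_mat_sum[symmetric]) auto
  finally show "adj (A * B) $$ (i, j) = (adj B * adj A) $$ (i, j)" .
qed (use assms in \<open>auto simp: adj_def\<close>)

text \<open>The Hilbert-Schmidt inner product, which for coefficient matrices is the inner product
  of the joint states. \<open>hs\<close> is the corresponding squared norm.\<close>

definition ip :: "complex mat \<Rightarrow> complex mat \<Rightarrow> complex" where
  "ip A B = (\<Sum>i<dim_row A. \<Sum>j<dim_col A. cnj (A $$ (i, j)) * B $$ (i, j))"

definition hs :: "complex mat \<Rightarrow> real" where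
  "hs A = (\<Sum>i<dim_row A. \<Sum>j<dim_col A. (cmod (A $$ (i, j)))\<^sup>2)"

lemma ip_self: "ip A A = of_real (hs A)"
  unfolding ip_def hs_def of_real_sum complex_norm_square by (simp add: mult.commute)

lemma hs_nonneg: "hs A \<ge> 0"
  by (simp add: hs_def sum_nonneg)

lemma hs_adj: "hs (adj A) = hs A"
proof -
  have "hs (adj A) = (\<Sum>i<dim_col A. \<Sum>j<dim_row A. (cmod (A $$ (j, i)))\<^sup>2)"
    by (simp add: hs_def adj_def)
  also have "\<dots> = hs A" unfolding hs_def by (rule sum.swap)
  finally show ?thesis .
qed

lemma ip_adj:
  assumes "A \<in> carrier_mat n m" "B \<in> carrier_mat n m"
  shows "ip (adj A) (adj B) = cnj (ip A B)"
proof -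
  have "ip (adj A) (adj B) = (\<Sum>i<m. \<Sum>j<n. A $$ (j, i) * cnj (B $$ (j, i)))"
    using assms by (simp add: ip_def adj_def)
  also have "\<dots> = (\<Sum>j<n. \<Sum>i<m. A $$ (j, i) * cnj (B $$ (j, i)))" by (rule sum.swap)
  also have "\<dots> = cnj (ip A B)" using assms by (simp add: ip_def)
  finally show ?thesis .
qed

lemma ip_mult_left:
  assumes A: "A \<in> carrier_mat n m" and B: "B \<in> carrier_mat m k" and C: "C \<in> carrier_mat n k"
  shows "ip C (A * B) = ip (adj A * C) B"
proof -
  have "ip C (A * B) = (\<Sum>i<n. \<Sum>j<k. \<Sum>l<m. cnj (C $$ (i, j)) * (A $$ (i, l) * B $$ (l, j)))"
    using assms by (simp add: ip_def index_mult_mat_sum[OF A B] sum_distrib_left del: index_mult_mat(1))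
  also have "\<dots> = (\<Sum>i<n. \<Sum>l<m. \<Sum>j<k. cnj (C $$ (i, j)) * (A $$ (i, l) * B $$ (l, j)))"
    by (intro sum.cong refl sum.swap)
  also have "\<dots> = (\<Sum>l<m. \<Sum>i<n. \<Sum>j<k. cnj (C $$ (i, j)) * (A $$ (i, l) * B $$ (l, j)))"
    by (rule sum.swap)
  also have "\<dots> = (\<Sum>l<m. \<Sum>j<k. \<Sum>i<n. cnj (C $$ (i, j)) * (A $$ (i, l) * B $$ (l, j)))"
    by (intro sum.cong refl sum.swap)
  also have "\<dots> = (\<Sum>l<m. \<Sum>j<k. cnj (\<Sum>i<n. adj A $$ (l, i) * C $$ (i, j)) * B $$ (l, j))"
    by (intro sum.cong refl) (simp add: index_adj[OF A] sum_distrib_left sum_distrib_right mult_ac)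
  also have "\<dots> = ip (adj A * C) B"
    using assms by (simp add: ip_def index_mult_mat_sum[OF adj_carrier[OF A] C] del: index_mult_mat(1))
  finally show ?thesis .
qed

lemma ip_mult_right:
  assumes A: "A \<in> carrier_mat n m" and B: "B \<in> carrier_mat m k" and C: "C \<in> carrier_mat n k"
  shows "ip C (A * B) = ip (C * adj B) A"
proof -
  have "cnj (ip C (A * B)) = ip (adj C) (adj B * adj A)"
    using ip_adj[of C n k "A * B"] assms by (simp add: adj_mult[OF A B])
  also have "\<dots> = ip (adj (adj B) * adj C) (adj A)"
    using assms by (intro ip_mult_left[of _ k m _ n]) auto
  also have "\<dots> = ip (adj (C * adj B)) (adj A)"
    using assms by (subst adj_mult[of C n k "adj B" m]) auto
  also have "\<dots> = cnj (ip (C * adj B) A)"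
    using assms by (intro ip_adj[of _ n m]) (auto intro!: mult_carrier_mat[of _ n k])
  finally show ?thesis by simp
qed

lemma cmod_ip_le:
  assumes "A \<in> carrier_mat n m" "B \<in> carrier_mat n m"
  shows "(cmod (ip A B))\<^sup>2 \<le> hs A * hs B"
proof -
  have "cmod (ip A B) \<le> (\<Sum>i<n. \<Sum>j<m. cmod (A $$ (i, j)) * cmod (B $$ (i, j)))"
    using assms by (auto simp: ip_def norm_mult intro!: sum_norm_le)
  also have "\<dots> = (\<Sum>p\<in>{..<n} \<times> {..<m}. cmod (A $$ p) * cmod (B $$ p))"
    by (simp add: sum.cartesian_product split_def)
  finally have "(cmod (ip A B))\<^sup>2 \<le> (\<Sum>p\<in>{..<n} \<times> {..<m}. cmod (A $$ p) * cmod (B $$ p))\<^sup>2"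
    by (rule power_mono) simp
  also have "\<dots> \<le> (\<Sum>p\<in>{..<n} \<times> {..<m}. (cmod (A $$ p))\<^sup>2) * (\<Sum>p\<in>{..<n} \<times> {..<m}. (cmod (B $$ p))\<^sup>2)"
    by (rule Cauchy_Schwarz_ineq_sum)
  also have "\<dots> = hs A * hs B"
    using assms by (simp add: hs_def sum.cartesian_product split_def)
  finally show ?thesis .
qed

definition contraction :: "complex mat \<Rightarrow> bool" where
  "contraction A \<longleftrightarrow> (\<forall>k. \<forall>B \<in> carrier_mat (dim_col A) k. hs (A * B) \<le> hs B)"

lemma contraction_leftD:
  "contraction A \<Longrightarrow> A \<in> carrier_mat n m \<Longrightarrow> B \<in> carrier_mat m k \<Longrightarrow> hs (A * B) \<le> hs B"
  by (auto simp: contraction_def)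

text \<open>For \<open>C = adj A * B\<close>, Cauchy-Schwarz applied to
  \<open>hs C = ip (A * C) B\<close> gives
  \<open>(hs C)\<^sup>2 \<le> hs (A * C) * hs B \<le> hs C * hs B\<close>, and \<open>hs C\<close>
  cancels.\<close>

lemma contraction_adj:
  assumes c: "contraction A" and A: "A \<in> carrier_mat n m"
  shows "contraction (adj A)"
  unfolding contraction_def
proof (intro allI ballI)
  fix k and B :: "complex mat" assume "B \<in> carrier_mat (dim_col (adj A)) k"
  then have B: "B \<in> carrier_mat n k" using A by (simp add: adj_def)
  let ?C = "adj A * B"
  have C: "?C \<in> carrier_mat m k" using A B by (intro mult_carrier_mat[of _ m n]) simp_all
  have "of_real (hs ?C) = ip ?C ?C" by (simp add: ip_self)
  also have "\<dots> = ip (adj (adj A) * ?C) B"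
    using A B C by (intro ip_mult_left[of _ m n _ k]) auto
  finally have eq: "complex_of_real (hs ?C) = ip (A * ?C) B" using adj_adj[OF A] by simp
  have "(hs ?C)\<^sup>2 = (cmod (of_real (hs ?C)))\<^sup>2" by simp
  also have "\<dots> \<le> hs (A * ?C) * hs B"
    unfolding eq using A B C by (intro cmod_ip_le[of _ n k]) auto
  also have "\<dots> \<le> hs ?C * hs B"
    using contraction_leftD[OF c A C] by (simp add: mult_right_mono hs_nonneg)
  finally have "hs ?C * hs ?C \<le> hs ?C * hs B" by (simp add: power2_eq_square)
  then show "hs ?C \<le> hs B"
    using hs_nonneg[of ?C] hs_nonneg[of B] by (cases "hs ?C = 0") auto
qed

lemma contraction_rightD:
  assumes "contraction A" "A \<in> carrier_mat n m" "B \<in> carrier_mat k n"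
  shows "hs (B * A) \<le> hs B"
proof -
  have "hs (B * A) = hs (adj A * adj B)"
    using adj_mult[OF assms(3,2)] hs_adj by metis
  also have "\<dots> \<le> hs (adj B)"
    using assms by (intro contraction_leftD[OF contraction_adj[OF assms(1,2)], of m n _ k]) auto
  finally show ?thesis by (simp add: hs_adj)
qed

lemma contraction_mult:
  assumes "contraction A" "contraction B" "A \<in> carrier_mat n m" "B \<in> carrier_mat m k"
  shows "contraction (A * B)"
  unfolding contraction_def
proof (intro allI ballI)
  fix l and C :: "complex mat" assume "C \<in> carrier_mat (dim_col (A * B)) l"
  then have C: "C \<in> carrier_mat k l" using assms by simp
  have "hs (A * B * C) = hs (A * (B * C))" using assoc_mult_mat[OF assms(3,4) C] by simp
  also have "\<dots> \<le> hs (B * C)" using assms C by (intro contraction_leftD[of _ n m _ l]) auto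
  also have "\<dots> \<le> hs C" using assms C by (intro contraction_leftD[of _ m k _ l]) auto
  finally show "hs (A * B * C) \<le> hs C" .
qed

lemma unitary_hs:
  assumes "is_unitary d U" "B \<in> carrier_mat d k"
  shows "hs (U * B) = hs B"
proof -
  have U: "U \<in> carrier_mat d d" "adj U * U = 1\<^sub>m d"
    using assms(1) by (auto simp: is_unitary_def mat_adjoint_eq_adj)
  have "complex_of_real (hs (U * B)) = ip (U * B) (U * B)" by (simp add: ip_self)
  also have "\<dots> = ip (adj U * (U * B)) B" using U assms(2) by (intro ip_mult_left[of _ d d _ k]) auto
  also have "adj U * (U * B) = adj U * U * B"
    using U assms(2) by (intro assoc_mult_mat[symmetric, of _ d d _ d _ k]) auto
  also have "\<dots> = B" using U assms(2) by simp
  finally show ?thesis by (simp add: ip_self)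
qed

lemma contraction_unitary: "is_unitary d U \<Longrightarrow> contraction U"
  unfolding contraction_def using unitary_hs[of d U] by (auto simp: is_unitary_def)

lemma is_unitary_transpose:
  assumes "is_unitary d U"
  shows "is_unitary d (transpose_mat U)"
proof -
  have U: "U \<in> carrier_mat d d" "U * adj U = 1\<^sub>m d" "adj U * U = 1\<^sub>m d"
    using assms by (auto simp: is_unitary_def mat_adjoint_eq_adj)
  have eq: "adj (transpose_mat U) = transpose_mat (adj U)"
    by (rule eq_matI) (auto simp: adj_def)
  have "transpose_mat (adj U * U) = transpose_mat U * transpose_mat (adj U)"
    using U(1) by (intro transpose_mult[of _ d d]) auto
  then have 1: "transpose_mat U * transpose_mat (adj U) = 1\<^sub>m d"
    unfolding U(3) transpose_one by simp
  have "transpose_mat (U * adj U) = transpose_mat (adj U) * transpose_mat U"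
    using U(1) by (intro transpose_mult[of _ d d]) auto
  then have 2: "transpose_mat (adj U) * transpose_mat U = 1\<^sub>m d"
    unfolding U(2) transpose_one by simp
  show ?thesis using U(1) 1 2 by (simp add: is_unitary_def mat_adjoint_eq_adj eq)
qed

section \<open>Projections for measuring and for splitting off a qubit\<close>

definition diag_proj :: "nat \<Rightarrow> (nat \<Rightarrow> bool) \<Rightarrow> complex mat" where
  "diag_proj n P = Matrix.mat n n (\<lambda>(i, j). if i = j \<and> P i then 1 else 0)"

lemma dim_diag_proj [simp]: "dim_row (diag_proj n P) = n" "dim_col (diag_proj n P) = n"
  by (simp_all add: diag_proj_def)

lemma diag_proj_carrier [simp]: "diag_proj n P \<in> carrier_mat n n"
  by (simp add: diag_proj_def)

lemma diag_proj_mult: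
  assumes "A \<in> carrier_mat n m" "i < n" "j < m"
  shows "(diag_proj n P * A) $$ (i, j) = (if P i then A $$ (i, j) else 0)"
proof -
  have "(diag_proj n P * A) $$ (i, j) = (\<Sum>l<n. diag_proj n P $$ (i, l) * A $$ (l, j))"
    using assms by (intro index_mult_mat_sum) auto
  also have "\<dots> = (\<Sum>l<n. if l = i then if P i then A $$ (i, j) else 0 else 0)"
    by (rule sum.cong) (use assms in \<open>auto simp: diag_proj_def\<close>)
  finally have "(diag_proj n P * A) $$ (i, j) = \<dots>" .
  then show ?thesis using assms by simp
qed

lemma mult_diag_proj:
  assumes "A \<in> carrier_mat m n" "i < m" "j < n"
  shows "(A * diag_proj n P) $$ (i, j) = (if P j then A $$ (i, j) else 0)"
proof -
  have "(A * diag_proj n P) $$ (i, j) = (\<Sum>l<n. A $$ (i, l) * diag_proj n P $$ (l, j))"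
    using assms by (intro index_mult_mat_sum) auto
  also have "\<dots> = (\<Sum>l<n. if l = j then if P j then A $$ (i, j) else 0 else 0)"
    by (rule sum.cong) (use assms in \<open>auto simp: diag_proj_def\<close>)
  finally have "(A * diag_proj n P) $$ (i, j) = \<dots>" .
  then show ?thesis using assms by simp
qed

lemma contraction_diag_proj: "contraction (diag_proj n P)"
  unfolding contraction_def
proof (intro allI ballI)
  fix k and B :: "complex mat" assume "B \<in> carrier_mat (dim_col (diag_proj n P)) k"
  then have B: "B \<in> carrier_mat n k" by (simp add: diag_proj_def)
  show "hs (diag_proj n P * B) \<le> hs B"
    using B unfolding hs_def
    by (auto simp: diag_proj_mult[OF B] simp del: index_mult_mat(1) intro!: sum_mono)
qed

text \<open>The bra of the value \<open>q\<close> of the first qubit, tensored with the identity.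
  From the left it keeps the part of a register in which that qubit is \<open>q\<close>; from the
  right it places a new qubit of value \<open>q\<close> in front of a register.\<close>

definition half_proj :: "nat \<Rightarrow> nat \<Rightarrow> complex mat" where
  "half_proj m q = Matrix.mat m (2 * m) (\<lambda>(i, l). if l = q * m + i then 1 else 0)"

lemma dim_half_proj [simp]: "dim_row (half_proj m q) = m" "dim_col (half_proj m q) = 2 * m"
  by (simp_all add: half_proj_def)

lemma half_proj_carrier [simp]: "half_proj m q \<in> carrier_mat m (2 * m)"
  by (simp add: half_proj_def)

lemma half_index_less: "q < 2 \<Longrightarrow> i < m \<Longrightarrow> q * m + i < 2 * (m :: nat)"
  by (cases q) auto

lemma half_proj_mult:
  assumes "A \<in> carrier_mat (2 * m) k" "i < m" "j < k" "q < 2"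
  shows "(half_proj m q * A) $$ (i, j) = A $$ (q * m + i, j)"
proof -
  have "(half_proj m q * A) $$ (i, j) = (\<Sum>l<2 * m. half_proj m q $$ (i, l) * A $$ (l, j))"
    using assms by (intro index_mult_mat_sum) auto
  also have "\<dots> = (\<Sum>l<2 * m. if l = q * m + i then A $$ (q * m + i, j) else 0)"
    by (rule sum.cong) (use assms in \<open>auto simp: half_proj_def\<close>)
  finally have "(half_proj m q * A) $$ (i, j) = \<dots>" .
  then show ?thesis using assms half_index_less by simp
qed

lemma mult_half_proj:
  assumes "A \<in> carrier_mat k b" "i < k" "j < 2 * b" "q < 2"
  shows "(A * half_proj b q) $$ (i, j) = (if j div b = q then A $$ (i, j mod b) else 0)"
proof -
  have "(A * half_proj b q) $$ (i, j) = (\<Sum>l<b. A $$ (i, l) * half_proj b q $$ (l, j))"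
    using assms by (intro index_mult_mat_sum) auto
  also have "\<dots> = (\<Sum>l<b. if l = j mod b then if j div b = q then A $$ (i, j mod b) else 0 else 0)"
  proof (rule sum.cong[OF refl])
    fix l assume "l \<in> {..<b}"
    then have "j = q * b + l \<longleftrightarrow> l = j mod b \<and> j div b = q" by auto
    then show "A $$ (i, l) * half_proj b q $$ (l, j)
        = (if l = j mod b then if j div b = q then A $$ (i, j mod b) else 0 else 0)"
      using assms \<open>l \<in> {..<b}\<close> by (auto simp: half_proj_def)
  qed
  finally have "(A * half_proj b q) $$ (i, j) = \<dots>" .
  then show ?thesis using assms by (cases "b = 0") auto
qed

lemma contraction_half_proj:
  assumes "q < 2"
  shows "contraction (half_proj m q)"
  unfolding contraction_def
proof (intro allI ballI)
  fix k and B :: "complex mat" assume "B \<in> carrier_mat (dim_col (half_proj m q)) k"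
  then have B: "B \<in> carrier_mat (2 * m) k" by (simp add: half_proj_def)
  have "hs (half_proj m q * B) = (\<Sum>i<m. \<Sum>j<k. (cmod (B $$ (q * m + i, j)))\<^sup>2)"
    using B assms unfolding hs_def
    by (auto simp: half_proj_mult[OF B] simp del: index_mult_mat(1) intro!: sum.cong)
  also have "\<dots> = (\<Sum>i\<in>(\<lambda>i. q * m + i) ` {..<m}. \<Sum>j<k. (cmod (B $$ (i, j)))\<^sup>2)"
    by (simp add: sum.reindex)
  also have "\<dots> \<le> (\<Sum>i<2 * m. \<Sum>j<k. (cmod (B $$ (i, j)))\<^sup>2)"
    using half_index_less[OF assms] by (intro sum_mono2) (auto intro: sum_nonneg)
  finally show "hs (half_proj m q * B) \<le> hs B" using B by (simp add: hs_def)
qed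

lemma adj_half_proj: "adj (half_proj m q) = transpose_mat (half_proj m q)"
  by (rule eq_matI) (auto simp: adj_def half_proj_def)

section \<open>Quantum protocols as sums of contractions\<close>

lemma mult_sum_entries:
  fixes L R \<Phi> :: "complex mat"
  assumes L: "L \<in> carrier_mat a'' a'" and R: "R \<in> carrier_mat b' b''" and \<Phi>: "\<Phi> \<in> carrier_mat a' b'"
    and T: "\<And>r. r < n \<Longrightarrow> T r \<in> carrier_mat a' b'"
    and sum: "\<And>i j. i < a' \<Longrightarrow> j < b' \<Longrightarrow> \<Phi> $$ (i, j) = (\<Sum>r<n. T r $$ (i, j))"
    and ij: "i < a''" "j < b''"
  shows "(L * \<Phi> * R) $$ (i, j) = (\<Sum>r<n. (L * T r * R) $$ (i, j))"
proof -
  have expand: "(L * M * R) $$ (i, j) = (\<Sum>k<b'. \<Sum>l<a'. L $$ (i, l) * M $$ (l, k) * R $$ (k, j))"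
    if M: "M \<in> carrier_mat a' b'" for M
  proof -
    have "(L * M * R) $$ (i, j) = (\<Sum>k<b'. (L * M) $$ (i, k) * R $$ (k, j))"
      using L M R ij by (intro index_mult_mat_sum[of _ a'' _ _ b'']) auto
    also have "\<dots> = (\<Sum>k<b'. \<Sum>l<a'. L $$ (i, l) * M $$ (l, k) * R $$ (k, j))"
      using ij by (intro sum.cong refl) (simp add: index_mult_mat_sum[OF L M] sum_distrib_right del: index_mult_mat)
    finally show ?thesis .
  qed
  have "(L * \<Phi> * R) $$ (i, j) = (\<Sum>k<b'. \<Sum>l<a'. \<Sum>r<n. L $$ (i, l) * T r $$ (l, k) * R $$ (k, j))"
    unfolding expand[OF \<Phi>]
    by (intro sum.cong refl) (simp add: sum sum_distrib_left sum_distrib_right)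
  also have "\<dots> = (\<Sum>k<b'. \<Sum>r<n. \<Sum>l<a'. L $$ (i, l) * T r $$ (l, k) * R $$ (k, j))"
    by (intro sum.cong refl sum.swap)
  also have "\<dots> = (\<Sum>r<n. \<Sum>k<b'. \<Sum>l<a'. L $$ (i, l) * T r $$ (l, k) * R $$ (k, j))"
    by (rule sum.swap)
  also have "\<dots> = (\<Sum>r<n. (L * T r * R) $$ (i, j))"
    by (intro sum.cong refl expand[symmetric] T) simp
  finally show ?thesis .
qed

lemma sum_div_mod:
  fixes f :: "nat \<Rightarrow> nat \<Rightarrow> 'a :: comm_monoid_add"
  shows "(\<Sum>p<n * k. f (p div k) (p mod k)) = (\<Sum>r<n. \<Sum>q<k. f r q)"
proof -
  have "(\<Sum>p<n * k. f (p div k) (p mod k)) = (\<Sum>(r, q)\<in>{..<n} \<times> {..<k}. f r q)"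
  proof (rule sum.reindex_bij_witness[where i = "\<lambda>(r, q). r * k + q" and j = "\<lambda>p. (p div k, p mod k)"])
    fix p assume p: "p \<in> {..<n * k}"
    then have "k > 0" by (cases k) auto
    with p show "(p div k, p mod k) \<in> {..<n} \<times> {..<k}" by (auto simp: less_mult_imp_div_less)
  next
    fix c assume "c \<in> {..<n} \<times> {..<k}"
    then obtain r q where c: "c = (r, q)" "r < n" "q < k" by auto
    have "r * k + q < Suc r * k" using c by simp
    also have "\<dots> \<le> n * k" using c by (intro mult_le_mono1) simp
    finally show "(case c of (r, q) \<Rightarrow> r * k + q) \<in> {..<n * k}" using c by simp
  qed auto
  then show ?thesis by (simp add: sum.cartesian_product)
qed

text \<open>In contrast to a decomposition without prior entanglement, the two parties' operators act on
  a fixed initial state, so they have to be kept as contractions instead of vectors.\<close>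

definition decomposes ::
  "'x set \<Rightarrow> 'y set \<Rightarrow> complex mat \<Rightarrow> nat \<Rightarrow> nat \<Rightarrow> nat \<Rightarrow> ('x \<Rightarrow> 'y \<Rightarrow> complex mat) \<Rightarrow> bool" where
  "decomposes X Y \<psi> n a b \<Phi> \<longleftrightarrow> (\<exists>A B.
     (\<forall>x\<in>X. \<forall>r<n. A r x \<in> carrier_mat a (dim_row \<psi>) \<and> contraction (A r x)) \<and>
     (\<forall>y\<in>Y. \<forall>r<n. B r y \<in> carrier_mat (dim_col \<psi>) b \<and> contraction (B r y)) \<and>
     (\<forall>x\<in>X. \<forall>y\<in>Y. \<Phi> x y \<in> carrier_mat a b \<and>
        (\<forall>i<a. \<forall>j<b. \<Phi> x y $$ (i, j) = (\<Sum>r<n. (A r x * \<psi> * B r y) $$ (i, j)))))"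

text \<open>A step that is a sum of \<open>k\<close> products of local operators multiplies the
  number of terms by \<open>k\<close>. Unitaries have \<open>k = 1\<close>; sending a qubit has
  \<open>k = 2\<close>, one term for each value of the qubit.\<close>

lemma decomposes_step:
  assumes dec: "decomposes X Y \<psi> n a b \<Phi>"
    and L: "\<And>q x. q < k \<Longrightarrow> x \<in> X \<Longrightarrow> L q x \<in> carrier_mat a' a \<and> contraction (L q x)"
    and R: "\<And>q y. q < k \<Longrightarrow> y \<in> Y \<Longrightarrow> R q y \<in> carrier_mat b b' \<and> contraction (R q y)"
    and \<Phi>': "\<And>x y. x \<in> X \<Longrightarrow> y \<in> Y \<Longrightarrow> \<Phi> x y \<in> carrier_mat a b \<Longrightarrow> \<Phi>' x y \<in> carrier_mat a' b' \<and>
      (\<forall>i<a'. \<forall>j<b'. \<Phi>' x y $$ (i, j) = (\<Sum>q<k. (L q x * \<Phi> x y * R q y) $$ (i, j)))"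
  shows "decomposes X Y \<psi> (n * k) a' b' \<Phi>'"
proof -
  let ?d = "dim_row \<psi>" and ?e = "dim_col \<psi>"
  obtain A B where A: "\<And>x r. x \<in> X \<Longrightarrow> r < n \<Longrightarrow> A r x \<in> carrier_mat a ?d \<and> contraction (A r x)"
    and B: "\<And>y r. y \<in> Y \<Longrightarrow> r < n \<Longrightarrow> B r y \<in> carrier_mat ?e b \<and> contraction (B r y)"
    and \<Phi>: "\<And>x y. x \<in> X \<Longrightarrow> y \<in> Y \<Longrightarrow> \<Phi> x y \<in> carrier_mat a b"
    and sum: "\<And>x y i j. x \<in> X \<Longrightarrow> y \<in> Y \<Longrightarrow> i < a \<Longrightarrow> j < b \<Longrightarrow>
      \<Phi> x y $$ (i, j) = (\<Sum>r<n. (A r x * \<psi> * B r y) $$ (i, j))"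
    using dec unfolding decomposes_def by blast
  have idx: "p div k < n \<and> p mod k < k" if "p < n * k" for p
    using that by (cases "k = 0") (auto simp: less_mult_imp_div_less)
  show ?thesis
    unfolding decomposes_def
  proof (rule exI[of _ "\<lambda>p x. L (p mod k) x * A (p div k) x"],
      rule exI[of _ "\<lambda>p y. B (p div k) y * R (p mod k) y"], intro conjI ballI allI impI)
    fix x p assume x: "x \<in> X" and p: "p < n * k"
    note l = L[of "p mod k" x] A[OF x, of "p div k"] idx[OF p]
    show "L (p mod k) x * A (p div k) x \<in> carrier_mat a' ?d" using l x by (intro mult_carrier_mat) auto
    show "contraction (L (p mod k) x * A (p div k) x)" using l x by (intro contraction_mult[of _ _ a' a ?d]) auto
  next
    fix y p assume y: "y \<in> Y" and p: "p < n * k"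
    note r = R[of "p mod k" y] B[OF y, of "p div k"] idx[OF p]
    show "B (p div k) y * R (p mod k) y \<in> carrier_mat ?e b'" using r y by (intro mult_carrier_mat) auto
    show "contraction (B (p div k) y * R (p mod k) y)" using r y by (intro contraction_mult[of _ _ ?e b b']) auto
  next
    fix x y assume x: "x \<in> X" and y: "y \<in> Y"
    show "\<Phi>' x y \<in> carrier_mat a' b'" using \<Phi>'[OF x y \<Phi>[OF x y]] by simp
    fix i j assume i: "i < a'" and j: "j < b'"
    have T: "A r x * \<psi> * B r y \<in> carrier_mat a b" if "r < n" for r
      using A[OF x that] B[OF y that] by (intro mult_carrier_mat[of _ a ?e] mult_carrier_mat[of _ a ?d]) auto
    have assoc: "L q x * (A r x * \<psi> * B r y) * R q y = (L q x * A r x) * \<psi> * (B r y * R q y)"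
      if q: "q < k" and r: "r < n" for q r
    proof -
      have Lc: "L q x \<in> carrier_mat a' a" and Rc: "R q y \<in> carrier_mat b b'"
        and Ac: "A r x \<in> carrier_mat a ?d" and Bc: "B r y \<in> carrier_mat ?e b"
        using L[OF q x] R[OF q y] A[OF x r] B[OF y r] by auto
      have pc: "\<psi> \<in> carrier_mat ?d ?e" by simp
      have LA: "L q x * A r x \<in> carrier_mat a' ?d" using Lc Ac by simp
      have "L q x * (A r x * \<psi> * B r y) = (L q x * A r x) * \<psi> * B r y"
        using assoc_mult_mat[OF Lc mult_carrier_mat[OF Ac pc] Bc] assoc_mult_mat[OF Lc Ac pc] by simp
      then show ?thesis
        using assoc_mult_mat[OF mult_carrier_mat[OF LA pc] Bc Rc] by simp
    qed
    have "\<Phi>' x y $$ (i, j) = (\<Sum>q<k. (L q x * \<Phi> x y * R q y) $$ (i, j))"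
      using \<Phi>'[OF x y \<Phi>[OF x y]] i j by simp
    also have "\<dots> = (\<Sum>q<k. \<Sum>r<n. (L q x * (A r x * \<psi> * B r y) * R q y) $$ (i, j))"
    proof (rule sum.cong[OF refl])
      fix q assume "q \<in> {..<k}"
      then have q: "q < k" by simp
      show "(L q x * \<Phi> x y * R q y) $$ (i, j) = (\<Sum>r<n. (L q x * (A r x * \<psi> * B r y) * R q y) $$ (i, j))"
        by (rule mult_sum_entries[of _ a' a _ b b'])
          (use L[OF q x] R[OF q y] \<Phi>[OF x y] T sum[OF x y] i j in auto)
    qed
    also have "\<dots> = (\<Sum>r<n. \<Sum>q<k. (L q x * (A r x * \<psi> * B r y) * R q y) $$ (i, j))"
      by (rule sum.swap)
    also have "\<dots> = (\<Sum>r<n. \<Sum>q<k. ((L q x * A r x) * \<psi> * (B r y * R q y)) $$ (i, j))"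
      by (intro sum.cong refl) (simp only: assoc lessThan_iff)
    also have "\<dots> = (\<Sum>p<n * k. ((L (p mod k) x * A (p div k) x) * \<psi> * (B (p div k) y * R (p mod k) y)) $$ (i, j))"
      by (rule sum_div_mod[symmetric])
    finally show "\<Phi>' x y $$ (i, j)
      = (\<Sum>p<n * k. ((L (p mod k) x * A (p div k) x) * \<psi> * (B (p div k) y * R (p mod k) y)) $$ (i, j))" .
  qed
qed

lemma contraction_one: "contraction (1\<^sub>m n)"
  by (auto simp: contraction_def)

lemma send_qubit_carrier: "\<psi> \<in> carrier_mat (2 * m) b \<Longrightarrow> send_qubit \<psi> \<in> carrier_mat m (2 * b)"
  by (auto simp: send_qubit_def Let_def)

text \<open>A resolution of the identity on the transmitted qubit: for each value \<open>q\<close>,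
  Alice keeps the corresponding half of her register and Bob's register is extended by a qubit in
  state \<open>q\<close>.\<close>

lemma send_qubit_entries:
  assumes \<psi>: "\<psi> \<in> carrier_mat (2 * m) b" and i: "i < m" and j: "j < 2 * b"
  shows "send_qubit \<psi> $$ (i, j) = (\<Sum>q<2. (half_proj m q * \<psi> * half_proj b q) $$ (i, j))"
proof -
  have b: "j mod b < b" "j div b < 2" using j by (auto simp: less_mult_imp_div_less intro: gr0I)
  have "(half_proj m q * \<psi> * half_proj b q) $$ (i, j)
      = (if j div b = q then \<psi> $$ (q * m + i, j mod b) else 0)" if "q < 2" for q
  proof -
    have c: "half_proj m q * \<psi> \<in> carrier_mat m b" using \<psi> by (intro mult_carrier_mat) auto
    show ?thesis
      using mult_half_proj[OF c i j that] half_proj_mult[OF \<psi> i b(1) that] by (simp del: index_mult_mat)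
  qed
  then have "(\<Sum>q<2. (half_proj m q * \<psi> * half_proj b q) $$ (i, j))
      = (\<Sum>q<2. if j div b = q then \<psi> $$ (q * m + i, j mod b) else 0)"
    by (intro sum.cong) auto
  also have "\<dots> = \<psi> $$ ((j div b) * m + i, j mod b)" using b by simp
  finally show ?thesis using \<psi> i j by (simp add: send_qubit_def Let_def)
qed

definition qubits :: "('x, 'y) qstep list \<Rightarrow> nat" where
  "qubits ss = length (filter (\<lambda>s. s = Alice_Qubit \<or> s = Bob_Qubit) ss)"

lemma qubits_simps [simp]:
  "qubits [] = 0" "qubits (Alice_Unitary U # ss) = qubits ss" "qubits (Bob_Unitary V # ss) = qubits ss"
  "qubits (Alice_Qubit # ss) = Suc (qubits ss)" "qubits (Bob_Qubit # ss) = Suc (qubits ss)"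
  by (simp_all add: qubits_def)

lemma decomposes_steps:
  assumes "qsteps_ok X Y a b ss" "decomposes X Y \<psi> n a b \<Phi>"
  shows "\<exists>a' b'. decomposes X Y \<psi> (n * 2 ^ qubits ss) a' b' (\<lambda>x y. fold (apply_qstep x y) ss (\<Phi> x y))"
  using assms
proof (induction ss arbitrary: a b n \<Phi>)
  case Nil
  then show ?case by auto
next
  case (Cons s ss)
  show ?case
  proof (cases s)
    case (Alice_Unitary U)
    have "decomposes X Y \<psi> (n * 1) a b (\<lambda>x y. U x * \<Phi> x y)"
      by (rule decomposes_step[OF Cons.prems(2), where L = "\<lambda>q x. U x" and R = "\<lambda>q y. 1\<^sub>m b"])
        (use Cons.prems(1) Alice_Unitary contraction_unitary contraction_one in
          \<open>auto simp: is_unitary_def simp del: index_mult_mat(1)\<close>)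
    from Cons.IH[OF _ this] Cons.prems(1) Alice_Unitary show ?thesis by simp
  next
    case (Bob_Unitary V)
    have "decomposes X Y \<psi> (n * 1) a b (\<lambda>x y. \<Phi> x y * transpose_mat (V y))"
    proof (rule decomposes_step[OF Cons.prems(2), where L = "\<lambda>q x. 1\<^sub>m a" and R = "\<lambda>q y. transpose_mat (V y)"])
      show "transpose_mat (V y) \<in> carrier_mat b b \<and> contraction (transpose_mat (V y))" if "y \<in> Y" for y
        using Cons.prems(1) Bob_Unitary that is_unitary_transpose[of b "V y"] contraction_unitary[of b "transpose_mat (V y)"]
        by (auto simp: is_unitary_def)
      then show "\<Phi> x y * transpose_mat (V y) \<in> carrier_mat a b \<and> (\<forall>i<a. \<forall>j<b. (\<Phi> x y * transpose_mat (V y)) $$ (i, j)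
          = (\<Sum>q<1::nat. (1\<^sub>m a * \<Phi> x y * transpose_mat (V y)) $$ (i, j)))"
        if "x \<in> X" "y \<in> Y" "\<Phi> x y \<in> carrier_mat a b" for x y
        using that by (auto simp del: index_mult_mat(1))
    qed (auto simp: contraction_one)
    from Cons.IH[OF _ this] Cons.prems(1) Bob_Unitary show ?thesis by simp
  next
    case Alice_Qubit
    define m where "m = a div 2"
    have a: "a = 2 * m" using Cons.prems(1) Alice_Qubit by (simp add: m_def)
    have "decomposes X Y \<psi> (n * 2) m (2 * b) (\<lambda>x y. send_qubit (\<Phi> x y))"
      by (rule decomposes_step[OF Cons.prems(2), where L = "\<lambda>q x. half_proj m q" and R = "\<lambda>q y. half_proj b q"])
        (auto simp: a contraction_half_proj send_qubit_carrier send_qubit_entries simp del: index_mult_mat(1))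
    from Cons.IH[OF _ this] Cons.prems(1) Alice_Qubit a show ?thesis by (simp add: mult.assoc)
  next
    \<comment> \<open>Bob's transmission is Alice's, conjugated by transposition; the two half
      projections are transposed and change sides.\<close>
    case Bob_Qubit
    define m where "m = b div 2"
    have b: "b = 2 * m" using Cons.prems(1) Bob_Qubit by (simp add: m_def)
    have "decomposes X Y \<psi> (n * 2) (2 * a) m (\<lambda>x y. transpose_mat (send_qubit (transpose_mat (\<Phi> x y))))"
    proof (rule decomposes_step[OF Cons.prems(2), where L = "\<lambda>q x. transpose_mat (half_proj a q)"
          and R = "\<lambda>q y. transpose_mat (half_proj m q)"])
      show "transpose_mat (half_proj a q) \<in> carrier_mat (2 * a) a \<and> contraction (transpose_mat (half_proj a q))"
        if "q < 2" for q
        using contraction_adj[OF contraction_half_proj[OF that] half_proj_carrier] by (simp add: adj_half_proj)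
      show "transpose_mat (half_proj m q) \<in> carrier_mat b m \<and> contraction (transpose_mat (half_proj m q))"
        if "q < 2" for q
        using contraction_adj[OF contraction_half_proj[OF that] half_proj_carrier] by (simp add: adj_half_proj b)
      fix x y assume "\<Phi> x y \<in> carrier_mat a b"
      then have t: "transpose_mat (\<Phi> x y) \<in> carrier_mat (2 * m) a" by (simp add: b)
      have s: "send_qubit (transpose_mat (\<Phi> x y)) \<in> carrier_mat m (2 * a)" by (rule send_qubit_carrier[OF t])
      have "transpose_mat (send_qubit (transpose_mat (\<Phi> x y))) $$ (i, j)
         = (\<Sum>q<2. (transpose_mat (half_proj a q) * \<Phi> x y * transpose_mat (half_proj m q)) $$ (i, j))"
        if ij: "i < 2 * a" "j < m" for i j
      proof -
        have "transpose_mat (half_proj a q) * \<Phi> x y * transpose_mat (half_proj m q)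
          = transpose_mat (half_proj m q * transpose_mat (\<Phi> x y) * half_proj a q)" for q
        proof -
          have h: "half_proj m q \<in> carrier_mat m (2 * m)" "half_proj a q \<in> carrier_mat a (2 * a)" by simp_all
          have "transpose_mat (half_proj m q * transpose_mat (\<Phi> x y) * half_proj a q)
            = transpose_mat (half_proj a q) * (transpose_mat (transpose_mat (\<Phi> x y)) * transpose_mat (half_proj m q))"
            using transpose_mult[OF mult_carrier_mat[OF h(1) t] h(2)] transpose_mult[OF h(1) t] by simp
          also have "\<dots> = transpose_mat (half_proj a q) * \<Phi> x y * transpose_mat (half_proj m q)"
            using \<open>\<Phi> x y \<in> carrier_mat a b\<close> b by (subst assoc_mult_mat[of _ "2 * a" a _ b _ m]) auto
          finally show ?thesis ..
        qed
        moreover have "half_proj m q * transpose_mat (\<Phi> x y) * half_proj a q \<in> carrier_mat m (2 * a)" for q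
          using t by (intro mult_carrier_mat[of _ m a] mult_carrier_mat[of _ m "2 * m"]) auto
        ultimately have "(transpose_mat (half_proj a q) * \<Phi> x y * transpose_mat (half_proj m q)) $$ (i, j)
          = (half_proj m q * transpose_mat (\<Phi> x y) * half_proj a q) $$ (j, i)" for q
          using ij by (metis carrier_matD index_transpose_mat(1))
        then show ?thesis using send_qubit_entries[OF t ij(2,1)] s ij by (simp del: index_mult_mat(1))
      qed
      then show "transpose_mat (send_qubit (transpose_mat (\<Phi> x y))) \<in> carrier_mat (2 * a) m \<and>
        (\<forall>i<2 * a. \<forall>j<m. transpose_mat (send_qubit (transpose_mat (\<Phi> x y))) $$ (i, j)
         = (\<Sum>q<2. (transpose_mat (half_proj a q) * \<Phi> x y * transpose_mat (half_proj m q)) $$ (i, j)))"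
        using s by simp
    qed
    from Cons.IH[OF _ this] Cons.prems(1) Bob_Qubit b show ?thesis by (simp add: mult.assoc)
  qed
qed

lemma decomposes_init: "decomposes X Y \<psi> 1 (dim_row \<psi>) (dim_col \<psi>) (\<lambda>x y. \<psi>)"
  unfolding decomposes_def
  by (rule exI[of _ "\<lambda>r x. 1\<^sub>m (dim_row \<psi>)"], rule exI[of _ "\<lambda>r y. 1\<^sub>m (dim_col \<psi>)"])
    (auto simp: contraction_one simp del: index_mult_mat(1))

section \<open>Preservation of the norm and output probabilities\<close>

lemma hs_send_qubit:
  assumes "\<psi> \<in> carrier_mat (2 * m) b"
  shows "hs (send_qubit \<psi>) = hs \<psi>"
proof -
  have "hs (send_qubit \<psi>) = (\<Sum>(i, j)\<in>{..<m} \<times> {..<2 * b}. (cmod (\<psi> $$ ((j div b) * m + i, j mod b)))\<^sup>2)"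
    using assms by (simp add: hs_def send_qubit_def Let_def sum.cartesian_product)
  also have "\<dots> = (\<Sum>(i, j)\<in>{..<2 * m} \<times> {..<b}. (cmod (\<psi> $$ (i, j)))\<^sup>2)"
  proof (rule sum.reindex_bij_witness[where j = "\<lambda>(i, j). ((j div b) * m + i, j mod b)"
        and i = "\<lambda>(k, l). (k mod m, (k div m) * b + l)"])
    fix p assume p: "p \<in> {..<m} \<times> {..<2 * b}"
    then obtain i j where ij: "p = (i, j)" "i < m" "j < 2 * b" by auto
    then have "j div b < 2" "j mod b < b" by (auto simp: less_mult_imp_div_less intro: gr0I)
    then show "(case p of (i, j) \<Rightarrow> ((j div b) * m + i, j mod b)) \<in> {..<2 * m} \<times> {..<b}"
      using ij half_index_less by simp
    show "(case case p of (i, j) \<Rightarrow> ((j div b) * m + i, j mod b) of (k, l) \<Rightarrow> (k mod m, (k div m) * b + l)) = p"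
      using ij by simp
  next
    fix p assume p: "p \<in> {..<2 * m} \<times> {..<b}"
    then obtain k l where kl: "p = (k, l)" "k < 2 * m" "l < b" by auto
    then have "k div m < 2" "k mod m < m" by (auto simp: less_mult_imp_div_less intro: gr0I)
    then show "(case p of (k, l) \<Rightarrow> (k mod m, (k div m) * b + l)) \<in> {..<m} \<times> {..<2 * b}"
      using kl half_index_less by simp
    show "(case case p of (k, l) \<Rightarrow> (k mod m, (k div m) * b + l) of (i, j) \<Rightarrow> ((j div b) * m + i, j mod b)) = p"
      using kl by simp
  qed auto
  also have "\<dots> = hs \<psi>" using assms by (simp add: hs_def sum.cartesian_product)
  finally show ?thesis .
qed

lemma hs_transpose: "hs (transpose_mat \<psi>) = hs \<psi>"
  unfolding hs_def by (simp add: sum.swap[of _ "{..<dim_row \<psi>}"])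

lemma hs_steps:
  assumes "qsteps_ok X Y a b ss" "x \<in> X" "y \<in> Y" "\<psi> \<in> carrier_mat a b"
  shows "hs (fold (apply_qstep x y) ss \<psi>) = hs \<psi>"
  using assms
proof (induction ss arbitrary: a b \<psi>)
  case (Cons s ss)
  show ?case
  proof (cases s)
    case (Alice_Unitary U)
    then have U: "is_unitary a (U x)" using Cons.prems by auto
    have "U x * \<psi> \<in> carrier_mat a b" using U Cons.prems by (intro mult_carrier_mat) (auto simp: is_unitary_def)
    from Cons.IH[OF _ Cons.prems(2,3) this] show ?thesis
      using Alice_Unitary Cons.prems(1) unitary_hs[OF U Cons.prems(4)] by simp
  next
    case (Bob_Unitary V)
    then have V: "is_unitary b (V y)" using Cons.prems by auto
    have c: "V y \<in> carrier_mat b b" using V by (simp add: is_unitary_def)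
    have "hs (\<psi> * transpose_mat (V y)) = hs (transpose_mat (\<psi> * transpose_mat (V y)))"
      by (simp add: hs_transpose)
    also have "transpose_mat (\<psi> * transpose_mat (V y)) = V y * transpose_mat \<psi>"
      using transpose_mult[of \<psi> a b "transpose_mat (V y)" b] c Cons.prems(4) by simp
    also have "hs (V y * transpose_mat \<psi>) = hs \<psi>"
      using unitary_hs[OF V, of "transpose_mat \<psi>" a] Cons.prems(4) by (simp add: hs_transpose)
    finally have eq: "hs (\<psi> * transpose_mat (V y)) = hs \<psi>" .
    have "\<psi> * transpose_mat (V y) \<in> carrier_mat a b" using c Cons.prems(4) by (intro mult_carrier_mat) auto
    from Cons.IH[OF _ Cons.prems(2,3) this] show ?thesis
      using Bob_Unitary Cons.prems(1) eq by simp
  next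
    case Alice_Qubit
    define m where "m = a div 2"
    have a: "a = 2 * m" using Cons.prems(1) Alice_Qubit by (simp add: m_def)
    have "\<psi> \<in> carrier_mat (2 * m) b" using Cons.prems(4) a by simp
    from Cons.IH[OF _ Cons.prems(2,3) send_qubit_carrier[OF this]] hs_send_qubit[OF this]
    show ?thesis using Alice_Qubit Cons.prems(1) a by simp
  next
    case Bob_Qubit
    define m where "m = b div 2"
    have b: "b = 2 * m" using Cons.prems(1) Bob_Qubit by (simp add: m_def)
    have t: "transpose_mat \<psi> \<in> carrier_mat (2 * m) a" using Cons.prems(4) b by simp
    have "transpose_mat (send_qubit (transpose_mat \<psi>)) \<in> carrier_mat (2 * a) m"
      using send_qubit_carrier[OF t] by simp
    from Cons.IH[OF _ Cons.prems(2,3) this] hs_send_qubit[OF t]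
    show ?thesis using Bob_Qubit Cons.prems(1) b by (simp add: hs_transpose)
  qed
qed simp

lemma output_prob_bounds:
  assumes "qprotocol_ok X Y Q" "x \<in> X" "y \<in> Y"
  shows "0 \<le> output_prob Q x y v" "output_prob Q x y True + output_prob Q x y False = 1"
proof -
  show "0 \<le> output_prob Q x y v"
    unfolding output_prob_def Let_def by (intro sum_nonneg) auto
  have "hs (final_state Q x y) = (\<Sum>i<dim_row (final_state Q x y). \<Sum>j<dim_col (final_state Q x y).
      (if decide Q (if alice_measures Q then i else j) = True then (cmod (final_state Q x y $$ (i, j)))\<^sup>2 else 0) +
      (if decide Q (if alice_measures Q then i else j) = False then (cmod (final_state Q x y $$ (i, j)))\<^sup>2 else 0))"
    unfolding hs_def by (intro sum.cong refl) auto
  then have "output_prob Q x y True + output_prob Q x y False = hs (final_state Q x y)"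
    by (simp only: output_prob_def Let_def sum.distrib)
  also have "\<dots> = hs (init_state Q)"
    unfolding final_state_def using assms by (intro hs_steps) (auto simp: qprotocol_ok_def)
  finally show "output_prob Q x y True + output_prob Q x y False = 1"
    using assms(1) by (simp add: qprotocol_ok_def hs_def)
qed

text \<open>The probability is a quadratic form in the final state, so the decomposition enters
  twice and gives \<open>n * n = 4 ^ qcost Q\<close> terms. In each of them Bob's operators are
  moved to the left argument of the inner product and Alice's to the right one, which leaves
  \<open>ip (\<psi> * G) (E * \<psi>)\<close> with contractions \<open>E\<close> and
  \<open>G\<close>. The entries of these two matrices are the vectors; each term adds at most
  \<open>hs \<psi> = 1\<close> to their squared lengths, independently of all dimensions.\<close>

lemma output_prob_factorization:
  assumes ok: "qprotocol_ok X Y Q"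
  obtains R :: "((nat \<times> nat) \<times> nat \<times> nat) set" and u v where "finite R"
    "\<And>x. x \<in> X \<Longrightarrow> (\<Sum>r\<in>R. (cmod (u r x))\<^sup>2) \<le> 4 ^ qcost Q"
    "\<And>y. y \<in> Y \<Longrightarrow> (\<Sum>r\<in>R. (cmod (v r y))\<^sup>2) \<le> 4 ^ qcost Q"
    "\<And>x y. x \<in> X \<Longrightarrow> y \<in> Y \<Longrightarrow> of_real (output_prob Q x y val) = (\<Sum>r\<in>R. u r x * v r y)"
proof -
  let ?\<psi> = "init_state Q"
  define a b where "a = dim_row ?\<psi>" and "b = dim_col ?\<psi>"
  have \<psi>: "?\<psi> \<in> carrier_mat a b" by (simp add: a_def b_def)
  have hs\<psi>: "hs ?\<psi> = 1" using ok by (simp add: qprotocol_ok_def hs_def)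
  define n where "n = (2 :: nat) ^ qcost Q"
  have "qsteps_ok X Y a b (steps Q)" using ok by (simp add: qprotocol_ok_def a_def b_def)
  from decomposes_steps[OF this decomposes_init[of X Y ?\<psi>, folded a_def b_def]]
  obtain a' b' where "decomposes X Y ?\<psi> n a' b' (final_state Q)"
    unfolding n_def qcost_def qubits_def final_state_def by auto
  then obtain A B where A: "\<And>x r. x \<in> X \<Longrightarrow> r < n \<Longrightarrow> A r x \<in> carrier_mat a' a \<and> contraction (A r x)"
    and B: "\<And>y r. y \<in> Y \<Longrightarrow> r < n \<Longrightarrow> B r y \<in> carrier_mat b b' \<and> contraction (B r y)"
    and \<Phi>: "\<And>x y. x \<in> X \<Longrightarrow> y \<in> Y \<Longrightarrow> final_state Q x y \<in> carrier_mat a' b'"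
    and sum: "\<And>x y i j. x \<in> X \<Longrightarrow> y \<in> Y \<Longrightarrow> i < a' \<Longrightarrow> j < b' \<Longrightarrow>
      final_state Q x y $$ (i, j) = (\<Sum>r<n. (A r x * ?\<psi> * B r y) $$ (i, j))"
    unfolding decomposes_def a_def[symmetric] b_def[symmetric] by blast
  \<comment> \<open>Only the measuring player's predicate restricts anything; the other one is
    constantly true.\<close>
  define P1 P2 where "P1 = (\<lambda>i. alice_measures Q \<longrightarrow> decide Q i = val)"
    and "P2 = (\<lambda>j. \<not> alice_measures Q \<longrightarrow> decide Q j = val)"
  define E where "E = (\<lambda>r s x. adj (A s x) * (diag_proj a' P1 * A r x))"
  define G where "G = (\<lambda>r s y. B s y * adj (B r y * diag_proj b' P2))"
  define R where "R = ({..<n} \<times> {..<n}) \<times> ({..<a} \<times> {..<b})"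
  define u where "u = (\<lambda>((r, s), p) x. (E r s x * ?\<psi>) $$ p)"
  define v where "v = (\<lambda>((r, s), p) y. cnj ((?\<psi> * G r s y) $$ p))"
  have E: "E r s x \<in> carrier_mat a a" "contraction (E r s x)" if "x \<in> X" "r < n" "s < n" for x r s
  proof -
    have c: "A r x \<in> carrier_mat a' a" "A s x \<in> carrier_mat a' a" "contraction (A r x)" "contraction (A s x)"
      using A[OF that(1,2)] A[OF that(1,3)] by simp_all
    note d = mult_carrier_mat[OF diag_proj_carrier c(1), of P1]
    show "E r s x \<in> carrier_mat a a" unfolding E_def by (rule mult_carrier_mat[OF adj_carrier[OF c(2)] d])
    have "contraction (diag_proj a' P1 * A r x)"
      by (rule contraction_mult[OF contraction_diag_proj c(3) diag_proj_carrier c(1)])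
    then show "contraction (E r s x)" unfolding E_def
      by (rule contraction_mult[OF contraction_adj[OF c(4,2)] _ adj_carrier[OF c(2)] d])
  qed
  have G: "G r s y \<in> carrier_mat b b" "contraction (G r s y)" if "y \<in> Y" "r < n" "s < n" for y r s
  proof -
    have c: "B r y \<in> carrier_mat b b'" "B s y \<in> carrier_mat b b'" "contraction (B r y)" "contraction (B s y)"
      using B[OF that(1,2)] B[OF that(1,3)] by simp_all
    note d = mult_carrier_mat[OF c(1) diag_proj_carrier, of P2]
    show "G r s y \<in> carrier_mat b b" unfolding G_def by (rule mult_carrier_mat[OF c(2) adj_carrier[OF d]])
    have "contraction (B r y * diag_proj b' P2)"
      by (rule contraction_mult[OF c(3) contraction_diag_proj c(1) diag_proj_carrier])
    from contraction_adj[OF this d] show "contraction (G r s y)" unfolding G_def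
      by (rule contraction_mult[OF c(4) _ c(2) adj_carrier[OF d]])
  qed
  have sumR: "(\<Sum>p\<in>R. h p) = (\<Sum>r<n. \<Sum>s<n. \<Sum>p\<in>{..<a} \<times> {..<b}. h ((r, s), p))"
    for h :: "_ \<Rightarrow> 'c :: comm_monoid_add"
    unfolding R_def by (simp only: sum.cartesian_product')
  have hs_sum: "(\<Sum>p\<in>{..<a} \<times> {..<b}. (cmod (M $$ p))\<^sup>2) = hs M" if "M \<in> carrier_mat a b" for M
    using that by (simp add: hs_def sum.cartesian_product)
  have nn: "(\<Sum>r<n. \<Sum>s<n. 1 :: real) = 4 ^ qcost Q"
    by (simp add: n_def power_mult_distrib[symmetric])
  have uK: "(\<Sum>r\<in>R. (cmod (u r x))\<^sup>2) \<le> 4 ^ qcost Q" if x: "x \<in> X" for x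
  proof -
    have "(\<Sum>r\<in>R. (cmod (u r x))\<^sup>2) = (\<Sum>r<n. \<Sum>s<n. hs (E r s x * ?\<psi>))"
      unfolding sumR u_def prod.case
    proof (intro sum.cong refl hs_sum)
      fix r s assume "r \<in> {..<n}" "s \<in> {..<n}"
      then show "E r s x * ?\<psi> \<in> carrier_mat a b" using E(1)[OF x] \<psi> by (intro mult_carrier_mat[of _ a a]) auto
    qed
    also have "\<dots> \<le> (\<Sum>r<n. \<Sum>s<n. 1)"
    proof (intro sum_mono)
      fix r s assume "r \<in> {..<n}" "s \<in> {..<n}"
      then show "hs (E r s x * ?\<psi>) \<le> 1"
        using contraction_leftD[OF E(2)[OF x] E(1)[OF x] \<psi>] hs\<psi> by simp
    qed
    finally show ?thesis unfolding nn .
  qed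
  have vK: "(\<Sum>r\<in>R. (cmod (v r y))\<^sup>2) \<le> 4 ^ qcost Q" if y: "y \<in> Y" for y
  proof -
    have "(\<Sum>r\<in>R. (cmod (v r y))\<^sup>2) = (\<Sum>r<n. \<Sum>s<n. hs (?\<psi> * G r s y))"
      unfolding sumR v_def prod.case complex_mod_cnj
    proof (intro sum.cong refl hs_sum)
      fix r s assume "r \<in> {..<n}" "s \<in> {..<n}"
      then show "?\<psi> * G r s y \<in> carrier_mat a b" using G(1)[OF y] \<psi> by (intro mult_carrier_mat[of _ a b]) auto
    qed
    also have "\<dots> \<le> (\<Sum>r<n. \<Sum>s<n. 1)"
    proof (intro sum_mono)
      fix r s assume "r \<in> {..<n}" "s \<in> {..<n}"
      then show "hs (?\<psi> * G r s y) \<le> 1"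
        using contraction_rightD[OF G(2)[OF y] G(1)[OF y] \<psi>] hs\<psi> by simp
    qed
    finally show ?thesis unfolding nn .
  qed
  have "of_real (output_prob Q x y val) = (\<Sum>r\<in>R. u r x * v r y)" if x: "x \<in> X" and y: "y \<in> Y" for x y
  proof -
    define T where "T = (\<lambda>r. A r x * ?\<psi> * B r y)"
    have T: "T r \<in> carrier_mat a' b'" if "r < n" for r
      unfolding T_def using A[OF x that] B[OF y that] \<psi>
      by (intro mult_carrier_mat[of _ a' b] mult_carrier_mat[of _ a' a]) auto
    have decP: "(decide Q (if alice_measures Q then i else j) = val) = (P1 i \<and> P2 j)" for i j
      by (simp add: P1_def P2_def)
    have "of_real (output_prob Q x y val)
      = (\<Sum>i<a'. \<Sum>j<b'. if P1 i \<and> P2 j then cnj (final_state Q x y $$ (i, j)) * final_state Q x y $$ (i, j) else 0)"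
    proof -
      have dims: "dim_row (final_state Q x y) = a'" "dim_col (final_state Q x y) = b'" using \<Phi>[OF x y] by auto
      have sq: "of_real ((cmod z)\<^sup>2) = cnj z * z" for z by (simp only: complex_norm_square mult.commute)
      show ?thesis
        unfolding output_prob_def Let_def decP dims of_real_sum
        by (intro sum.cong refl) (simp only: sq if_distrib[of complex_of_real] of_real_0)
    qed
    also have "\<dots> = (\<Sum>i<a'. \<Sum>j<b'. \<Sum>s<n. \<Sum>r<n. cnj (T s $$ (i, j)) * (if P1 i \<and> P2 j then T r $$ (i, j) else 0))"
    proof (intro sum.cong refl)
      fix i j assume i: "i \<in> {..<a'}" and j: "j \<in> {..<b'}"
      have f: "final_state Q x y $$ (i, j) = (\<Sum>r<n. T r $$ (i, j))"
        using sum[OF x y, of i j] i j by (simp add: T_def)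
      have "(if c then cnj (\<Sum>r<n. T r $$ (i, j)) * (\<Sum>r<n. T r $$ (i, j)) else 0)
          = (\<Sum>s<n. \<Sum>r<n. cnj (T s $$ (i, j)) * (if c then T r $$ (i, j) else 0))" for c
        by (cases c) (simp_all add: sum_product)
      then show "(if P1 i \<and> P2 j then cnj (final_state Q x y $$ (i, j)) * final_state Q x y $$ (i, j) else 0)
          = (\<Sum>s<n. \<Sum>r<n. cnj (T s $$ (i, j)) * (if P1 i \<and> P2 j then T r $$ (i, j) else 0))"
        unfolding f .
    qed
    also have "\<dots> = (\<Sum>i<a'. \<Sum>j<b'. \<Sum>s<n. \<Sum>r<n. cnj (T s $$ (i, j)) * (diag_proj a' P1 * T r * diag_proj b' P2) $$ (i, j))"
    proof (intro sum.cong refl)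
      fix i j s r assume i: "i \<in> {..<a'}" and j: "j \<in> {..<b'}" and r: "r \<in> {..<n}"
      have D: "diag_proj a' P1 * T r \<in> carrier_mat a' b'" using T r by (intro mult_carrier_mat) auto
      show "cnj (T s $$ (i, j)) * (if P1 i \<and> P2 j then T r $$ (i, j) else 0)
          = cnj (T s $$ (i, j)) * (diag_proj a' P1 * T r * diag_proj b' P2) $$ (i, j)"
        using i j r mult_diag_proj[OF D, of i j P2] diag_proj_mult[OF T[of r], of i j P1] by (simp del: index_mult_mat)
    qed
    also have "\<dots> = (\<Sum>(i, j, s, r)\<in>{..<a'} \<times> {..<b'} \<times> {..<n} \<times> {..<n}.
        cnj (T s $$ (i, j)) * (diag_proj a' P1 * T r * diag_proj b' P2) $$ (i, j))"
      by (simp only: sum.cartesian_product split_def fst_conv snd_conv)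
    also have "\<dots> = (\<Sum>(r, s, i, j)\<in>{..<n} \<times> {..<n} \<times> {..<a'} \<times> {..<b'}.
        cnj (T s $$ (i, j)) * (diag_proj a' P1 * T r * diag_proj b' P2) $$ (i, j))"
      by (rule sum.reindex_bij_witness[where i = "\<lambda>(r, s, i, j). (i, j, s, r)" and j = "\<lambda>(i, j, s, r). (r, s, i, j)"]) auto
    also have "\<dots> = (\<Sum>r<n. \<Sum>s<n. \<Sum>i<a'. \<Sum>j<b'.
        cnj (T s $$ (i, j)) * (diag_proj a' P1 * T r * diag_proj b' P2) $$ (i, j))"
      by (simp only: sum.cartesian_product split_def fst_conv snd_conv)
    also have "\<dots> = (\<Sum>r<n. \<Sum>s<n. ip (T s) (diag_proj a' P1 * T r * diag_proj b' P2))"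
      by (intro sum.cong refl) (simp add: ip_def carrier_matD[OF T] del: index_mult_mat)
    also have "\<dots> = (\<Sum>r<n. \<Sum>s<n. ip (?\<psi> * G r s y) (E r s x * ?\<psi>))"
    proof (intro sum.cong refl)
      fix r s assume "r \<in> {..<n}" "s \<in> {..<n}"
      then have r: "r < n" and s: "s < n" by auto
      have c: "A r x \<in> carrier_mat a' a" "A s x \<in> carrier_mat a' a" "B r y \<in> carrier_mat b b'" "B s y \<in> carrier_mat b b'"
        using A[OF x r] A[OF x s] B[OF y r] B[OF y s] by auto
      let ?K = "diag_proj a' P1 * A r x" and ?M = "B r y * diag_proj b' P2"
      have K: "?K \<in> carrier_mat a' a" using c by (intro mult_carrier_mat) auto
      have M: "?M \<in> carrier_mat b b'" using c by (intro mult_carrier_mat) auto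
      have K\<psi>: "?K * ?\<psi> \<in> carrier_mat a' b" by (rule mult_carrier_mat[OF K \<psi>])
      have \<psi>s: "?\<psi> * B s y \<in> carrier_mat a b'" by (rule mult_carrier_mat[OF \<psi> c(4)])
      have A\<psi>: "A r x * ?\<psi> \<in> carrier_mat a' b" by (rule mult_carrier_mat[OF c(1) \<psi>])
      have e1: "diag_proj a' P1 * T r * diag_proj b' P2 = (?K * ?\<psi>) * ?M"
      proof -
        have "diag_proj a' P1 * T r = diag_proj a' P1 * (A r x * ?\<psi>) * B r y"
          unfolding T_def by (rule assoc_mult_mat[OF diag_proj_carrier A\<psi> c(3), symmetric])
        also have "diag_proj a' P1 * (A r x * ?\<psi>) = ?K * ?\<psi>"
          by (rule assoc_mult_mat[OF diag_proj_carrier c(1) \<psi>, symmetric])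
        finally show ?thesis using assoc_mult_mat[OF K\<psi> c(3) diag_proj_carrier, of P2] by simp
      qed
      have "ip (T s) ((?K * ?\<psi>) * ?M) = ip (T s * adj ?M) (?K * ?\<psi>)"
        by (rule ip_mult_right[OF K\<psi> M T[OF s]])
      also have "T s * adj ?M = A s x * (?\<psi> * G r s y)"
      proof -
        have "T s = A s x * (?\<psi> * B s y)" unfolding T_def by (rule assoc_mult_mat[OF c(2) \<psi> c(4)])
        then have "T s * adj ?M = A s x * ((?\<psi> * B s y) * adj ?M)"
          using assoc_mult_mat[OF c(2) \<psi>s adj_carrier[OF M]] by simp
        also have "(?\<psi> * B s y) * adj ?M = ?\<psi> * G r s y"
          unfolding G_def by (rule assoc_mult_mat[OF \<psi> c(4) adj_carrier[OF M]])
        finally show ?thesis .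
      qed
      also have "ip (A s x * (?\<psi> * G r s y)) (?K * ?\<psi>) = ip (?\<psi> * G r s y) (adj (A s x) * (?K * ?\<psi>))"
      proof -
        have g: "?\<psi> * G r s y \<in> carrier_mat a b" using \<psi> G(1)[OF y r s] by (rule mult_carrier_mat)
        have "ip (?\<psi> * G r s y) (adj (A s x) * (?K * ?\<psi>)) = ip (adj (adj (A s x)) * (?\<psi> * G r s y)) (?K * ?\<psi>)"
          by (rule ip_mult_left[OF adj_carrier[OF c(2)] K\<psi> g])
        then show ?thesis by (simp add: adj_adj[OF c(2)])
      qed
      also have "adj (A s x) * (?K * ?\<psi>) = E r s x * ?\<psi>"
        unfolding E_def by (rule assoc_mult_mat[OF adj_carrier[OF c(2)] K \<psi>, symmetric])
      finally show "ip (T s) (diag_proj a' P1 * T r * diag_proj b' P2) = ip (?\<psi> * G r s y) (E r s x * ?\<psi>)"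
        unfolding e1 .
    qed
    also have "\<dots> = (\<Sum>r<n. \<Sum>s<n. \<Sum>p\<in>{..<a} \<times> {..<b}. cnj ((?\<psi> * G r s y) $$ p) * (E r s x * ?\<psi>) $$ p)"
    proof (intro sum.cong refl)
      fix r s assume "r \<in> {..<n}" "s \<in> {..<n}"
      then have "?\<psi> * G r s y \<in> carrier_mat a b" using \<psi> G(1)[OF y] by (intro mult_carrier_mat[of _ a b]) auto
      then show "ip (?\<psi> * G r s y) (E r s x * ?\<psi>)
          = (\<Sum>p\<in>{..<a} \<times> {..<b}. cnj ((?\<psi> * G r s y) $$ p) * (E r s x * ?\<psi>) $$ p)"
        unfolding ip_def by (simp add: sum.cartesian_product split_def del: index_mult_mat)
    qed
    also have "\<dots> = (\<Sum>r\<in>R. u r x * v r y)"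
      unfolding sumR u_def v_def by (simp add: mult.commute del: index_mult_mat)
    finally show ?thesis .
  qed
  moreover have "finite R" by (simp add: R_def)
  ultimately show thesis using uK vK that by blast
qed

text \<open>\<open>\<phi> * adj \<phi>\<close> is Alice's reduced density matrix. Without
  transmissions Bob's unitaries cancel in it, and Alice's conjugate it in the same way for both of
  Bob's inputs.\<close>

lemma gram_steps_Alice:
  assumes "qsteps_ok X Y a b ss" "qubits ss = 0" "x \<in> X" "y \<in> Y" "y' \<in> Y"
    and "\<phi> \<in> carrier_mat a b" "\<phi>' \<in> carrier_mat a b" "\<phi> * adj \<phi> = \<phi>' * adj \<phi>'"
  defines "f \<equiv> fold (apply_qstep x y) ss \<phi>" and "f' \<equiv> fold (apply_qstep x y') ss \<phi>'"
  shows "f \<in> carrier_mat a b" "f' \<in> carrier_mat a b" "f * adj f = f' * adj f'"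
proof -
  have "fold (apply_qstep x y) ss \<phi> \<in> carrier_mat a b \<and> fold (apply_qstep x y') ss \<phi>' \<in> carrier_mat a b \<and>
    fold (apply_qstep x y) ss \<phi> * adj (fold (apply_qstep x y) ss \<phi>)
      = fold (apply_qstep x y') ss \<phi>' * adj (fold (apply_qstep x y') ss \<phi>')"
    using assms(1-8)
  proof (induction ss arbitrary: \<phi> \<phi>')
    case (Cons s ss)
    note c = Cons.prems(6,7)
    show ?case
    proof (cases s)
      case (Alice_Unitary U)
      then have U: "U x \<in> carrier_mat a a" using Cons.prems by (auto simp: is_unitary_def)
      have gram: "(U x * M) * adj (U x * M) = U x * ((M * adj M) * adj (U x))" if M: "M \<in> carrier_mat a b" for M
      proof -
        have aU: "adj (U x) \<in> carrier_mat a a" and aM: "adj M \<in> carrier_mat b a" using U M by simp_all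
        have "(U x * M) * adj (U x * M) = U x * (M * (adj M * adj (U x)))"
          unfolding adj_mult[OF U M] by (rule assoc_mult_mat[OF U M mult_carrier_mat[OF aM aU]])
        then show ?thesis using assoc_mult_mat[OF M aM aU] by simp
      qed
      have "(U x * \<phi>) * adj (U x * \<phi>) = (U x * \<phi>') * adj (U x * \<phi>')"
        unfolding gram[OF c(1)] gram[OF c(2)] Cons.prems(8) ..
      then show ?thesis
        using Cons.IH[of "U x * \<phi>" "U x * \<phi>'"] Cons.prems Alice_Unitary
          mult_carrier_mat[OF U c(1)] mult_carrier_mat[OF U c(2)] by simp
    next
      case (Bob_Unitary V)
      have V: "is_unitary b (transpose_mat (V v))" if "v \<in> Y" for v
        using Cons.prems(1) Bob_Unitary that is_unitary_transpose by auto
      have gram: "(M * transpose_mat (V v)) * adj (M * transpose_mat (V v)) = M * adj M"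
        and car: "M * transpose_mat (V v) \<in> carrier_mat a b"
        if M: "M \<in> carrier_mat a b" and v: "v \<in> Y" for M v
      proof -
        let ?W = "transpose_mat (V v)"
        have W: "?W \<in> carrier_mat b b" "?W * adj ?W = 1\<^sub>m b"
          using V[OF v] by (auto simp: is_unitary_def mat_adjoint_eq_adj)
        show "M * ?W \<in> carrier_mat a b" by (rule mult_carrier_mat[OF M W(1)])
        have aM: "adj M \<in> carrier_mat b a" and aW: "adj ?W \<in> carrier_mat b b" using W M by simp_all
        have "(M * ?W) * adj (M * ?W) = M * (?W * (adj ?W * adj M))"
          unfolding adj_mult[OF M W(1)] by (rule assoc_mult_mat[OF M W(1) mult_carrier_mat[OF aW aM]])
        also have "?W * (adj ?W * adj M) = adj M"
          unfolding assoc_mult_mat[OF W(1) aW aM, symmetric] W(2) by (rule left_mult_one_mat[OF aM])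
        finally show "(M * ?W) * adj (M * ?W) = M * adj M" .
      qed
      have "(\<phi> * transpose_mat (V y)) * adj (\<phi> * transpose_mat (V y))
          = (\<phi>' * transpose_mat (V y')) * adj (\<phi>' * transpose_mat (V y'))"
        unfolding gram[OF c(1) Cons.prems(4)] gram[OF c(2) Cons.prems(5)] by (rule Cons.prems(8))
      then show ?thesis
        using Cons.IH[of "\<phi> * transpose_mat (V y)" "\<phi>' * transpose_mat (V y')"] Cons.prems Bob_Unitary
          car[OF c(1) Cons.prems(4)] car[OF c(2) Cons.prems(5)] by simp
    qed (use Cons.prems in auto)
  qed simp
  then show "f \<in> carrier_mat a b" "f' \<in> carrier_mat a b" "f * adj f = f' * adj f'"
    unfolding f_def f'_def by auto
qed

text \<open>Exchanging the players transposes the joint state. This reduces a measurement by Bob to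
  one by Alice.\<close>

primrec swap_step :: "('x, 'y) qstep \<Rightarrow> ('y, 'x) qstep" where
  "swap_step (Alice_Unitary U) = Bob_Unitary U"
| "swap_step (Bob_Unitary V) = Alice_Unitary V"
| "swap_step Alice_Qubit = Bob_Qubit"
| "swap_step Bob_Qubit = Alice_Qubit"

lemma qsteps_ok_swap: "qsteps_ok X Y a b ss \<Longrightarrow> qubits ss = 0 \<Longrightarrow>
   qsteps_ok Y X b a (map swap_step ss) \<and> qubits (map swap_step ss) = 0"
proof (induction ss)
  case (Cons s ss)
  then show ?case by (cases s) auto
qed simp

lemma fold_swap:
  assumes "qsteps_ok X Y a b ss" "qubits ss = 0" "x \<in> X" "y \<in> Y" "\<phi> \<in> carrier_mat a b"
  shows "fold (apply_qstep x y) ss \<phi> \<in> carrier_mat a b \<and>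
    transpose_mat (fold (apply_qstep x y) ss \<phi>) = fold (apply_qstep y x) (map swap_step ss) (transpose_mat \<phi>)"
  using assms
proof (induction ss arbitrary: \<phi>)
  case (Cons s ss)
  show ?case
  proof (cases s)
    case (Alice_Unitary U)
    then have U: "U x \<in> carrier_mat a a" using Cons.prems by (auto simp: is_unitary_def)
    show ?thesis
      using Cons.IH[of "U x * \<phi>"] Cons.prems Alice_Unitary mult_carrier_mat[OF U Cons.prems(5)]
        transpose_mult[OF U Cons.prems(5)] by simp
  next
    case (Bob_Unitary V)
    then have V: "V y \<in> carrier_mat b b" using Cons.prems by (auto simp: is_unitary_def)
    then have Vt: "transpose_mat (V y) \<in> carrier_mat b b" by simp
    show ?thesis
      using Cons.IH[of "\<phi> * transpose_mat (V y)"] Cons.prems Bob_Unitary mult_carrier_mat[OF Cons.prems(5) Vt]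
        transpose_mult[OF Cons.prems(5) Vt] by simp
  qed (use Cons.prems in auto)
qed simp

text \<open>The diagonal of the reduced density matrix is the distribution of Alice's
  outcome.\<close>

lemma row_norm_gram:
  assumes "\<phi> \<in> carrier_mat a b" "i < a"
  shows "of_real (\<Sum>j<b. (cmod (\<phi> $$ (i, j)))\<^sup>2) = (\<phi> * adj \<phi>) $$ (i, i)"
proof -
  have "(\<phi> * adj \<phi>) $$ (i, i) = (\<Sum>j<b. \<phi> $$ (i, j) * adj \<phi> $$ (j, i))"
    using assms by (intro index_mult_mat_sum[of _ a b _ a]) auto
  also have "\<dots> = (\<Sum>j<b. of_real ((cmod (\<phi> $$ (i, j)))\<^sup>2))"
    using assms by (intro sum.cong refl) (simp add: index_adj[OF assms(1)] complex_norm_square del: of_real_power)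
  finally show ?thesis by (simp only: of_real_sum)
qed

text \<open>No-signalling: the outcome depends only on the reduced state of the measuring player,
  which \<open>gram_steps_Alice\<close> shows to be unaffected by the other input.\<close>

lemma output_prob_no_qubit:
  assumes ok: "qprotocol_ok X Y Q" and c: "qcost Q = 0"
  shows "alice_measures Q \<Longrightarrow> x \<in> X \<Longrightarrow> y \<in> Y \<Longrightarrow> y' \<in> Y \<Longrightarrow> output_prob Q x y v = output_prob Q x y' v"
    and "\<not> alice_measures Q \<Longrightarrow> x \<in> X \<Longrightarrow> x' \<in> X \<Longrightarrow> y \<in> Y \<Longrightarrow> output_prob Q x y v = output_prob Q x' y v"
proof -
  let ?\<psi> = "init_state Q"
  define a b where "a = dim_row ?\<psi>" and "b = dim_col ?\<psi>"
  have \<psi>: "?\<psi> \<in> carrier_mat a b" by (simp add: a_def b_def)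
  have steps: "qsteps_ok X Y a b (steps Q)" "qubits (steps Q) = 0"
    using ok c by (simp_all add: qprotocol_ok_def a_def b_def qcost_def qubits_def)
  { assume m: "alice_measures Q" and x: "x \<in> X" and y: "y \<in> Y" "y' \<in> Y"
    note g = gram_steps_Alice[OF steps x y \<psi> \<psi> refl]
    have "(\<Sum>j<b. (cmod (final_state Q x y $$ (i, j)))\<^sup>2) = (\<Sum>j<b. (cmod (final_state Q x y' $$ (i, j)))\<^sup>2)"
      if "i < a" for i
      using row_norm_gram[OF g(1) that] row_norm_gram[OF g(2) that] g(3)
      unfolding final_state_def by (metis of_real_eq_iff)
    then have rows: "(\<Sum>j<b. if decide Q i = v then (cmod (final_state Q x y $$ (i, j)))\<^sup>2 else 0)
       = (\<Sum>j<b. if decide Q i = v then (cmod (final_state Q x y' $$ (i, j)))\<^sup>2 else 0)" if "i < a" for i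
      using that by (cases "decide Q i = v") simp_all
    have dims: "dim_row (final_state Q x y) = a" "dim_col (final_state Q x y) = b"
      "dim_row (final_state Q x y') = a" "dim_col (final_state Q x y') = b"
      using g(1,2) unfolding final_state_def by auto
    show "output_prob Q x y v = output_prob Q x y' v"
      unfolding output_prob_def Let_def dims by (rule sum.cong[OF refl]) (use m rows in simp)
  }
  { assume m: "\<not> alice_measures Q" and x: "x \<in> X" "x' \<in> X" and y: "y \<in> Y"
    have \<psi>t: "transpose_mat ?\<psi> \<in> carrier_mat b a" using \<psi> by simp
    have sw: "qsteps_ok Y X b a (map swap_step (steps Q))" "qubits (map swap_step (steps Q)) = 0"
      using qsteps_ok_swap[OF steps] by simp_all
    note f = fold_swap[OF steps x(1) y \<psi>] fold_swap[OF steps x(2) y \<psi>]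
    note g = gram_steps_Alice[OF sw y x \<psi>t \<psi>t refl]
    have dims: "dim_row (final_state Q x y) = a" "dim_col (final_state Q x y) = b"
      "dim_row (final_state Q x' y) = a" "dim_col (final_state Q x' y) = b"
      using f unfolding final_state_def by auto
    have t: "final_state Q u y $$ (i, j) = fold (apply_qstep y u) (map swap_step (steps Q)) (transpose_mat ?\<psi>) $$ (j, i)"
      if "u \<in> X" "i < a" "j < b" for i j u
      using fold_swap[OF steps that(1) y \<psi>] that unfolding final_state_def
      by (metis carrier_matD index_transpose_mat(1))
    have cols: "(\<Sum>i<a. (cmod (final_state Q x y $$ (i, j)))\<^sup>2) = (\<Sum>i<a. (cmod (final_state Q x' y $$ (i, j)))\<^sup>2)"
      if "j < b" for j
    proof -
      have "complex_of_real (\<Sum>i<a. (cmod (final_state Q x y $$ (i, j)))\<^sup>2)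
          = complex_of_real (\<Sum>i<a. (cmod (final_state Q x' y $$ (i, j)))\<^sup>2)"
        using row_norm_gram[OF g(1) that] row_norm_gram[OF g(2) that] g(3) t[OF x(1)] t[OF x(2)] that
        by simp
      then show ?thesis by (simp only: of_real_eq_iff)
    qed
    have cols': "(\<Sum>i<a. if decide Q j = v then (cmod (final_state Q x y $$ (i, j)))\<^sup>2 else 0)
       = (\<Sum>i<a. if decide Q j = v then (cmod (final_state Q x' y $$ (i, j)))\<^sup>2 else 0)" if "j < b" for j
      using cols[OF that] by (cases "decide Q j = v") simp_all
    have swap: "output_prob Q u y v = (\<Sum>j<b. \<Sum>i<a. if decide Q j = v then (cmod (final_state Q u y $$ (i, j)))\<^sup>2 else 0)"
      if "dim_row (final_state Q u y) = a" "dim_col (final_state Q u y) = b" for u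
      unfolding output_prob_def Let_def that using m by (simp add: sum.swap[of _ "{..<a}"])
    show "output_prob Q x y v = output_prob Q x' y v"
      unfolding swap[OF dims(1,2)] swap[OF dims(3,4)] by (rule sum.cong[OF refl]) (use cols' in simp)
  }
qed

section \<open>The quantum lower bound\<close>

lemma block_union_Int:
  assumes "\<And>k l. k \<in> I \<Longrightarrow> l \<in> I \<Longrightarrow> k \<noteq> l \<Longrightarrow> blk k \<inter> blk l = {}" "K \<subseteq> I" "L \<subseteq> I"
  shows "(\<Union>k\<in>K. blk k) \<inter> (\<Union>k\<in>L. blk k) = (\<Union>k\<in>K \<inter> L. blk k)"
proof
  show "(\<Union>k\<in>K. blk k) \<inter> (\<Union>k\<in>L. blk k) \<subseteq> (\<Union>k\<in>K \<inter> L. blk k)"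
  proof
    fix e assume "e \<in> (\<Union>k\<in>K. blk k) \<inter> (\<Union>k\<in>L. blk k)"
    then obtain k l where kl: "k \<in> K" "l \<in> L" "e \<in> blk k" "e \<in> blk l" by blast
    then have "k = l" using assms(1)[of k l] assms(2,3) by auto
    then show "e \<in> (\<Union>k\<in>K \<inter> L. blk k)" using kl by blast
  qed
qed blast

text \<open>The index \<open>i\<close> owns four blocks, numbered \<open>2 * c\<close> and
  \<open>2 * c + 1\<close> for its coordinates \<open>c = 2 * i\<close> and
  \<open>c = 2 * i + 1\<close>. Of each such pair Alice takes the even one if
  \<open>c \<in> x\<close> and the odd one otherwise, so Bob compares \<open>c \<in> x\<close> with
  his mask by choosing a parity.\<close>

definition alice_blocks :: "nat \<Rightarrow> nat set \<Rightarrow> nat set" where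
  "alice_blocks t x = {k. k < 4 * t \<and> (k div 2 \<in> x) \<noteq> odd k}"

text \<open>One block per index, so at most one of the four blocks of an index is taken by both
  players.\<close>

definition bob_blocks :: "nat \<Rightarrow> nat set \<Rightarrow> nat set \<Rightarrow> nat set" where
  "bob_blocks t V w = (\<lambda>i. 2 * coord V i + of_bool (i \<in> w)) ` {..<t}"

lemma bob_blocks_subset: "bob_blocks t V w \<subseteq> {..<4 * t}"
proof -
  have "2 * coord V i + of_bool (i \<in> w) < 4 * t" if "i < t" for i
    using coord_less[OF that, of V] by (cases "i \<in> w") auto
  then show ?thesis by (auto simp: bob_blocks_def)
qed

lemma alice_bob_blocks:
  "alice_blocks t x \<inter> bob_blocks t V w = (\<lambda>i. 2 * coord V i + of_bool (i \<in> w)) ` pattern {..<t} x V w"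
proof -
  have "2 * coord V i + of_bool (i \<in> w) \<in> alice_blocks t x \<longleftrightarrow> (coord V i \<in> x) \<noteq> (i \<in> w)" if "i < t" for i
    using coord_less[OF that, of V] unfolding alice_blocks_def by (cases "i \<in> w") auto
  then show ?thesis unfolding bob_blocks_def pattern_def by auto
qed

lemma pattern_involution: "z \<subseteq> T \<Longrightarrow> pattern T x V (pattern T x V z) = z"
  by (auto simp: pattern_def)

text \<open>Alice and Bob turn a pattern matrix input into strings whose AND (if the blocks consist of
  zeros of the base point) or OR (if they consist of ones) is the base point with the blocks indexed
  by \<open>pattern\<close> flipped; Bob's choice of \<open>V\<close> and \<open>w\<close> decides which of four blocks
  stands for the index.\<close>

lemma quantum_pure_blocks:
  assumes ok: "qprotocol_ok (bits n \<times> UNIV) (bits n) Q"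
    and correct: "\<And>x y. x \<in> bits n \<times> UNIV \<Longrightarrow> y \<in> bits n \<Longrightarrow> 2 / 3 \<le> output_prob Q x y (and_or_problem f x y)"
    and sens: "sensitive_blocks {1..n} (cube_fun n f) A \<B>"
    and pure: "\<Union>\<B> \<inter> A = {} \<or> \<Union>\<B> \<subseteq> A"
    and t: "4 * t \<le> card \<B>" "1 \<le> t" "41 * d\<^sup>2 \<le> t"
  shows "d \<le> 4 * qcost Q + 7"
proof -
  define T where "T = {..<t}"
  have T: "finite T" "card T = t" by (auto simp: T_def)
  have "finite \<B>" using sensitive_blocks_finite[OF _ sens] by simp
  then obtain blk where blk: "bij_betw blk {..<card \<B>} \<B>"
    using ex_bij_betw_nat_finite[of \<B>] by (auto simp: lessThan_atLeast0)
  have blk_in: "blk k \<in> \<B>" if "k < 4 * t" for k using blk that t(1) by (auto simp: bij_betw_def)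
  have disj: "blk k \<inter> blk l = {}" if "k \<in> {..<4 * t}" "l \<in> {..<4 * t}" "k \<noteq> l" for k l
  proof -
    have "blk k \<noteq> blk l" using inj_onD[OF bij_betw_imp_inj_on[OF blk], of k l] that t(1) by auto
    then show ?thesis
      using disjointD[of \<B> "blk k" "blk l"] sens blk_in that by (simp add: sensitive_blocks_def)
  qed
  define U where "U = (\<lambda>K. \<Union>k\<in>K. blk k)"
  define ones where "ones \<longleftrightarrow> \<not> \<Union>\<B> \<inter> A = {}"
  define flip where "flip = (\<lambda>S. if ones then A - S else A \<union> S)"
  define X where "X = (\<lambda>x. (char_vec n (flip (U (alice_blocks t x))), ones))"
  define Y where "Y = (\<lambda>V w. char_vec n (flip (U (bob_blocks t V w))))"
  \<comment> \<open>The value may depend on which of its four blocks represents an index, hence on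
    \<open>V\<close> and \<open>w\<close>. Only for \<open>z\<close> empty or a singleton is it
    determined, by \<open>g0\<close> and \<open>g1\<close>.\<close>
  define g where "g = (\<lambda>V w z. cube_fun n f (flip (U ((\<lambda>i. 2 * coord V i + of_bool (i \<in> w)) ` z))))"
  have XY: "X x \<in> bits n \<times> UNIV" "Y V w \<in> bits n" for x V w by (simp_all add: X_def Y_def)
  have F: "and_or_problem f (X x) (Y V w) = g V w (pattern T x V w)" for x V w
  proof -
    have "U (alice_blocks t x) \<inter> U (bob_blocks t V w) = U (alice_blocks t x \<inter> bob_blocks t V w)"
      unfolding U_def by (rule block_union_Int[OF disj _ bob_blocks_subset]) (auto simp: alice_blocks_def)
    then have UI: "U (alice_blocks t x) \<inter> U (bob_blocks t V w)
        = U ((\<lambda>i. 2 * coord V i + of_bool (i \<in> w)) ` pattern T x V w)"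
      unfolding alice_bob_blocks T_def .
    show ?thesis
    proof (cases ones)
      case True
      have "A - U (alice_blocks t x) \<union> (A - U (bob_blocks t V w))
          = A - U (alice_blocks t x) \<inter> U (bob_blocks t V w)" by blast
      then show ?thesis using True
        by (simp add: X_def Y_def g_def and_or_problem_def bit_or_char_vec cube_fun_def flip_def UI)
    next
      case False
      have "(A \<union> U (alice_blocks t x)) \<inter> (A \<union> U (bob_blocks t V w))
          = A \<union> U (alice_blocks t x) \<inter> U (bob_blocks t V w)" by blast
      then show ?thesis using False
        by (simp add: X_def Y_def g_def and_or_problem_def bit_and_char_vec cube_fun_def flip_def UI)
    qed
  qed
  define val where "val = cube_fun n f A"
  have g0: "g V w {} = val" for V w by (simp add: g_def U_def flip_def val_def)
  have g1: "g V w {i} = (\<not> val)" if "i \<in> T" for V w i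
  proof -
    define k where "k = 2 * coord V i + of_bool (i \<in> w)"
    have "k \<in> bob_blocks t V w" using that by (auto simp: k_def bob_blocks_def T_def)
    then have B: "blk k \<in> \<B>" using bob_blocks_subset blk_in by blast
    then have "flip (blk k) = sym_diff A (blk k)"
      using pure unfolding flip_def ones_def by (cases "\<Union>\<B> \<inter> A = {}") auto
    moreover have "cube_fun n f (sym_diff A (blk k)) \<noteq> val"
      using sens B unfolding sensitive_blocks_def val_def by blast
    ultimately show ?thesis by (simp add: g_def U_def k_def[symmetric])
  qed
  define M where "M = (\<lambda>x V w. output_prob Q (X x) (Y V w) val)"
  have M: "0 \<le> M x V w" "M x V w \<le> 1" for x V w
  proof -
    note b = output_prob_bounds[OF ok XY(1) XY(2), of x V w]
    show "0 \<le> M x V w" unfolding M_def by (rule b(1))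
    show "M x V w \<le> 1" unfolding M_def using b(1)[of True] b(1)[of False] b(2) by (cases val) auto
  qed
  have M0: "2 / 3 \<le> M x V w" if "pattern T x V w = {}" for x V w
    using correct[OF XY, of x V w] unfolding F that g0 M_def .
  have M1: "M x V w \<le> 1 / 3" if "pattern T x V w = {i}" "i \<in> T" for x V w i
  proof -
    have "2 / 3 \<le> output_prob Q (X x) (Y V w) (\<not> val)"
      using correct[OF XY, of x V w] unfolding F that(1) g1[OF that(2)] .
    then show ?thesis using output_prob_bounds(2)[OF ok XY(1) XY(2), of x V w] unfolding M_def by (cases val) auto
  qed
  obtain \<psi> where \<psi>: "\<And>S. S \<subseteq> T \<Longrightarrow> card S \<le> d \<Longrightarrow> (\<Sum>z\<in>Pow T. \<psi> z * chi S z) = 0"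
    "(\<Sum>z\<in>Pow T. \<bar>\<psi> z\<bar>) \<le> 3"
    and \<psi>F: "\<And>F. (\<And>z. z \<subseteq> T \<Longrightarrow> 0 \<le> F z \<and> F z \<le> 1) \<Longrightarrow> 2 / 3 \<le> F {} \<Longrightarrow> (\<And>i. i \<in> T \<Longrightarrow> F {i} \<le> 1 / 3) \<Longrightarrow>
       1 / 4 \<le> (\<Sum>z\<in>Pow T. \<psi> z * F z)"
    using dual_cube[OF T(1), of d] t T(2) by auto
  let ?X = "Pow {..<2 * t}"
  have card8: "real (card ?X * card (Pow T)) = 8 ^ t"
    using T by (simp add: card_Pow power_mult power_mult_distrib[symmetric])
  \<comment> \<open>The average probability of the output \<open>val\<close> over the inputs with
    pattern \<open>z\<close>; by the involution, their mask is \<open>pattern T x V z\<close>.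
    Averaging yields a function of \<open>z\<close> alone, although \<open>g\<close> depends on
    \<open>V\<close> and \<open>w\<close>.\<close>
  define F where "F = (\<lambda>z. (\<Sum>x\<in>?X. \<Sum>V\<in>Pow T. M x V (pattern T x V z)) / 8 ^ t)"
  have avg: "(\<Sum>x\<in>?X. \<Sum>V\<in>Pow T. c) = c * 8 ^ t" for c :: real
    using card8 by (simp add: mult.commute mult.assoc)
  have "1 / 4 \<le> (\<Sum>z\<in>Pow T. \<psi> z * F z)"
  proof (rule \<psi>F)
    show "0 \<le> F z \<and> F z \<le> 1" if "z \<subseteq> T" for z
    proof
      show "0 \<le> F z" unfolding F_def using M by (intro divide_nonneg_nonneg sum_nonneg) auto
      have "(\<Sum>x\<in>?X. \<Sum>V\<in>Pow T. M x V (pattern T x V z)) \<le> (\<Sum>x\<in>?X. \<Sum>V\<in>Pow T. 1)"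
        by (intro sum_mono M)
      then show "F z \<le> 1" unfolding avg F_def by simp
    qed
    have "(\<Sum>x\<in>?X. \<Sum>V\<in>Pow T. 2 / 3) \<le> (\<Sum>x\<in>?X. \<Sum>V\<in>Pow T. M x V (pattern T x V {}))"
      by (intro sum_mono M0 pattern_involution) simp
    then show "2 / 3 \<le> F {}" unfolding avg F_def by (simp add: field_simps)
    show "F {i} \<le> 1 / 3" if "i \<in> T" for i
    proof -
      have "(\<Sum>x\<in>?X. \<Sum>V\<in>Pow T. M x V (pattern T x V {i})) \<le> (\<Sum>x\<in>?X. \<Sum>V\<in>Pow T. 1 / 3)"
        using that by (intro sum_mono M1[OF pattern_involution]) auto
      then show ?thesis unfolding avg F_def by (simp add: field_simps)
    qed
  qed
  also have "(\<Sum>z\<in>Pow T. \<psi> z * F z)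
      = (\<Sum>x\<in>?X. \<Sum>V\<in>Pow T. \<Sum>w\<in>Pow T. \<psi> (pattern T x V w) * M x V w) / 8 ^ t"
  proof -
    have "(\<Sum>z\<in>Pow T. \<psi> z * F z)
        = (\<Sum>z\<in>Pow T. \<Sum>x\<in>?X. \<Sum>V\<in>Pow T. \<psi> z * M x V (pattern T x V z)) / 8 ^ t"
      by (simp add: F_def sum_distrib_left sum_divide_distrib)
    also have "(\<Sum>z\<in>Pow T. \<Sum>x\<in>?X. \<Sum>V\<in>Pow T. \<psi> z * M x V (pattern T x V z))
        = (\<Sum>x\<in>?X. \<Sum>z\<in>Pow T. \<Sum>V\<in>Pow T. \<psi> z * M x V (pattern T x V z))" by (rule sum.swap)
    also have "\<dots> = (\<Sum>x\<in>?X. \<Sum>V\<in>Pow T. \<Sum>z\<in>Pow T. \<psi> z * M x V (pattern T x V z))"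
      by (intro sum.cong refl sum.swap)
    also have "\<dots> = (\<Sum>x\<in>?X. \<Sum>V\<in>Pow T. \<Sum>w\<in>Pow T. \<psi> (pattern T x V w) * M x V w)"
    proof (rule sum.cong[OF refl], rule sum.cong[OF refl])
      fix x V
      show "(\<Sum>z\<in>Pow T. \<psi> z * M x V (pattern T x V z)) = (\<Sum>w\<in>Pow T. \<psi> (pattern T x V w) * M x V w)"
        unfolding sum_pattern_eq[OF T(1), of "\<lambda>z. \<psi> z * M x V (pattern T x V z)" x V, symmetric]
        by (intro sum.cong refl) (simp add: pattern_involution)
    qed
    finally show ?thesis .
  qed
  finally have lower: "8 ^ t / 4 \<le> (\<Sum>x\<in>?X. \<Sum>V\<in>Pow T. \<Sum>w\<in>Pow T. \<psi> (pattern T x V w) * M x V w)" (is "_ \<le> ?S")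
    by (simp add: field_simps)
  obtain R :: "((nat \<times> nat) \<times> nat \<times> nat) set" and u v where R: "finite R"
    and u: "\<And>x. x \<in> bits n \<times> UNIV \<Longrightarrow> (\<Sum>r\<in>R. (cmod (u r x))\<^sup>2) \<le> 4 ^ qcost Q"
    and v: "\<And>y. y \<in> bits n \<Longrightarrow> (\<Sum>r\<in>R. (cmod (v r y))\<^sup>2) \<le> 4 ^ qcost Q"
    and uv: "\<And>x y. x \<in> bits n \<times> UNIV \<Longrightarrow> y \<in> bits n \<Longrightarrow>
      of_real (output_prob Q x y val) = (\<Sum>r\<in>R. u r x * v r y)"
    using output_prob_factorization[OF ok, of val] by blast
  have "cmod (\<Sum>x\<in>?X. \<Sum>V\<in>Pow T. \<Sum>w\<in>Pow T.
      of_real (\<psi> (pattern T x V w)) * (\<Sum>r\<in>R. u r (X x) * v r (Y V w)))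
    \<le> 3 * 4 ^ qcost Q * 8 ^ t / sqrt (2 ^ Suc d)"
    unfolding T_def
    by (rule pattern_discrepancy[OF R]) (use u v XY \<psi> in \<open>simp_all add: T_def\<close>)
  also have "(\<Sum>x\<in>?X. \<Sum>V\<in>Pow T. \<Sum>w\<in>Pow T.
      of_real (\<psi> (pattern T x V w)) * (\<Sum>r\<in>R. u r (X x) * v r (Y V w))) = of_real ?S"
    unfolding of_real_sum of_real_mult M_def uv[OF XY] ..
  finally have "\<bar>?S\<bar> \<le> 3 * 4 ^ qcost Q * 8 ^ t / sqrt (2 ^ Suc d)" by (simp only: norm_of_real)
  with lower have "8 ^ t / 4 \<le> 3 * 4 ^ qcost Q * 8 ^ t / sqrt (2 ^ Suc d)" by linarith
  \<comment> \<open>The 12 is the norm bound 3 of \<open>\<psi>\<close> divided by the correlation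
    1/4. Its square 144 is below \<open>2 ^ 8\<close>, which explains the 7 in the
    conclusion.\<close>
  then have "sqrt (2 ^ Suc d) \<le> 12 * 4 ^ qcost Q"
    by (simp add: field_simps)
  then have "(sqrt (2 ^ Suc d))\<^sup>2 \<le> (12 * 4 ^ qcost Q)\<^sup>2" by (rule power_mono) simp
  then have "(2 :: real) ^ Suc d \<le> 144 * 16 ^ qcost Q"
    by (simp add: power_mult_distrib power_mult[symmetric] mult.commute[of _ 2] power_mult)
  also have "\<dots> \<le> 2 ^ 8 * 2 ^ (4 * qcost Q)" by (simp add: power_mult)
  also have "\<dots> = 2 ^ (8 + 4 * qcost Q)" by (simp add: power_add)
  finally have "Suc d \<le> 8 + 4 * qcost Q" by (simp only: power_increasing_iff one_less_numeral_iff semiring_norm)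
  then show ?thesis by simp
qed

text \<open>If Alice measures, she is given the string of ones, so that the AND equals Bob's string,
  while her outcome cannot depend on it; if Bob measures, the roles are exchanged. The bound
  \<open>d \<le> 4 * qcost Q + 7\<close> would still admit a positive block sensitivity at cost 0,
  which no multiple of the cost controls.\<close>

lemma quantum_no_qubit_constant:
  assumes ok: "qprotocol_ok (bits n \<times> UNIV) (bits n) Q"
    and correct: "\<And>x y. x \<in> bits n \<times> UNIV \<Longrightarrow> y \<in> bits n \<Longrightarrow> 2 / 3 \<le> output_prob Q x y (and_or_problem f x y)"
    and c: "qcost Q = 0"
  shows "block_sensitivity n f = 0"
proof -
  have unique: "v = v'" if "x \<in> bits n \<times> UNIV" "y \<in> bits n" "2 / 3 \<le> output_prob Q x y v" "2 / 3 \<le> output_prob Q x y v'"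
    for x y v v'
    using output_prob_bounds(2)[OF ok that(1,2)] that(3,4) by (cases v; cases v') auto
  let ?E = "char_vec n {1..n}"
  have const: "cube_fun n f B = cube_fun n f B'" for B B'
  proof (cases "alice_measures Q")
    case True
    have E: "(?E, True) \<in> bits n \<times> UNIV" "(?E, False) \<in> bits n \<times> UNIV" by auto
    have n: "char_vec n ({1..n} \<inter> C) = char_vec n C" for C by (rule nth_equalityI) auto
    have "2 / 3 \<le> output_prob Q (?E, False) (char_vec n B) (cube_fun n f C)" for C
      using correct[OF E(2), of "char_vec n C"] output_prob_no_qubit(1)[OF ok c True E(2), of "char_vec n C" "char_vec n B"]
      by (simp add: and_or_problem_def bit_and_char_vec n cube_fun_def del: One_nat_def)
    then show ?thesis using unique[OF E(2), of "char_vec n B"] by simp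
  next
    case False
    have n: "char_vec n (C \<inter> {1..n}) = char_vec n C" for C by (rule nth_equalityI) auto
    have "2 / 3 \<le> output_prob Q (char_vec n B, False) ?E (cube_fun n f C)" for C
      using correct[of "(char_vec n C, False)" ?E]
        output_prob_no_qubit(2)[OF ok c False, of "(char_vec n C, False)" "(char_vec n B, False)" ?E]
      by (simp add: and_or_problem_def bit_and_char_vec n cube_fun_def del: One_nat_def)
    then show ?thesis using unique[of "(char_vec n B, False)" ?E] by simp
  qed
  obtain A \<B> where s: "sensitive_blocks {1..n} (cube_fun n f) A \<B>" "card \<B> = block_sensitivity n f"
    using block_sensitivity_attained by blast
  then have "\<B> = {}" using const unfolding sensitive_blocks_def by blast
  then show ?thesis using s(2) by simp
qed

lemma quantum_lower_bound:
  assumes ok: "qprotocol_ok (bits n \<times> UNIV) (bits n) Q"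
    and correct: "\<And>x y. x \<in> bits n \<times> UNIV \<Longrightarrow> y \<in> bits n \<Longrightarrow> 2 / 3 \<le> output_prob Q x y (and_or_problem f x y)"
  shows "real (block_sensitivity n f) powr (1 / 4) \<le> 274 * real (qcost Q)"
proof (cases "qcost Q = 0")
  case True
  then show ?thesis using quantum_no_qubit_constant[OF ok correct] by simp
next
  case False
  let ?c = "qcost Q"
  \<comment> \<open>One more than \<open>quantum_pure_blocks\<close> permits. Hence there are at
    most \<open>s = 4 * 41 * d\<^sup>2\<close> pure blocks, the 4 counting the blocks of an
    index.\<close>
  define d where "d = 4 * ?c + 8"
  define s where "s = 164 * d\<^sup>2"
  have d: "d \<ge> 8" by (simp add: d_def)
  have s1: "s \<ge> 1" using d by (simp add: s_def)
  have pure: "card \<C> \<le> s"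
    if "sensitive_blocks {1..n} (cube_fun n f) A \<C>" "\<Union>\<C> \<inter> A = {} \<or> \<Union>\<C> \<subseteq> A" for A \<C>
  proof (rule ccontr)
    assume "\<not> card \<C> \<le> s"
    then have "4 * (41 * d\<^sup>2) \<le> card \<C>" by (simp add: s_def)
    from quantum_pure_blocks[OF ok correct that this, of d] d have "d \<le> 4 * ?c + 7" by simp
    then show False by (simp add: d_def)
  qed
  obtain A \<B> where \<B>: "sensitive_blocks {1..n} (cube_fun n f) A \<B>" "card \<B> = block_sensitivity n f"
    using block_sensitivity_attained by blast
  have "card \<B> \<le> 10 * s * s"
    by (rule sensitive_blocks_le_pure[OF _ s1 \<B>(1) pure]) auto
  then have "real (block_sensitivity n f) \<le> real (10 * s * s)" unfolding \<B>(2) by (simp only: of_nat_le_iff)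
  \<comment> \<open>The number is \<open>10 * 164\<^sup>2\<close>. For positive cost
    \<open>d \<le> 12 * qcost Q\<close>, and 274 is the least integer whose fourth power reaches
    \<open>268960 * 12 ^ 4\<close>.\<close>
  also have "\<dots> = 268960 * real d ^ 4" by (simp add: s_def power2_eq_square power4_eq_xxxx)
  also have "\<dots> \<le> 268960 * (12 * real ?c) ^ 4"
    using False by (intro mult_left_mono power_mono) (auto simp: d_def)
  also have "\<dots> \<le> (274 * real ?c) ^ 4" by (simp add: power_mult_distrib)
  finally have "real (block_sensitivity n f) powr (1 / 4) \<le> ((274 * real ?c) ^ 4) powr (1 / 4)"
    by (intro powr_mono2) auto
  also have "\<dots> = 274 * real ?c"
  proof -
    have pos: "274 * real ?c > 0" using False by simp
    then have "((274 * real ?c) ^ 4) powr (1 / 4) = ((274 * real ?c) powr 4) powr (1 / 4)"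
      by (simp only: powr_numeral)
    also have "\<dots> = (274 * real ?c) powr (4 * (1 / 4))" by (rule powr_powr)
    also have "\<dots> = 274 * real ?c" using pos by simp
    finally show ?thesis .
  qed
  finally show ?thesis .
qed

section \<open>Finite shared randomness and two-level messages\<close>

lemma space_coins [simp]: "space coins = UNIV"
  by (simp add: coins_def space_stream_space)

lemma prob_space_coins: "prob_space coins"
  unfolding coins_def by (rule prob_space.prob_space_stream_space) (rule measure_pmf.prob_space_axioms)

text \<open>Only the set of inputs on which the protocol for a random string \<open>r\<close> is correct matters, so
  finitely many protocols with suitable weights suffice.\<close>

lemma finite_shared_randomness:
  fixes P :: "bool stream \<Rightarrow> ('x, 'y) protocol"
  assumes fin: "finite X" "finite Y" and cost: "\<And>r. cost (P r) \<le> c"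
    and meas: "\<And>x y. x \<in> X \<Longrightarrow> y \<in> Y \<Longrightarrow> {r. run (P r) x y = F x y} \<in> sets coins"
    and prob: "\<And>x y. x \<in> X \<Longrightarrow> y \<in> Y \<Longrightarrow> measure coins {r. run (P r) x y = F x y} \<ge> q"
  obtains N :: nat and p T where "\<And>g. g < N \<Longrightarrow> (0 :: real) \<le> p g" "(\<Sum>g<N. p g) = 1" "\<And>g. cost (T g) \<le> c"
    "\<And>x y. x \<in> X \<Longrightarrow> y \<in> Y \<Longrightarrow> q \<le> (\<Sum>g<N. if run (T g) x y = F x y then p g else 0)"
proof -
  interpret prob_space coins by (rule prob_space_coins)
  let ?I = "X \<times> Y"
  define C where "C = (\<lambda>r. {p \<in> ?I. run (P r) (fst p) (snd p) = F (fst p) (snd p)})"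
  define E where "E = (\<lambda>S. {r. C r = S})"
  define p where "p = (\<lambda>S. measure coins (E S))"
  define T where "T = (\<lambda>S. P (SOME r. C r = S))"
  have finI: "finite ?I" using fin by simp
  have ev: "E S \<in> sets coins" if S: "S \<in> Pow ?I" for S
  proof -
    have "{r \<in> space coins. \<forall>i\<in>?I. (run (P r) (fst i) (snd i) = F (fst i) (snd i)) = (i \<in> S)} \<in> sets coins"
    proof (rule sets.sets_Collect_finite_All[OF _ finI])
      fix i assume i: "i \<in> ?I"
      then have m: "{r \<in> space coins. run (P r) (fst i) (snd i) = F (fst i) (snd i)} \<in> sets coins"
        using meas by auto
      show "{r \<in> space coins. (run (P r) (fst i) (snd i) = F (fst i) (snd i)) = (i \<in> S)} \<in> sets coins"
        using m sets.sets_Collect_neg[OF m] by (cases "i \<in> S") simp_all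
    qed
    moreover have "{r \<in> space coins. \<forall>i\<in>?I. (run (P r) (fst i) (snd i) = F (fst i) (snd i)) = (i \<in> S)} = E S"
    proof -
      have "(\<forall>i\<in>?I. B i = (i \<in> S)) = ({i \<in> ?I. B i} = S)" for B using S by blast
      then show ?thesis unfolding E_def C_def by (simp only: space_coins UNIV_I simp_thms)
    qed
    ultimately show ?thesis by simp
  qed
  have disj: "disjoint_family_on E \<S>" for \<S> by (auto simp: disjoint_family_on_def E_def)
  have union: "measure coins (\<Union>S\<in>\<S>. E S) = (\<Sum>S\<in>\<S>. p S)" if "\<S> \<subseteq> Pow ?I" for \<S>
    unfolding p_def
  proof (rule finite_measure_finite_Union[OF _ _ disj])
    show "finite \<S>" using that finI finite_subset finite_Pow_iff by metis
    show "E ` \<S> \<subseteq> sets coins" using ev that by auto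
  qed
  have mem: "r \<in> (\<Union>S\<in>\<S>. E S) \<longleftrightarrow> C r \<in> \<S>" for r \<S> unfolding E_def by simp
  have CI: "C r \<in> Pow ?I" for r unfolding C_def by (rule PowI) (rule Collect_restrict)
  have total: "(\<Sum>S\<in>Pow ?I. p S) = 1"
  proof -
    have "(\<Union>S\<in>Pow ?I. E S) = space coins" unfolding set_eq_iff mem using CI by simp
    then show ?thesis using union[OF subset_refl] prob_space by simp
  qed
  have good: "q \<le> (\<Sum>S\<in>Pow ?I. if run (T S) x y = F x y then p S else 0)" if xy: "x \<in> X" "y \<in> Y" for x y
  proof -
    let ?\<S> = "{S \<in> Pow ?I. (x, y) \<in> S}"
    have xyC: "(x, y) \<in> C r \<longleftrightarrow> run (P r) x y = F x y" for r using xy by (simp add: C_def)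
    then have "(\<Union>S\<in>?\<S>. E S) = {r. run (P r) x y = F x y}"
      unfolding set_eq_iff mem using CI by simp
    then have "q \<le> (\<Sum>S\<in>?\<S>. p S)" using union[of ?\<S>, OF Collect_restrict] prob[OF xy] by simp
    also have "\<dots> = (\<Sum>S\<in>Pow ?I. if (x, y) \<in> S then p S else 0)"
      using finI by (intro sum.inter_filter) simp
    also have "\<dots> \<le> (\<Sum>S\<in>Pow ?I. if run (T S) x y = F x y then p S else 0)"
    proof (rule sum_mono)
      fix S assume "S \<in> Pow ?I"
      have p0: "p S \<ge> 0" by (simp add: p_def)
      show "(if (x, y) \<in> S then p S else 0) \<le> (if run (T S) x y = F x y then p S else 0)"
      proof (cases "(x, y) \<in> S \<and> run (T S) x y \<noteq> F x y")
        case True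
        \<comment> \<open>A set \<open>S\<close> that no random string realizes has an arbitrary
          representative \<open>T S\<close>, but its weight is 0.\<close>
        have "E S = {}"
        proof (rule ccontr)
          assume "E S \<noteq> {}"
          then have "C (SOME r. C r = S) = S" unfolding E_def using someI_ex[of "\<lambda>r. C r = S"] by blast
          then have "run (T S) x y = F x y" using True xyC[of "SOME r. C r = S"] unfolding T_def by simp
          then show False using True by simp
        qed
        then show ?thesis using True by (simp add: p_def)
      qed (use p0 in auto)
    qed
    finally show ?thesis .
  qed
  have "finite (Pow ?I)" using finI by simp
  then obtain h where h: "bij_betw h {..<card (Pow ?I)} (Pow ?I)"
    using ex_bij_betw_nat_finite by (metis lessThan_atLeast0)
  show thesis
  proof (rule that[of "card (Pow ?I)" "\<lambda>g. p (h g)" "\<lambda>g. T (h g)"])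
    show "0 \<le> p (h g)" for g by (simp add: p_def)
    show "(\<Sum>g<card (Pow ?I). p (h g)) = 1"
      using sum.reindex_bij_betw[OF h, of p] total by simp
    show "cost (T (h g)) \<le> c" for g by (simp add: T_def cost)
    show "q \<le> (\<Sum>g<card (Pow ?I). if run (T (h g)) x y = F x y then p (h g) else 0)"
      if "x \<in> X" "y \<in> Y" for x y
      using sum.reindex_bij_betw[OF h, of "\<lambda>S. if run (T S) x y = F x y then p S else 0"] good[OF that] by simp
  qed
qed

text \<open>The value \<open>False\<close> at nodes where Alice does not speak is a filler that
  \<open>descend\<close> does not read; likewise for \<open>bob_bit\<close>.\<close>

definition alice_bit :: "'x \<Rightarrow> ('x, 'y) protocol \<Rightarrow> bool" where
  "alice_bit x T = (case T of Alice_Sends g P Q \<Rightarrow> g x | _ \<Rightarrow> False)"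

definition bob_bit :: "'y \<Rightarrow> ('x, 'y) protocol \<Rightarrow> bool" where
  "bob_bit y T = (case T of Bob_Sends h P Q \<Rightarrow> h y | _ \<Rightarrow> False)"

definition bob_turn :: "('x, 'y) protocol \<Rightarrow> bool" where
  "bob_turn T = (case T of Bob_Sends h P Q \<Rightarrow> True | _ \<Rightarrow> False)"

text \<open>A leaf is its own child, so protocol trees of different depths can be driven for the
  same number of steps.\<close>

definition descend :: "('x, 'y) protocol \<Rightarrow> bool \<Rightarrow> bool \<Rightarrow> ('x, 'y) protocol" where
  "descend T a b = (case T of Output v \<Rightarrow> T | Alice_Sends g P Q \<Rightarrow> if a then P else Q
     | Bob_Sends h P Q \<Rightarrow> if b then P else Q)"

lemma run_descend: "run (descend T (alice_bit x T) (bob_bit y T)) x y = run T x y"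
  by (cases T) (auto simp: descend_def alice_bit_def bob_bit_def)

lemma cost_descend: "cost (descend T a b) \<le> cost T - 1"
  by (cases T) (auto simp: descend_def)

lemma descend_irrelevant:
  "bob_turn T \<Longrightarrow> descend T a b = descend T a' b"
  "\<not> bob_turn T \<Longrightarrow> descend T a b = descend T a b'"
  by (cases T; simp add: descend_def bob_turn_def)+

text \<open>The speaker of a classical protocol may depend on the transcript, while the order of the
  qubits is fixed. With superdense coding a qubit in each direction transmits two bits in each
  direction, which is enough for two levels of any protocol tree: if Bob is to speak first, Alice
  sends her bits for both of his answers.\<close>

definition pair_code :: "bool \<Rightarrow> bool \<Rightarrow> nat" where
  "pair_code a b = 2 * of_bool a + of_bool b"

definition first_bit :: "nat \<Rightarrow> bool" where "first_bit m = (m div 2 = 1)"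
definition second_bit :: "nat \<Rightarrow> bool" where "second_bit m = odd m"

lemma pair_code [simp]:
  "pair_code a b < 4" "first_bit (pair_code a b) = a" "second_bit (pair_code a b) = b"
  by (auto simp: pair_code_def first_bit_def second_bit_def)

text \<open>In the first branch the first argument \<open>False\<close> of \<open>descend\<close> is
  a filler and the second one runs through Bob's two answers. In the second branch the final
  \<open>False\<close> is the filler.\<close>

definition alice_message :: "'x \<Rightarrow> ('x, 'y) protocol \<Rightarrow> nat" where
  "alice_message x T =
     (if bob_turn T then pair_code (alice_bit x (descend T False True)) (alice_bit x (descend T False False))
      else pair_code (alice_bit x T) (alice_bit x (descend T (alice_bit x T) False)))"

definition bob_message :: "'y \<Rightarrow> ('x, 'y) protocol \<Rightarrow> nat \<Rightarrow> nat" where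
  "bob_message y T m = pair_code (bob_bit y T) (bob_bit y (descend T (first_bit m) (bob_bit y T)))"

text \<open>If Bob spoke at the first level, his answer \<open>first_bit l\<close> selects which of
  Alice's two bits applies at the second level.\<close>

definition descend2 :: "('x, 'y) protocol \<Rightarrow> nat \<Rightarrow> nat \<Rightarrow> ('x, 'y) protocol" where
  "descend2 T m l = descend (descend T (first_bit m) (first_bit l))
     (if bob_turn T \<and> first_bit l then first_bit m else second_bit m) (second_bit l)"

lemma message_less [simp]: "alice_message x T < 4" "bob_message y T m < 4"
  by (simp_all add: alice_message_def bob_message_def)

lemma descend2_messages:
  assumes "m = alice_message x T" "l = bob_message y T m"
  shows "run (descend2 T m l) x y = run T x y" "cost (descend2 T m l) \<le> cost T - 2"
proof -
  let ?T = "descend T (alice_bit x T) (bob_bit y T)"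
  have "descend2 T m l = descend ?T (alice_bit x ?T) (bob_bit y ?T)"
  proof (cases "bob_turn T")
    case True
    have d: "descend T a b = descend T False b" for a b by (rule descend_irrelevant(1)[OF True])
    show ?thesis
      using True unfolding descend2_def assms bob_message_def alice_message_def
      by (cases "bob_bit y T") (simp_all add: d[of "alice_bit x (descend T False True)"] d[of "alice_bit x T"])
  next
    case False
    have d: "descend T a b = descend T a False" for a b by (rule descend_irrelevant(2)[OF False])
    show ?thesis
      using False unfolding descend2_def assms bob_message_def alice_message_def
      by (simp add: d[of _ "bob_bit y T"])
  qed
  then show "run (descend2 T m l) x y = run T x y" "cost (descend2 T m l) \<le> cost T - 2"
    using run_descend[of ?T x y] run_descend[of T x y] cost_descend[of ?T "alice_bit x ?T" "bob_bit y ?T"]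
      cost_descend[of T "alice_bit x T" "bob_bit y T"] by simp_all
qed

section \<open>Superdense coding\<close>

text \<open>The Pauli matrices \<open>1\<close>, \<open>Z\<close>, \<open>X\<close>, \<open>XZ\<close>.\<close>

definition pauli :: "nat \<Rightarrow> nat \<Rightarrow> nat \<Rightarrow> complex" where
  "pauli m q e = (if q = (e + m div 2) mod 2 then (- 1) ^ (m mod 2 * e) else 0)"

lemma less_4_cases: "(m :: nat) < 4 \<Longrightarrow> m = 0 \<or> m = 1 \<or> m = 2 \<or> m = 3"
  by auto

lemma less_2_cases': "(m :: nat) < 2 \<Longrightarrow> m = 0 \<or> m = 1"
  by auto

lemma sum_less_2: "(\<Sum>q<2. f q) = f 0 + f (1 :: nat)"
  by (simp add: numeral_2_eq_2)

lemma pauli_columns: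
  assumes "m < 4" "e < 2" "e' < 2"
  shows "(\<Sum>q<2. pauli m q e * pauli m q e') = (if e = e' then 1 else 0)"
  using less_4_cases[OF assms(1)] less_2_cases'[OF assms(2)] less_2_cases'[OF assms(3)]
  unfolding sum_less_2 by (elim disjE) (simp_all add: pauli_def)

text \<open>Orthogonality of the Pauli matrices under the trace inner product, which makes the four
  Bell states distinguishable.\<close>

lemma pauli_trace:
  assumes "m < 4" "m' < 4"
  shows "(\<Sum>q<2. \<Sum>e<2. pauli m q e * pauli m' q e) = (if m = m' then 2 else 0)"
  using less_4_cases[OF assms(1)] less_4_cases[OF assms(2)]
  unfolding sum_less_2 by (elim disjE) (simp_all add: pauli_def)

lemma cnj_pauli [simp]: "cnj (pauli m q e) = pauli m q e"
  by (simp add: pauli_def)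

text \<open>A Pauli matrix controlled by Alice's record. Columns split into the record
  \<open>j div 2\<close> and the EPR half \<open>j mod 2\<close>; rows split into the qubit
  \<open>i div a\<close> and the record \<open>i mod a\<close>, the order required by
  \<open>send_qubit\<close>.\<close>

definition encoder :: "nat \<Rightarrow> (nat \<Rightarrow> nat) \<Rightarrow> complex mat" where
  "encoder a \<mu> = Matrix.mat (2 * a) (2 * a)
     (\<lambda>(i, j). if i mod a = j div 2 then pauli (\<mu> (j div 2)) (i div a) (j mod 2) else 0)"

text \<open>The change to the Bell basis. Columns consist of the received qubit, Bob's record and
  his EPR half \<open>j mod 2\<close>; rows carry the message \<open>i div b\<close> in front of the
  record.\<close>

definition decoder :: "nat \<Rightarrow> complex mat" where
  "decoder b = Matrix.mat (4 * b) (4 * b)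
     (\<lambda>(i, j). if i mod b = j mod (2 * b) div 2 then pauli (i div b) (j div (2 * b)) (j mod 2) / sqrt 2 else 0)"

lemma sum_encode:
  fixes f :: "nat \<Rightarrow> 'a :: comm_monoid_add"
  shows "(\<Sum>i<n * k. f i) = (\<Sum>q<n. \<Sum>s<k. f (q * k + s))"
proof -
  have "(\<Sum>q<n. \<Sum>s<k. f (q * k + s)) = (\<Sum>p<n * k. f (p div k * k + p mod k))"
    by (rule sum_div_mod[symmetric])
  then show ?thesis by simp
qed

lemma is_unitaryI:
  assumes "U \<in> carrier_mat d d" "adj U * U = 1\<^sub>m d"
  shows "is_unitary d U"
  using mat_mult_left_right_inverse[OF adj_carrier[OF assms(1)] assms(1,2)] assms
  by (simp add: is_unitary_def mat_adjoint_eq_adj)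

lemma unitary_encoder:
  assumes \<mu>: "\<And>s. s < a \<Longrightarrow> \<mu> s < 4"
  shows "is_unitary (2 * a) (encoder a \<mu>)"
proof (rule is_unitaryI)
  let ?U = "encoder a \<mu>"
  show U: "?U \<in> carrier_mat (2 * a) (2 * a)" by (simp add: encoder_def)
  show "adj ?U * ?U = 1\<^sub>m (2 * a)"
  proof (rule eq_matI)
    fix i j assume "i < dim_row (1\<^sub>m (2 * a) :: complex mat)" "j < dim_col (1\<^sub>m (2 * a) :: complex mat)"
    then have ij: "i < 2 * a" "j < 2 * a" by auto
    then have d: "i div 2 < a" "j div 2 < a" by auto
    have "(adj ?U * ?U) $$ (i, j) = (\<Sum>l<2 * a. cnj (?U $$ (l, i)) * ?U $$ (l, j))"
      using ij by (subst index_mult_mat_sum[OF adj_carrier[OF U] U]) (simp_all add: index_adj[OF U])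
    also have "\<dots> = (\<Sum>q<2. \<Sum>s<a. cnj (?U $$ (q * a + s, i)) * ?U $$ (q * a + s, j))"
      by (rule sum_encode)
    also have "\<dots> = (\<Sum>q<2. \<Sum>s<a. if s = i div 2 then
        (if i div 2 = j div 2 then pauli (\<mu> (i div 2)) q (i mod 2) * pauli (\<mu> (i div 2)) q (j mod 2) else 0) else 0)"
    proof (intro sum.cong refl)
      fix q s :: nat assume "q \<in> {..<2}" "s \<in> {..<a}"
      then have "q * a + s < 2 * a" "s < a" using half_index_less[of q s a] by auto
      then show "cnj (?U $$ (q * a + s, i)) * ?U $$ (q * a + s, j) = (if s = i div 2 then
        (if i div 2 = j div 2 then pauli (\<mu> (i div 2)) q (i mod 2) * pauli (\<mu> (i div 2)) q (j mod 2) else 0) else 0)"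
        using ij by (auto simp: encoder_def)
    qed
    also have "\<dots> = (\<Sum>q<2. if i div 2 = j div 2 then pauli (\<mu> (i div 2)) q (i mod 2) * pauli (\<mu> (i div 2)) q (j mod 2) else 0)"
      using d by simp
    also have "\<dots> = (if i div 2 = j div 2 then if i mod 2 = j mod 2 then 1 else 0 else 0)"
      using pauli_columns[OF \<mu>[OF d(1)], of "i mod 2" "j mod 2"] by (cases "i div 2 = j div 2") simp_all
    also have "\<dots> = (if i = j then 1 else 0)"
      by (metis div_mult_mod_eq)
    finally show "(adj ?U * ?U) $$ (i, j) = 1\<^sub>m (2 * a) $$ (i, j)" using ij by simp
  qed (auto simp: encoder_def)
qed

lemma decoder_entry:
  assumes "m < 4" "s < b" "q < 2" "s' < b" "e < 2"
  shows "decoder b $$ (m * b + s, q * (2 * b) + (s' * 2 + e)) = (if s' = s then pauli m q e / sqrt 2 else 0)"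
proof -
  have "m * b + s < Suc m * b" using assms by simp
  also have "\<dots> \<le> 4 * b" using assms by (intro mult_le_mono1) simp
  finally have i: "m * b + s < 4 * b" .
  have r: "s' * 2 + e < 2 * b" using assms by simp
  then have j: "q * (2 * b) + (s' * 2 + e) < 4 * b" using half_index_less[OF assms(3) r] by simp
  have "(q * (2 * b) + (s' * 2 + e)) mod (2 * b) = s' * 2 + e" "(q * (2 * b) + (s' * 2 + e)) div (2 * b) = q"
    using r by auto
  moreover have "(s' * 2 + e) div 2 = s'" using assms by auto
  moreover have "(q * (2 * b) + (s' * 2 + e)) mod 2 = e"
  proof -
    have "q * (2 * b) + (s' * 2 + e) = (q * b + s') * 2 + e" by (simp add: algebra_simps)
    moreover have "(k * 2 + e) mod 2 = e" for k using assms by simp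
    ultimately show ?thesis by (simp only:)
  qed
  ultimately show ?thesis using i j assms by (cases "s' = s") (simp_all add: decoder_def)
qed

lemma decoder_row_sum:
  fixes g :: "nat \<Rightarrow> complex"
  assumes b: "m < 4" "s < b"
  shows "(\<Sum>l<4 * b. decoder b $$ (m * b + s, l) * g l)
    = (\<Sum>q<2. \<Sum>e<2. pauli m q e / sqrt 2 * g (q * (2 * b) + (s * 2 + e)))"
proof -
  have i: "m * b + s < 4 * b" "(m * b + s) mod b = s" "(m * b + s) div b = m"
  proof -
    have "m * b + s < Suc m * b" using b by simp
    also have "\<dots> \<le> 4 * b" using b by (intro mult_le_mono1) simp
    finally show "m * b + s < 4 * b" .
  qed (use b in auto)
  have "(\<Sum>l<4 * b. decoder b $$ (m * b + s, l) * g l)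
    = (\<Sum>l<2 * (2 * b). decoder b $$ (m * b + s, l) * g l)" by simp
  also have "\<dots> = (\<Sum>q<2. \<Sum>r<2 * b. decoder b $$ (m * b + s, q * (2 * b) + r) * g (q * (2 * b) + r))"
    by (rule sum_encode)
  also have "\<dots> = (\<Sum>q<2. \<Sum>s'<b. \<Sum>e<2. decoder b $$ (m * b + s, q * (2 * b) + (s' * 2 + e)) * g (q * (2 * b) + (s' * 2 + e)))"
    unfolding mult.commute[of 2 b] sum_encode ..
  also have "\<dots> = (\<Sum>q<2. \<Sum>s'<b. if s' = s then (\<Sum>e<2. pauli m q e / sqrt 2 * g (q * (2 * b) + (s * 2 + e))) else 0)"
  proof (intro sum.cong refl)
    fix q s' :: nat assume "q \<in> {..<2}" "s' \<in> {..<b}"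
    then have q: "q < 2" "s' < b" by auto
    have e: "decoder b $$ (m * b + s, q * (2 * b) + (s' * 2 + e)) = (if s' = s then pauli m q e / sqrt 2 else 0)"
      if "e < 2" for e
      by (rule decoder_entry[OF b q that])
    show "(\<Sum>e<2. decoder b $$ (m * b + s, q * (2 * b) + (s' * 2 + e)) * g (q * (2 * b) + (s' * 2 + e)))
        = (if s' = s then (\<Sum>e<2. pauli m q e / sqrt 2 * g (q * (2 * b) + (s * 2 + e))) else 0)"
      using e by (cases "s' = s") simp_all
  qed
  also have "\<dots> = (\<Sum>q<2. \<Sum>e<2. pauli m q e / sqrt 2 * g (q * (2 * b) + (s * 2 + e)))"
    using b by simp
  finally show ?thesis .
qed

lemma sqrt_2_mult: "complex_of_real (sqrt 2) * complex_of_real (sqrt 2) = 2"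
  by (simp flip: of_real_mult)

lemma unitary_decoder: "is_unitary (4 * b) (decoder b)"
proof -
  let ?V = "decoder b"
  have V: "?V \<in> carrier_mat (4 * b) (4 * b)" by (simp add: decoder_def)
  have "?V * adj ?V = 1\<^sub>m (4 * b)"
  proof (rule eq_matI)
    fix i j assume "i < dim_row (1\<^sub>m (4 * b) :: complex mat)" "j < dim_col (1\<^sub>m (4 * b) :: complex mat)"
    then have ij: "i < 4 * b" "j < 4 * b" by auto
    then have b: "b > 0" by auto
    define m s m' s' where "m = i div b" and "s = i mod b" and "m' = j div b" and "s' = j mod b"
    have ms: "m < 4" "s < b" "m' < 4" "s' < b"
      using ij b by (auto simp: m_def s_def m'_def s'_def less_mult_imp_div_less)
    have i: "i = m * b + s" and j: "j = m' * b + s'" by (simp_all add: m_def s_def m'_def s'_def)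
    have "(?V * adj ?V) $$ (i, j) = (\<Sum>l<4 * b. ?V $$ (i, l) * cnj (?V $$ (j, l)))"
      using ij by (subst index_mult_mat_sum[OF V adj_carrier[OF V]]) (simp_all add: index_adj[OF V])
    also have "\<dots> = (\<Sum>q<2. \<Sum>e<2. pauli m q e / sqrt 2 * cnj (?V $$ (j, q * (2 * b) + (s * 2 + e))))"
      unfolding i by (rule decoder_row_sum[OF ms(1,2)])
    also have "\<dots> = (\<Sum>q<2. \<Sum>e<2. if s = s' then pauli m q e * pauli m' q e / 2 else 0)"
      using ms by (intro sum.cong refl)
        (simp add: j decoder_entry sqrt_2_mult times_divide_times_eq)
    also have "\<dots> = (if s = s' then (\<Sum>q<2. \<Sum>e<2. pauli m q e * pauli m' q e) / 2 else 0)"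
      by (cases "s = s'") (simp_all add: sum_divide_distrib)
    also have "\<dots> = (if s = s' \<and> m = m' then 1 else 0)"
      unfolding pauli_trace[OF ms(1,3)] by simp
    also have "(s = s' \<and> m = m') = (i = j)"
      unfolding m_def s_def m'_def s'_def by (metis div_mult_mod_eq)
    finally show "(?V * adj ?V) $$ (i, j) = 1\<^sub>m (4 * b) $$ (i, j)" using ij by simp
  qed (auto simp: decoder_def)
  then have "adj ?V * ?V = 1\<^sub>m (4 * b)"
    using mat_mult_left_right_inverse[OF V adj_carrier[OF V]] by simp
  then show ?thesis by (rule is_unitaryI[OF V])
qed

section \<open>EPR pairs and the transmission of two bits by one qubit\<close>

definition epr :: "complex mat \<Rightarrow> complex mat" where
  "epr \<psi> = Matrix.mat (2 * dim_row \<psi>) (2 * dim_col \<psi>)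
     (\<lambda>(i, j). if i mod 2 = j mod 2 then \<psi> $$ (i div 2, j div 2) / sqrt 2 else 0)"

text \<open>The net effect of superdense coding: a message computed from Alice's record, possibly in
  superposition, is put in front of Bob's record.\<close>

definition transmit :: "(nat \<Rightarrow> nat) \<Rightarrow> complex mat \<Rightarrow> complex mat" where
  "transmit \<mu> \<psi> = Matrix.mat (dim_row \<psi>) (4 * dim_col \<psi>)
     (\<lambda>(i, j). if j div dim_col \<psi> = \<mu> i then \<psi> $$ (i, j mod dim_col \<psi>) else 0)"

lemma epr_carrier [simp]: "\<psi> \<in> carrier_mat a b \<Longrightarrow> epr \<psi> \<in> carrier_mat (2 * a) (2 * b)"
  by (simp add: epr_def)

lemma transmit_carrier [simp]: "\<psi> \<in> carrier_mat a b \<Longrightarrow> transmit \<mu> \<psi> \<in> carrier_mat a (4 * b)"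
  by (simp add: transmit_def)

lemma encoder_epr:
  assumes \<psi>: "\<psi> \<in> carrier_mat a b" and i: "q < 2" "s < a" and j: "j < 2 * b"
  shows "(encoder a \<mu> * epr \<psi>) $$ (q * a + s, j) = pauli (\<mu> s) q (j mod 2) * \<psi> $$ (s, j div 2) / sqrt 2"
proof -
  have i': "q * a + s < 2 * a" by (rule half_index_less[OF i])
  have U: "encoder a \<mu> \<in> carrier_mat (2 * a) (2 * a)" by (simp add: encoder_def)
  have "(encoder a \<mu> * epr \<psi>) $$ (q * a + s, j)
      = (\<Sum>l<2 * a. encoder a \<mu> $$ (q * a + s, l) * epr \<psi> $$ (l, j))"
    by (rule index_mult_mat_sum[OF U epr_carrier[OF \<psi>] i' j])
  also have "\<dots> = (\<Sum>s'<a. \<Sum>e<2. encoder a \<mu> $$ (q * a + s, s' * 2 + e) * epr \<psi> $$ (s' * 2 + e, j))"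
    unfolding mult.commute[of 2 a] by (rule sum_encode)
  also have "\<dots> = (\<Sum>s'<a. if s' = s then
      (\<Sum>e<2. if e = j mod 2 then pauli (\<mu> s) q (j mod 2) * \<psi> $$ (s, j div 2) / sqrt 2 else 0) else 0)"
  proof (rule sum.cong[OF refl])
    fix s' assume s': "s' \<in> {..<a}"
    have "encoder a \<mu> $$ (q * a + s, s' * 2 + e) * epr \<psi> $$ (s' * 2 + e, j)
      = (if s' = s then if e = j mod 2 then pauli (\<mu> s) q (j mod 2) * \<psi> $$ (s, j div 2) / sqrt 2 else 0 else 0)"
      if e: "e < 2" for e
    proof -
      have "s' * 2 + e < 2 * a" "(s' * 2 + e) div 2 = s'" "(s' * 2 + e) mod 2 = e" using s' e by auto
      then show ?thesis using i i' j \<psi> s' by (auto simp: encoder_def epr_def)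
    qed
    then have "(\<Sum>e<2. encoder a \<mu> $$ (q * a + s, s' * 2 + e) * epr \<psi> $$ (s' * 2 + e, j)) = (\<Sum>e<2. if s' = s
      then if e = j mod 2 then pauli (\<mu> s) q (j mod 2) * \<psi> $$ (s, j div 2) / sqrt 2 else 0 else 0)"
      by (intro sum.cong refl) (simp only: lessThan_iff)
    then show "(\<Sum>e<2. encoder a \<mu> $$ (q * a + s, s' * 2 + e) * epr \<psi> $$ (s' * 2 + e, j)) = (if s' = s then
      (\<Sum>e<2. if e = j mod 2 then pauli (\<mu> s) q (j mod 2) * \<psi> $$ (s, j div 2) / sqrt 2 else 0) else 0)"
      by (cases "s' = s") simp_all
  qed
  also have "\<dots> = pauli (\<mu> s) q (j mod 2) * \<psi> $$ (s, j div 2) / sqrt 2"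
    using i by simp
  finally show ?thesis .
qed

lemma send_qubit_index:
  "\<psi> \<in> carrier_mat (2 * m) b \<Longrightarrow> i < m \<Longrightarrow> j < 2 * b \<Longrightarrow>
    send_qubit \<psi> $$ (i, j) = \<psi> $$ ((j div b) * m + i, j mod b)"
  by (simp add: send_qubit_def Let_def)

text \<open>The amplitude for decoding \<open>m\<close> is that of \<open>\<psi>\<close> times half
  the trace inner product of the Pauli matrices \<open>m\<close> and \<open>\<mu> i\<close>, that
  is, times 1 or 0. The half collects the factors \<open>1 / sqrt 2\<close> of the EPR pair and of
  the decoder.\<close>

lemma superdense_coding:
  assumes \<psi>: "\<psi> \<in> carrier_mat a b" and \<mu>: "\<And>s. s < a \<Longrightarrow> \<mu> s < 4"
  shows "send_qubit (encoder a \<mu> * epr \<psi>) * transpose_mat (decoder b) = transmit \<mu> \<psi>"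
proof (rule eq_matI)
  have U: "encoder a \<mu> \<in> carrier_mat (2 * a) (2 * a)" by (simp add: encoder_def)
  have V: "transpose_mat (decoder b) \<in> carrier_mat (4 * b) (4 * b)" by (simp add: decoder_def)
  have U\<psi>: "encoder a \<mu> * epr \<psi> \<in> carrier_mat (2 * a) (2 * b)" by (rule mult_carrier_mat[OF U epr_carrier[OF \<psi>]])
  have S: "send_qubit (encoder a \<mu> * epr \<psi>) \<in> carrier_mat a (4 * b)"
    using send_qubit_carrier[OF U\<psi>] by simp
  show "dim_row (send_qubit (encoder a \<mu> * epr \<psi>) * transpose_mat (decoder b)) = dim_row (transmit \<mu> \<psi>)"
    "dim_col (send_qubit (encoder a \<mu> * epr \<psi>) * transpose_mat (decoder b)) = dim_col (transmit \<mu> \<psi>)"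
    using S V \<psi> by (auto simp: transmit_def)
  fix i j assume "i < dim_row (transmit \<mu> \<psi>)" "j < dim_col (transmit \<mu> \<psi>)"
  then have ij: "i < a" "j < 4 * b" using \<psi> by (auto simp: transmit_def)
  then have b: "b > 0" by auto
  define m s where "m = j div b" and "s = j mod b"
  have ms: "m < 4" "s < b" using ij b by (auto simp: m_def s_def less_mult_imp_div_less)
  have j: "j = m * b + s" by (simp add: m_def s_def)
  have dd: "dim_row (decoder b) = 4 * b" "dim_col (decoder b) = 4 * b" by (simp_all add: decoder_def)
  have send: "send_qubit (encoder a \<mu> * epr \<psi>) $$ (i, q * (2 * b) + (s * 2 + e))
      = pauli (\<mu> i) q e * \<psi> $$ (i, s) / sqrt 2" if "q < 2" "e < 2" for q e
  proof -
    have r: "s * 2 + e < 2 * b" using ms that by simp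
    have J: "q * (2 * b) + (s * 2 + e) < 2 * (2 * b)" by (rule half_index_less[OF that(1) r])
    have d: "(q * (2 * b) + (s * 2 + e)) div (2 * b) = q" "(q * (2 * b) + (s * 2 + e)) mod (2 * b) = s * 2 + e"
      using r by auto
    have "send_qubit (encoder a \<mu> * epr \<psi>) $$ (i, q * (2 * b) + (s * 2 + e))
      = (encoder a \<mu> * epr \<psi>) $$ (q * a + i, s * 2 + e)"
      using send_qubit_index[OF U\<psi> ij(1), of "q * (2 * b) + (s * 2 + e)"] J unfolding d by simp
    also have "\<dots> = pauli (\<mu> i) q e * \<psi> $$ (i, s) / sqrt 2"
      using encoder_epr[OF \<psi> that(1) ij(1) r] that by simp
    finally show ?thesis .
  qed
  have "(send_qubit (encoder a \<mu> * epr \<psi>) * transpose_mat (decoder b)) $$ (i, j)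
      = (\<Sum>l<4 * b. send_qubit (encoder a \<mu> * epr \<psi>) $$ (i, l) * transpose_mat (decoder b) $$ (l, j))"
    by (rule index_mult_mat_sum[OF S V ij])
  also have "\<dots> = (\<Sum>l<4 * b. decoder b $$ (m * b + s, l) * send_qubit (encoder a \<mu> * epr \<psi>) $$ (i, l))"
    unfolding j[symmetric] by (rule sum.cong[OF refl]) (use ij in \<open>simp add: dd mult.commute\<close>)
  also have "\<dots> = (\<Sum>q<2. \<Sum>e<2. pauli m q e / sqrt 2 * (send_qubit (encoder a \<mu> * epr \<psi>) $$ (i, q * (2 * b) + (s * 2 + e))))"
    by (rule decoder_row_sum[OF ms])
  also have "\<dots> = (\<Sum>q<2. \<Sum>e<2. pauli m q e * pauli (\<mu> i) q e * (\<psi> $$ (i, s) / 2))"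
    by (intro sum.cong refl) (simp add: send times_divide_times_eq sqrt_2_mult)
  also have "\<dots> = (\<Sum>q<2. \<Sum>e<2. pauli m q e * pauli (\<mu> i) q e) * (\<psi> $$ (i, s) / 2)"
    by (simp only: sum_distrib_right)
  also have "\<dots> = (if m = \<mu> i then \<psi> $$ (i, s) else 0)"
    using pauli_trace[OF ms(1) \<mu>[OF ij(1)]] by simp
  also have "\<dots> = transmit \<mu> \<psi> $$ (i, j)"
    using \<psi> ij by (auto simp: transmit_def m_def s_def)
  finally show "(send_qubit (encoder a \<mu> * epr \<psi>) * transpose_mat (decoder b)) $$ (i, j) = transmit \<mu> \<psi> $$ (i, j)" .
qed

lemma transpose_epr: "transpose_mat (epr \<psi>) = epr (transpose_mat \<psi>)"
  by (rule eq_matI) (auto simp: epr_def)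

text \<open>The remaining EPR pairs occupy the lowest digits of both registers and are not disturbed
  by a transmission. So all pairs can be part of the initial state and be consumed one by one, the
  outermost first.\<close>

lemma transmit_epr:
  assumes \<psi>: "\<psi> \<in> carrier_mat a b"
  shows "transmit (\<lambda>i. \<mu> (i div 2)) (epr \<psi>) = epr (transmit \<mu> \<psi>)"
proof (rule eq_matI)
  fix i j assume "i < dim_row (epr (transmit \<mu> \<psi>))" "j < dim_col (epr (transmit \<mu> \<psi>))"
  then have ij: "i < 2 * a" "j < 2 * (4 * b)" using \<psi> by (auto simp: epr_def transmit_def)
  then have b: "b > 0" by auto
  have "j mod (2 * b) < 2 * b" using b by simp
  moreover have "j div (2 * b) = j div 2 div b" by (rule div_mult2_eq)
  moreover have "j mod (2 * b) div 2 = j div 2 mod b" by (simp add: mod_mult2_eq)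
  moreover have "j mod (2 * b) mod 2 = j mod 2" by (simp add: mod_mod_cancel)
  ultimately show "transmit (\<lambda>i. \<mu> (i div 2)) (epr \<psi>) $$ (i, j) = epr (transmit \<mu> \<psi>) $$ (i, j)"
    using ij \<psi> by (auto simp: epr_def transmit_def)
qed (use \<psi> in \<open>auto simp: epr_def transmit_def\<close>)

section \<open>Simulation of randomized protocols\<close>

text \<open>Shared randomness as entanglement: the seed \<open>g\<close> has amplitude
  \<open>sqrt (p g)\<close> and is recorded by Alice as \<open>\<phi> g\<close> and by Bob as
  \<open>\<phi>' g\<close>.\<close>

definition shared_state :: "nat \<Rightarrow> (nat \<Rightarrow> real) \<Rightarrow> nat \<Rightarrow> nat \<Rightarrow> (nat \<Rightarrow> nat) \<Rightarrow> (nat \<Rightarrow> nat) \<Rightarrow> complex mat" where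
  "shared_state N p a b \<phi> \<phi>' = Matrix.mat a b
     (\<lambda>(i, j). \<Sum>g<N. if i = \<phi> g \<and> j = \<phi>' g then complex_of_real (sqrt (p g)) else 0)"

lemma shared_state_carrier [simp]: "shared_state N p a b \<phi> \<phi>' \<in> carrier_mat a b"
  by (simp add: shared_state_def)

lemma transpose_shared_state: "transpose_mat (shared_state N p a b \<phi> \<phi>') = shared_state N p b a \<phi>' \<phi>"
  by (rule eq_matI) (auto simp: shared_state_def conj_commute)

text \<open>A transmission only changes Bob's record of each seed, where the message becomes the
  leading digit. So the state keeps its form throughout the simulation.\<close>

lemma transmit_shared_state:
  assumes b: "\<And>g. g < N \<Longrightarrow> \<phi>' g < b"
  shows "transmit \<mu> (shared_state N p a b \<phi> \<phi>') = shared_state N p a (4 * b) \<phi> (\<lambda>g. \<mu> (\<phi> g) * b + \<phi>' g)"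
proof (rule eq_matI)
  fix i j assume "i < dim_row (shared_state N p a (4 * b) \<phi> (\<lambda>g. \<mu> (\<phi> g) * b + \<phi>' g))"
    "j < dim_col (shared_state N p a (4 * b) \<phi> (\<lambda>g. \<mu> (\<phi> g) * b + \<phi>' g))"
  then have ij: "i < a" "j < 4 * b" by (auto simp: shared_state_def)
  then have b0: "b > 0" by auto
  have eq: "(j div b = \<mu> i \<and> i = \<phi> g \<and> j mod b = \<phi>' g) = (i = \<phi> g \<and> j = \<mu> (\<phi> g) * b + \<phi>' g)" if "g < N" for g
  proof
    assume l: "j div b = \<mu> i \<and> i = \<phi> g \<and> j mod b = \<phi>' g"
    then have "j = \<mu> (\<phi> g) * b + \<phi>' g" by (metis div_mult_mod_eq)
    then show "i = \<phi> g \<and> j = \<mu> (\<phi> g) * b + \<phi>' g" using l by blast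
  qed (use b[OF that] in auto)
  have "transmit \<mu> (shared_state N p a b \<phi> \<phi>') $$ (i, j)
      = (if j div b = \<mu> i then \<Sum>g<N. if i = \<phi> g \<and> j mod b = \<phi>' g then complex_of_real (sqrt (p g)) else 0 else 0)"
    using ij b0 by (simp add: transmit_def shared_state_def)
  also have "\<dots> = (\<Sum>g<N. if j div b = \<mu> i \<and> i = \<phi> g \<and> j mod b = \<phi>' g then complex_of_real (sqrt (p g)) else 0)"
    by (cases "j div b = \<mu> i") simp_all
  also have "\<dots> = (\<Sum>g<N. if i = \<phi> g \<and> j = \<mu> (\<phi> g) * b + \<phi>' g then complex_of_real (sqrt (p g)) else 0)"
    by (rule sum.cong[OF refl]) (simp only: eq lessThan_iff)
  also have "\<dots> = shared_state N p a (4 * b) \<phi> (\<lambda>g. \<mu> (\<phi> g) * b + \<phi>' g) $$ (i, j)"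
    using ij by (simp add: shared_state_def)
  finally show "transmit \<mu> (shared_state N p a b \<phi> \<phi>') $$ (i, j)
      = shared_state N p a (4 * b) \<phi> (\<lambda>g. \<mu> (\<phi> g) * b + \<phi>' g) $$ (i, j)" .
qed (auto simp: transmit_def shared_state_def)

lemma eprs_carrier: "\<psi> \<in> carrier_mat a b \<Longrightarrow> (epr ^^ k) \<psi> \<in> carrier_mat (2 ^ k * a) (2 ^ k * b)"
  by (induction k) (auto dest: epr_carrier simp: mult.assoc)

lemma transpose_eprs: "transpose_mat ((epr ^^ k) \<psi>) = (epr ^^ k) (transpose_mat \<psi>)"
  by (induction k) (simp_all add: transpose_epr)

lemma transmit_eprs:
  assumes "\<psi> \<in> carrier_mat a b"
  shows "transmit (\<lambda>i. \<mu> (i div 2 ^ k)) ((epr ^^ k) \<psi>) = (epr ^^ k) (transmit \<mu> \<psi>)"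
proof (induction k)
  case (Suc k)
  have "(\<lambda>i. \<mu> (i div 2 ^ Suc k)) = (\<lambda>i. (\<lambda>i. \<mu> (i div 2 ^ k)) (i div 2))"
    by (rule ext) (simp add: div_mult2_eq)
  then have "transmit (\<lambda>i. \<mu> (i div 2 ^ Suc k)) ((epr ^^ Suc k) \<psi>)
      = transmit (\<lambda>i. (\<lambda>i. \<mu> (i div 2 ^ k)) (i div 2)) (epr ((epr ^^ k) \<psi>))" by simp
  also have "\<dots> = epr (transmit (\<lambda>i. \<mu> (i div 2 ^ k)) ((epr ^^ k) \<psi>))"
    by (rule transmit_epr[OF eprs_carrier[OF assms]])
  finally show ?case using Suc by simp
qed simp

definition alice_send :: "nat \<Rightarrow> nat \<Rightarrow> ('x \<Rightarrow> nat \<Rightarrow> nat) \<Rightarrow> ('x, 'y) qstep list" where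
  "alice_send a b \<mu> = [Alice_Unitary (\<lambda>x. encoder a (\<mu> x)), Alice_Qubit, Bob_Unitary (\<lambda>y. decoder b)]"

definition bob_send :: "nat \<Rightarrow> nat \<Rightarrow> ('y \<Rightarrow> nat \<Rightarrow> nat) \<Rightarrow> ('x, 'y) qstep list" where
  "bob_send a b \<nu> = [Bob_Unitary (\<lambda>y. encoder b (\<nu> y)), Bob_Qubit, Alice_Unitary (\<lambda>x. decoder a)]"

lemma alice_send_ok:
  assumes "\<And>x s. \<mu> x s < 4" "qsteps_ok X Y a (4 * b) ss"
  shows "qsteps_ok X Y (2 * a) (2 * b) (alice_send a b \<mu> @ ss)"
  using assms unitary_decoder[of b] by (simp add: alice_send_def unitary_encoder)

lemma bob_send_ok:
  assumes "\<And>y s. \<nu> y s < 4" "qsteps_ok X Y (4 * a) b ss"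
  shows "qsteps_ok X Y (2 * a) (2 * b) (bob_send a b \<nu> @ ss)"
  using assms unitary_decoder[of a] by (simp add: bob_send_def unitary_encoder)

lemma send_qubits [simp]:
  "qubits (alice_send a b \<mu> @ ss) = Suc (qubits ss)" "qubits (bob_send a b \<nu> @ ss) = Suc (qubits ss)"
  by (simp_all add: alice_send_def bob_send_def)

lemma fold_alice_send:
  assumes "\<psi> \<in> carrier_mat a b" "\<And>s. \<mu> x s < 4"
  shows "fold (apply_qstep x y) (alice_send a b \<mu> @ ss) (epr \<psi>) = fold (apply_qstep x y) ss (transmit (\<mu> x) \<psi>)"
  using superdense_coding[OF assms(1), of "\<mu> x"] assms(2) by (simp add: alice_send_def)

lemma fold_bob_send:
  assumes \<psi>: "\<psi> \<in> carrier_mat a b" and \<nu>: "\<And>s. \<nu> y s < 4"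
  shows "fold (apply_qstep x y) (bob_send a b \<nu> @ ss) (epr \<psi>)
    = fold (apply_qstep x y) ss (transpose_mat (transmit (\<nu> y) (transpose_mat \<psi>)))"
proof -
  let ?U = "encoder b (\<nu> y)" and ?t = "transpose_mat \<psi>"
  have U: "?U \<in> carrier_mat (2 * b) (2 * b)" and Ut: "transpose_mat ?U \<in> carrier_mat (2 * b) (2 * b)"
    by (simp_all add: encoder_def)
  have D: "decoder a \<in> carrier_mat (4 * a) (4 * a)" and Dt: "transpose_mat (decoder a) \<in> carrier_mat (4 * a) (4 * a)"
    by (simp_all add: decoder_def)
  have t: "?t \<in> carrier_mat b a" using \<psi> by simp
  have "transpose_mat (epr \<psi> * transpose_mat ?U) = ?U * epr ?t"
    using transpose_mult[OF epr_carrier[OF \<psi>] Ut] by (simp add: transpose_epr)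
  moreover have S: "send_qubit (?U * epr ?t) \<in> carrier_mat b (4 * a)"
    using send_qubit_carrier[OF mult_carrier_mat[OF U epr_carrier[OF t]]] by simp
  moreover have "decoder a * transpose_mat (send_qubit (?U * epr ?t))
      = transpose_mat (send_qubit (?U * epr ?t) * transpose_mat (decoder a))"
    using transpose_mult[OF S Dt] by simp
  ultimately show ?thesis
    using superdense_coding[OF t, of "\<nu> y"] \<nu> by (simp add: bob_send_def)
qed

text \<open>The condition is evaluated at the even member of the pair of \<open>j\<close>, so either
  both members are exchanged or neither. This makes \<open>toggle f\<close> an involution and
  \<open>writer\<close> unitary.\<close>

definition toggle :: "(nat \<Rightarrow> bool) \<Rightarrow> nat \<Rightarrow> nat" where
  "toggle f j = (if f (2 * (j div 2)) then if even j then j + 1 else j - 1 else j)"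

lemma toggle_toggle [simp]: "toggle f (toggle f j) = j"
  by (auto simp: toggle_def elim!: evenE oddE)

lemma toggle_less: "even b \<Longrightarrow> j < b \<Longrightarrow> toggle f j < b"
  by (auto simp: toggle_def elim!: evenE)

lemma toggle_eq_iff: "toggle f i = j \<longleftrightarrow> i = toggle f j"
  by auto

definition writer :: "nat \<Rightarrow> (nat \<Rightarrow> bool) \<Rightarrow> complex mat" where
  "writer b f = Matrix.mat b b (\<lambda>(i, j). if i = toggle f j then 1 else 0)"

lemma unitary_writer:
  assumes "even b"
  shows "is_unitary b (writer b f)"
proof (rule is_unitaryI)
  show W: "writer b f \<in> carrier_mat b b" by (simp add: writer_def)
  show "adj (writer b f) * writer b f = 1\<^sub>m b"
  proof (rule eq_matI)
    fix i j assume "i < dim_row (1\<^sub>m b :: complex mat)" "j < dim_col (1\<^sub>m b :: complex mat)"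
    then have ij: "i < b" "j < b" by auto
    have "(adj (writer b f) * writer b f) $$ (i, j) = (\<Sum>l<b. cnj (writer b f $$ (l, i)) * writer b f $$ (l, j))"
      using ij by (subst index_mult_mat_sum[OF adj_carrier[OF W] W]) (simp_all add: index_adj[OF W])
    also have "\<dots> = (\<Sum>l<b. if l = toggle f i then if i = j then 1 else 0 else 0)"
    proof (rule sum.cong[OF refl])
      fix l assume l: "l \<in> {..<b}"
      have "(toggle f i = toggle f j) = (i = j)" by (metis toggle_toggle)
      then show "cnj (writer b f $$ (l, i)) * writer b f $$ (l, j) = (if l = toggle f i then if i = j then 1 else 0 else 0)"
        using l ij by (auto simp: writer_def)
    qed
    also have "\<dots> = (if i = j then 1 else 0)" using toggle_less[OF assms ij(1)] by simp
    finally show "(adj (writer b f) * writer b f) $$ (i, j) = 1\<^sub>m b $$ (i, j)" using ij by simp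
  qed (auto simp: writer_def)
qed

lemma shared_state_writer:
  assumes "even b"
  shows "shared_state N p a b \<phi> \<phi>' * transpose_mat (writer b f) = shared_state N p a b \<phi> (\<lambda>g. toggle f (\<phi>' g))"
proof (rule eq_matI)
  let ?S = "shared_state N p a b \<phi> \<phi>'" and ?W = "transpose_mat (writer b f)"
  have W: "?W \<in> carrier_mat b b" by (simp add: writer_def)
  fix i j assume "i < dim_row (shared_state N p a b \<phi> (\<lambda>g. toggle f (\<phi>' g)))"
    "j < dim_col (shared_state N p a b \<phi> (\<lambda>g. toggle f (\<phi>' g)))"
  then have ij: "i < a" "j < b" by (auto simp: shared_state_def)
  have "(?S * ?W) $$ (i, j) = (\<Sum>l<b. ?S $$ (i, l) * ?W $$ (l, j))"
    by (rule index_mult_mat_sum[OF shared_state_carrier W ij])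
  also have "\<dots> = (\<Sum>l<b. if l = toggle f j then ?S $$ (i, toggle f j) else 0)"
    by (rule sum.cong[OF refl]) (use ij in \<open>auto simp: writer_def\<close>)
  also have "\<dots> = ?S $$ (i, toggle f j)" using toggle_less[OF assms ij(2)] by simp
  also have "\<dots> = shared_state N p a b \<phi> (\<lambda>g. toggle f (\<phi>' g)) $$ (i, j)"
    using ij toggle_less[OF assms ij(2)] by (simp add: shared_state_def toggle_eq_iff)
  finally show "(?S * ?W) $$ (i, j) = shared_state N p a b \<phi> (\<lambda>g. toggle f (\<phi>' g)) $$ (i, j)" .
qed (auto simp: shared_state_def writer_def)

definition odd_prob :: "complex mat \<Rightarrow> bool \<Rightarrow> real" where
  "odd_prob \<psi> v = (\<Sum>i<dim_row \<psi>. \<Sum>j<dim_col \<psi>. if odd j = v then (cmod (\<psi> $$ (i, j)))\<^sup>2 else 0)"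

lemma sum_single:
  fixes N h :: nat
  assumes "h < N" "\<And>g. g < N \<Longrightarrow> Q g = (g = h)"
  shows "(\<Sum>g<N. if Q g then r g else (0 :: 'a :: comm_monoid_add)) = r h"
proof -
  have "(\<Sum>g<N. if Q g then r g else 0) = (\<Sum>g<N. if g = h then r h else 0)"
    using assms(2) by (intro sum.cong refl) auto
  then show ?thesis using assms(1) by simp
qed

lemma sum_none:
  fixes N :: nat
  assumes "\<And>g. g < N \<Longrightarrow> \<not> Q g"
  shows "(\<Sum>g<N. if Q g then r g else (0 :: 'a :: comm_monoid_add)) = 0"
  using assms by (intro sum.neutral) auto

text \<open>Injectivity of \<open>\<phi>'\<close> excludes interference: at most one seed
  contributes to each entry, and squaring turns \<open>sqrt (p g)\<close> into
  \<open>p g\<close>.\<close>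

lemma odd_prob_shared_state:
  assumes range: "\<And>g. g < N \<Longrightarrow> \<phi> g < a \<and> \<phi>' g < b" and inj: "inj_on \<phi>' {..<N}"
    and p: "\<And>g. g < N \<Longrightarrow> 0 \<le> p g"
  shows "odd_prob (shared_state N p a b \<phi> \<phi>') v = (\<Sum>g<N. if odd (\<phi>' g) = v then p g else 0)"
proof -
  have entry: "(cmod (\<Sum>g<N. if i = \<phi> g \<and> j = \<phi>' g then complex_of_real (sqrt (p g)) else 0))\<^sup>2
      = (\<Sum>g<N. if i = \<phi> g \<and> j = \<phi>' g then p g else 0)" for i j
  proof (cases "\<exists>g<N. i = \<phi> g \<and> j = \<phi>' g")
    case True
    then obtain h where h: "h < N" "i = \<phi> h" "j = \<phi>' h" by blast
    have eq: "(i = \<phi> g \<and> j = \<phi>' g) = (g = h)" if "g < N" for g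
      using h inj_onD[OF inj, of g h] that by auto
    have "(\<Sum>g<N. if i = \<phi> g \<and> j = \<phi>' g then complex_of_real (sqrt (p g)) else 0) = complex_of_real (sqrt (p h))"
      by (rule sum_single[OF h(1) eq])
    moreover have "(\<Sum>g<N. if i = \<phi> g \<and> j = \<phi>' g then p g else 0) = p h"
      by (rule sum_single[OF h(1) eq])
    ultimately show ?thesis using p[OF h(1)] by (simp only: norm_of_real power2_abs real_sqrt_pow2)
  next
    case False
    then have none: "\<not> (i = \<phi> g \<and> j = \<phi>' g)" if "g < N" for g using that by blast
    have "(\<Sum>g<N. if i = \<phi> g \<and> j = \<phi>' g then complex_of_real (sqrt (p g)) else 0) = 0"
      by (rule sum_none[OF none])
    moreover have "(\<Sum>g<N. if i = \<phi> g \<and> j = \<phi>' g then p g else 0) = 0"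
      by (rule sum_none[OF none])
    ultimately show ?thesis by (simp only: norm_zero zero_power2)
  qed
  have "odd_prob (shared_state N p a b \<phi> \<phi>') v
      = (\<Sum>i<a. \<Sum>j<b. \<Sum>g<N. if i = \<phi> g \<and> j = \<phi>' g then if odd (\<phi>' g) = v then p g else 0 else 0)"
    unfolding odd_prob_def
  proof -
    have "(if odd j = v then (cmod (shared_state N p a b \<phi> \<phi>' $$ (i, j)))\<^sup>2 else 0)
      = (\<Sum>g<N. if i = \<phi> g \<and> j = \<phi>' g then if odd (\<phi>' g) = v then p g else 0 else 0)" if "i < a" "j < b" for i j
    proof (cases "odd j = v")
      case True
      then show ?thesis using that by (simp add: shared_state_def entry) (intro sum.cong refl, auto)
    next
      case False
      have "(\<Sum>g<N. if i = \<phi> g \<and> j = \<phi>' g then if odd (\<phi>' g) = v then p g else 0 else 0) = 0"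
        by (rule sum.neutral) (use False in auto)
      then show ?thesis using False by (simp only: if_False)
    qed
    then show "(\<Sum>i<dim_row (shared_state N p a b \<phi> \<phi>'). \<Sum>j<dim_col (shared_state N p a b \<phi> \<phi>').
        if odd j = v then (cmod (shared_state N p a b \<phi> \<phi>' $$ (i, j)))\<^sup>2 else 0)
      = (\<Sum>i<a. \<Sum>j<b. \<Sum>g<N. if i = \<phi> g \<and> j = \<phi>' g then if odd (\<phi>' g) = v then p g else 0 else 0)"
      unfolding carrier_matD[OF shared_state_carrier] by (intro sum.cong refl) (simp only: lessThan_iff)
  qed
  also have "\<dots> = (\<Sum>i<a. \<Sum>g<N. \<Sum>j<b. if i = \<phi> g \<and> j = \<phi>' g then if odd (\<phi>' g) = v then p g else 0 else 0)"
    by (intro sum.cong refl sum.swap)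
  also have "\<dots> = (\<Sum>g<N. \<Sum>i<a. \<Sum>j<b. if i = \<phi> g \<and> j = \<phi>' g then if odd (\<phi>' g) = v then p g else 0 else 0)"
    by (rule sum.swap)
  also have "\<dots> = (\<Sum>g<N. if odd (\<phi>' g) = v then p g else 0)"
  proof (rule sum.cong[OF refl])
    fix g assume "g \<in> {..<N}"
    then have r: "\<phi> g < a" "\<phi>' g < b" using range by auto
    have "(\<Sum>j<b. if i = \<phi> g \<and> j = \<phi>' g then c else 0) = (if i = \<phi> g then c else 0)" for i and c :: real
      using r(2) by (cases "i = \<phi> g") simp_all
    then show "(\<Sum>i<a. \<Sum>j<b. if i = \<phi> g \<and> j = \<phi>' g then if odd (\<phi>' g) = v then p g else 0 else 0)
        = (if odd (\<phi>' g) = v then p g else 0)"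
      using r(1) by simp
  qed
  finally show ?thesis .
qed

text \<open>A seed \<open>g\<close> with its transcript is recorded on both sides; \<open>\<tau> x\<close> and \<open>\<tau>' y\<close> recover the
  current node of the protocol tree of the seed from the two records. The lowest bit of Bob's
  record is reserved for the output.\<close>

definition simulates :: "'x set \<Rightarrow> 'y set \<Rightarrow> nat \<Rightarrow> nat \<Rightarrow> nat \<Rightarrow> ('x \<Rightarrow> nat \<Rightarrow> ('x, 'y) protocol) \<Rightarrow>
    ('y \<Rightarrow> nat \<Rightarrow> ('x, 'y) protocol) \<Rightarrow> ('x, 'y) qstep list \<Rightarrow> bool" where
  "simulates X Y c a b \<tau> \<tau>' ss \<longleftrightarrow> qsteps_ok X Y (2 ^ c * a) (2 ^ c * b) ss \<and> qubits ss = c \<and>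
     (\<forall>x\<in>X. \<forall>y\<in>Y. \<forall>N p \<phi> \<phi>' v.
        (\<forall>g<N. \<phi> g < a \<and> \<phi>' g < b \<and> even (\<phi>' g) \<and> 0 \<le> p g \<and> \<tau> x (\<phi> g) = \<tau>' y (\<phi>' g) \<and>
           cost (\<tau>' y (\<phi>' g)) \<le> c) \<and> inj_on \<phi>' {..<N} \<longrightarrow>
        odd_prob (fold (apply_qstep x y) ss ((epr ^^ c) (shared_state N p a b \<phi> \<phi>'))) v
          = (\<Sum>g<N. if run (\<tau>' y (\<phi>' g)) x y = v then p g else 0))"

lemma simulatesD:
  assumes "simulates X Y c a b \<tau> \<tau>' ss" "x \<in> X" "y \<in> Y"
    and "\<forall>g<N. \<phi> g < a \<and> \<phi>' g < b \<and> even (\<phi>' g) \<and> 0 \<le> p g \<and> \<tau> x (\<phi> g) = \<tau>' y (\<phi>' g) \<and>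
      cost (\<tau>' y (\<phi>' g)) \<le> c" and "inj_on \<phi>' {..<N}"
  shows "odd_prob (fold (apply_qstep x y) ss ((epr ^^ c) (shared_state N p a b \<phi> \<phi>'))) v
    = (\<Sum>g<N. if run (\<tau>' y (\<phi>' g)) x y = v then p g else 0)"
proof -
  note all = assms(1)[unfolded simulates_def, THEN conjunct2, THEN conjunct2]
  show ?thesis
    by (rule all[THEN bspec, OF assms(2), THEN bspec, OF assms(3), THEN spec, THEN spec, THEN spec, THEN spec,
          THEN spec, THEN mp, OF conjI[OF assms(4,5)]])
qed

definition answer_step :: "nat \<Rightarrow> ('y \<Rightarrow> nat \<Rightarrow> ('x, 'y) protocol) \<Rightarrow> ('x, 'y) qstep" where
  "answer_step b \<tau>' = Bob_Unitary (\<lambda>y. writer b (\<lambda>s. \<tau>' y s = Output True))"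

text \<open>At remaining cost 0 every node is a leaf, so Bob reads its value off his record and
  writes it into the lowest bit, which was 0 before.\<close>

lemma odd_prob_answer:
  assumes b: "even b"
    and g: "\<And>g. g < N \<Longrightarrow> \<phi> g < a \<and> \<phi>' g < b \<and> even (\<phi>' g) \<and> 0 \<le> p g \<and> cost (\<tau>' y (\<phi>' g)) = 0"
    and inj: "inj_on \<phi>' {..<N}"
  shows "odd_prob (fold (apply_qstep x y) [answer_step b \<tau>'] (shared_state N p a b \<phi> \<phi>')) v
    = (\<Sum>g<N. if run (\<tau>' y (\<phi>' g)) x y = v then p g else 0)"
proof -
  let ?f = "\<lambda>s. \<tau>' y s = Output True"
  have "odd_prob (fold (apply_qstep x y) [answer_step b \<tau>'] (shared_state N p a b \<phi> \<phi>')) v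
      = odd_prob (shared_state N p a b \<phi> (\<lambda>g. toggle ?f (\<phi>' g))) v"
    by (simp add: answer_step_def shared_state_writer[OF b])
  also have "\<dots> = (\<Sum>g<N. if odd (toggle ?f (\<phi>' g)) = v then p g else 0)"
  proof (rule odd_prob_shared_state)
    show "\<phi> g < a \<and> toggle ?f (\<phi>' g) < b" if "g < N" for g using g[OF that] toggle_less[OF b] by blast
    show "inj_on (\<lambda>g. toggle ?f (\<phi>' g)) {..<N}"
      using inj unfolding inj_on_def by (metis toggle_toggle)
  qed (use g in blast)
  also have "\<dots> = (\<Sum>g<N. if run (\<tau>' y (\<phi>' g)) x y = v then p g else 0)"
  proof (rule sum.cong[OF refl])
    fix h assume "h \<in> {..<N}"
    then have h: "even (\<phi>' h)" "cost (\<tau>' y (\<phi>' h)) = 0" using g by auto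
    then have "odd (toggle ?f (\<phi>' h)) = (\<tau>' y (\<phi>' h) = Output True)" by (auto simp: toggle_def)
    also have "\<dots> = run (\<tau>' y (\<phi>' h)) x y" using h(2) by (cases "\<tau>' y (\<phi>' h)") auto
    finally show "(if odd (toggle ?f (\<phi>' h)) = v then p h else 0) = (if run (\<tau>' y (\<phi>' h)) x y = v then p h else 0)"
      by simp
  qed
  finally show ?thesis .
qed

lemma answer_step_ok: "even b \<Longrightarrow> qsteps_ok X Y a b [answer_step b \<tau>']"
  by (simp add: answer_step_def unitary_writer)

lemma qubits_answer [simp]: "qubits [answer_step b \<tau>'] = 0"
  by (simp add: answer_step_def)

lemma inj_on_record:
  assumes "inj_on \<phi>' {..<N}" "\<And>g. g < N \<Longrightarrow> \<phi>' g < (b :: nat)"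
  shows "inj_on (\<lambda>g. m g * b + \<phi>' g) {..<N}"
proof (rule inj_onI)
  fix g h assume gh: "g \<in> {..<N}" "h \<in> {..<N}" and eq: "m g * b + \<phi>' g = m h * b + \<phi>' h"
  have "(m g * b + \<phi>' g) mod b = \<phi>' g" "(m h * b + \<phi>' h) mod b = \<phi>' h" using assms(2) gh by auto
  then have "\<phi>' g = \<phi>' h" using eq by simp
  then show "g = h" using inj_onD[OF assms(1)] gh by blast
qed

lemma record_less: "m < 4 \<Longrightarrow> s < b \<Longrightarrow> m * b + s < 4 * (b :: nat)"
proof -
  assume a: "m < 4" "s < b"
  then have "m * b + s < Suc m * b" by simp
  also have "\<dots> \<le> 4 * b" using a by (intro mult_le_mono1) simp
  finally show ?thesis .
qed

text \<open>One qubit in each direction descends two levels, hence induction in steps of two.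
  Records grow by putting messages in front, and \<open>\<sigma>\<close>, \<open>\<sigma>'\<close>
  recompute the node from them. Since Bob measures, a last odd level takes only one qubit, from
  Alice.\<close>

lemma exists_simulation:
  "even b \<Longrightarrow> \<exists>ss. simulates X Y c a b \<tau> \<tau>' ss"
proof (induction c arbitrary: a b \<tau> \<tau>' rule: nat_induct2)
  case 0
  have "simulates X Y 0 a b \<tau> \<tau>' [answer_step b \<tau>']"
    unfolding simulates_def
  proof (intro conjI ballI allI impI)
    fix x y v and N :: nat and p :: "nat \<Rightarrow> real" and \<phi> \<phi>' :: "nat \<Rightarrow> nat"
    assume h: "(\<forall>g<N. \<phi> g < a \<and> \<phi>' g < b \<and> even (\<phi>' g) \<and> 0 \<le> p g \<and> \<tau> x (\<phi> g) = \<tau>' y (\<phi>' g) \<and>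
           cost (\<tau>' y (\<phi>' g)) \<le> 0) \<and> inj_on \<phi>' {..<N}"
    show "odd_prob (fold (apply_qstep x y) [answer_step b \<tau>'] ((epr ^^ 0) (shared_state N p a b \<phi> \<phi>'))) v
          = (\<Sum>g<N. if run (\<tau>' y (\<phi>' g)) x y = v then p g else 0)"
      unfolding funpow_0 by (rule odd_prob_answer[OF 0]) (use h in auto)
  qed (use 0 answer_step_ok[of b] in simp_all)
  then show ?case ..
next
  case 1
  define \<mu> :: "'a \<Rightarrow> nat \<Rightarrow> nat" where "\<mu> = (\<lambda>x s. of_bool (alice_bit x (\<tau> x s)))"
  \<comment> \<open>Alice's message is a single bit here. Bob adds his own bit locally, so the level
    is completed whoever speaks.\<close>
  define \<sigma>' where "\<sigma>' = (\<lambda>y l. descend (\<tau>' y (l mod b)) (l div b = 1) (bob_bit y (\<tau>' y (l mod b))))"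
  have \<mu>: "\<mu> x s < 4" for x s by (simp add: \<mu>_def)
  have b4: "even (4 * b)" by simp
  have "simulates X Y 1 a b \<tau> \<tau>' (alice_send a b \<mu> @ [answer_step (4 * b) \<sigma>'])"
    unfolding simulates_def
  proof (intro conjI ballI allI impI)
    show "qsteps_ok X Y (2 ^ 1 * a) (2 ^ 1 * b) (alice_send a b \<mu> @ [answer_step (4 * b) \<sigma>'])"
    proof -
      have "qsteps_ok X Y (2 * a) (2 * b) (alice_send a b \<mu> @ [answer_step (4 * b) \<sigma>'])"
        by (rule alice_send_ok[where \<mu> = \<mu>]) (rule \<mu>, rule answer_step_ok[OF b4])
      then show ?thesis by simp
    qed
    show "qubits (alice_send a b \<mu> @ [answer_step (4 * b) \<sigma>']) = 1" by simp
    fix x y v and N :: nat and p :: "nat \<Rightarrow> real" and \<phi> \<phi>' :: "nat \<Rightarrow> nat"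
    assume h: "(\<forall>g<N. \<phi> g < a \<and> \<phi>' g < b \<and> even (\<phi>' g) \<and> 0 \<le> p g \<and> \<tau> x (\<phi> g) = \<tau>' y (\<phi>' g) \<and>
           cost (\<tau>' y (\<phi>' g)) \<le> 1) \<and> inj_on \<phi>' {..<N}"
    let ?\<phi>' = "\<lambda>g. \<mu> x (\<phi> g) * b + \<phi>' g"
    have node: "\<sigma>' y (?\<phi>' g) = descend (\<tau>' y (\<phi>' g)) (alice_bit x (\<tau>' y (\<phi>' g))) (bob_bit y (\<tau>' y (\<phi>' g)))"
      if "g < N" for g
    proof -
      have "?\<phi>' g mod b = \<phi>' g" "?\<phi>' g div b = \<mu> x (\<phi> g)" using h that by auto
      moreover have "(\<mu> x (\<phi> g) = 1) = alice_bit x (\<tau>' y (\<phi>' g))" using h that by (simp add: \<mu>_def)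
      ultimately show ?thesis by (simp only: \<sigma>'_def)
    qed
    have "fold (apply_qstep x y) (alice_send a b \<mu> @ [answer_step (4 * b) \<sigma>']) ((epr ^^ 1) (shared_state N p a b \<phi> \<phi>'))
        = fold (apply_qstep x y) [answer_step (4 * b) \<sigma>'] (shared_state N p a (4 * b) \<phi> ?\<phi>')"
      using fold_alice_send[where ss = "[answer_step (4 * b) \<sigma>']" and \<mu> = \<mu> and x = x and y = y,
          OF shared_state_carrier[of N p a b \<phi> \<phi>'] \<mu>] transmit_shared_state[of N \<phi>' b "\<mu> x" p a \<phi>] h
      by simp
    also have "odd_prob \<dots> v = (\<Sum>g<N. if run (\<sigma>' y (?\<phi>' g)) x y = v then p g else 0)"
    proof (rule odd_prob_answer[OF b4])
      show "\<phi> g < a \<and> ?\<phi>' g < 4 * b \<and> even (?\<phi>' g) \<and> 0 \<le> p g \<and> cost (\<sigma>' y (?\<phi>' g)) = 0" if "g < N" for g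
      proof -
        have "cost (\<sigma>' y (?\<phi>' g)) = 0"
          unfolding node[OF that] using cost_descend[of "\<tau>' y (\<phi>' g)"] h that by (metis diff_is_0_eq le_zero_eq)
        then show ?thesis using h that record_less[OF \<mu>] 1 by simp
      qed
      show "inj_on ?\<phi>' {..<N}" using h by (intro inj_on_record) auto
    qed
    also have "\<dots> = (\<Sum>g<N. if run (\<tau>' y (\<phi>' g)) x y = v then p g else 0)"
      by (rule sum.cong[OF refl]) (simp only: lessThan_iff node run_descend)
    finally show "odd_prob (fold (apply_qstep x y) (alice_send a b \<mu> @ [answer_step (4 * b) \<sigma>'])
        ((epr ^^ 1) (shared_state N p a b \<phi> \<phi>'))) v = (\<Sum>g<N. if run (\<tau>' y (\<phi>' g)) x y = v then p g else 0)" .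
  qed
  then show ?case ..
next
  case (step k)
  define \<mu> where "\<mu> = (\<lambda>x s. alice_message x (\<tau> x s))"
  \<comment> \<open>Bob's record \<open>l\<close> already has Alice's message as its leading digit,
    and his reply may depend on it.\<close>
  define \<nu> where "\<nu> = (\<lambda>y l. bob_message y (\<tau>' y (l mod b)) (l div b))"
  \<comment> \<open>Alice's new record holds only Bob's reply in front of the old record; she
    recomputes her own message.\<close>
  define \<sigma> where "\<sigma> = (\<lambda>x l. descend2 (\<tau> x (l mod a)) (\<mu> x (l mod a)) (l div a))"
  define \<sigma>' where "\<sigma>' = (\<lambda>y l. descend2 (\<tau>' y (l mod b)) (l div b) (\<nu> y l))"
  have \<mu>: "\<mu> x s < 4" and \<nu>: "\<nu> y l < 4" for x s y l by (simp_all add: \<mu>_def \<nu>_def)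
  have "even (4 * b)" by simp
  from step.IH[OF this, of "4 * a" \<sigma> \<sigma>']
  obtain ss where ss: "simulates X Y k (4 * a) (4 * b) \<sigma> \<sigma>' ss" ..
  define A B where "A = 2 ^ k * a" and "B = 2 ^ k * b"
  \<comment> \<open>The divisions strip the halves of the EPR pairs still in reserve:
    \<open>Suc k\<close> of them at Alice's transmission, \<open>k\<close> at Bob's.\<close>
  define tt where "tt = alice_send (2 * A) (2 * B) (\<lambda>x i. \<mu> x (i div 2 ^ Suc k)) @
     bob_send A (4 * B) (\<lambda>y j. \<nu> y (j div 2 ^ k)) @ ss"
  have "simulates X Y (k + 2) a b \<tau> \<tau>' tt"
    unfolding simulates_def
  proof (intro conjI ballI allI impI)
    have "qsteps_ok X Y (4 * A) (4 * B) ss" using ss by (simp add: simulates_def A_def B_def mult.left_commute)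
    then have "qsteps_ok X Y (2 * A) (2 * (4 * B)) (bob_send A (4 * B) (\<lambda>y j. \<nu> y (j div 2 ^ k)) @ ss)"
      by (intro bob_send_ok[where \<nu> = "\<lambda>y j. \<nu> y (j div 2 ^ k)"] \<nu>)
    then have "qsteps_ok X Y (2 * A) (4 * (2 * B)) (bob_send A (4 * B) (\<lambda>y j. \<nu> y (j div 2 ^ k)) @ ss)" by simp
    then have "qsteps_ok X Y (2 * (2 * A)) (2 * (2 * B)) tt"
      unfolding tt_def by (intro alice_send_ok[where \<mu> = "\<lambda>x i. \<mu> x (i div 2 ^ Suc k)"] \<mu>)
    then show "qsteps_ok X Y (2 ^ (k + 2) * a) (2 ^ (k + 2) * b) tt" by (simp add: A_def B_def mult.assoc)
    show "qubits tt = k + 2" using ss by (simp add: tt_def simulates_def)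
    fix x y v and N :: nat and p :: "nat \<Rightarrow> real" and \<phi> \<phi>' :: "nat \<Rightarrow> nat"
    assume x: "x \<in> X" and y: "y \<in> Y"
    assume h: "(\<forall>g<N. \<phi> g < a \<and> \<phi>' g < b \<and> even (\<phi>' g) \<and> 0 \<le> p g \<and> \<tau> x (\<phi> g) = \<tau>' y (\<phi>' g) \<and>
           cost (\<tau>' y (\<phi>' g)) \<le> k + 2) \<and> inj_on \<phi>' {..<N}"
    let ?S = "shared_state N p a b \<phi> \<phi>'"
    define \<rho>' where "\<rho>' = (\<lambda>g. \<mu> x (\<phi> g) * b + \<phi>' g)"
    define \<rho> where "\<rho> = (\<lambda>g. \<nu> y (\<rho>' g) * a + \<phi> g)"
    have \<rho>'_less: "\<rho>' g < 4 * b" and \<rho>_less: "\<rho> g < 4 * a" if "g < N" for g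
      using h that record_less[OF \<mu>] record_less[OF \<nu>] by (simp_all add: \<rho>'_def \<rho>_def)
    have tS: "transmit (\<mu> x) ?S = shared_state N p a (4 * b) \<phi> \<rho>'"
      unfolding \<rho>'_def using h by (intro transmit_shared_state) auto
    have c1: "(epr ^^ Suc k) ?S \<in> carrier_mat (2 * A) (2 * B)"
      using eprs_carrier[OF shared_state_carrier, of "Suc k" N p a b \<phi> \<phi>'] by (simp add: A_def B_def mult.assoc)
    have c2: "(epr ^^ k) (shared_state N p a (4 * b) \<phi> \<rho>') \<in> carrier_mat A (4 * B)"
      using eprs_carrier[OF shared_state_carrier, of k N p a "4 * b" \<phi> \<rho>'] by (simp add: A_def B_def mult.left_commute)
    have "fold (apply_qstep x y) tt ((epr ^^ (k + 2)) ?S)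
        = fold (apply_qstep x y) (bob_send A (4 * B) (\<lambda>y j. \<nu> y (j div 2 ^ k)) @ ss)
            (transmit (\<lambda>i. \<mu> x (i div 2 ^ Suc k)) ((epr ^^ Suc k) ?S))"
    proof -
      have "(epr ^^ (k + 2)) ?S = epr ((epr ^^ Suc k) ?S)" by simp
      then show ?thesis
        unfolding tt_def by (simp only:) (rule fold_alice_send[where \<mu> = "\<lambda>x i. \<mu> x (i div 2 ^ Suc k)", OF c1 \<mu>])
    qed
    also have "transmit (\<lambda>i. \<mu> x (i div 2 ^ Suc k)) ((epr ^^ Suc k) ?S) = epr ((epr ^^ k) (shared_state N p a (4 * b) \<phi> \<rho>'))"
      using transmit_eprs[OF shared_state_carrier, of "\<mu> x" "Suc k"] tS by simp
    also have "fold (apply_qstep x y) (bob_send A (4 * B) (\<lambda>y j. \<nu> y (j div 2 ^ k)) @ ss) \<dots>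
        = fold (apply_qstep x y) ss (transpose_mat (transmit (\<lambda>j. \<nu> y (j div 2 ^ k))
            (transpose_mat ((epr ^^ k) (shared_state N p a (4 * b) \<phi> \<rho>')))))"
      by (rule fold_bob_send[where \<nu> = "\<lambda>y j. \<nu> y (j div 2 ^ k)", OF c2 \<nu>])
    also have "transpose_mat (transmit (\<lambda>j. \<nu> y (j div 2 ^ k)) (transpose_mat ((epr ^^ k) (shared_state N p a (4 * b) \<phi> \<rho>'))))
        = (epr ^^ k) (shared_state N p (4 * a) (4 * b) \<rho> \<rho>')"
    proof -
      have "transmit (\<lambda>j. \<nu> y (j div 2 ^ k)) (transpose_mat ((epr ^^ k) (shared_state N p a (4 * b) \<phi> \<rho>')))
          = (epr ^^ k) (transmit (\<nu> y) (shared_state N p (4 * b) a \<rho>' \<phi>))"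
        unfolding transpose_eprs transpose_shared_state by (rule transmit_eprs[OF shared_state_carrier])
      also have "transmit (\<nu> y) (shared_state N p (4 * b) a \<rho>' \<phi>) = shared_state N p (4 * b) (4 * a) \<rho>' \<rho>"
        unfolding \<rho>_def using h by (intro transmit_shared_state) auto
      finally show ?thesis by (simp add: transpose_eprs transpose_shared_state)
    qed
    finally have fold: "fold (apply_qstep x y) tt ((epr ^^ (k + 2)) ?S)
        = fold (apply_qstep x y) ss ((epr ^^ k) (shared_state N p (4 * a) (4 * b) \<rho> \<rho>'))" .
    have node: "\<sigma> x (\<rho> g) = \<sigma>' y (\<rho>' g)" "run (\<sigma>' y (\<rho>' g)) x y = run (\<tau>' y (\<phi>' g)) x y"
      "cost (\<sigma>' y (\<rho>' g)) \<le> k" if g: "g < N" for g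
    proof -
      have T: "\<tau> x (\<phi> g) = \<tau>' y (\<phi>' g)" and c: "cost (\<tau>' y (\<phi>' g)) \<le> k + 2" using h g by auto
      have m: "\<rho>' g mod b = \<phi>' g" "\<rho>' g div b = \<mu> x (\<phi> g)" "\<rho> g mod a = \<phi> g" "\<rho> g div a = \<nu> y (\<rho>' g)"
        using h g by (auto simp: \<rho>'_def \<rho>_def)
      let ?T = "\<tau>' y (\<phi>' g)" and ?m = "alice_message x (\<tau>' y (\<phi>' g))"
      have \<mu>g: "\<mu> x (\<phi> g) = ?m" by (simp add: \<mu>_def T)
      have \<nu>g: "\<nu> y (\<rho>' g) = bob_message y ?T ?m" unfolding \<nu>_def m \<mu>g ..
      have s': "\<sigma>' y (\<rho>' g) = descend2 ?T ?m (bob_message y ?T ?m)" unfolding \<sigma>'_def \<nu>g m \<mu>g ..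
      show "\<sigma> x (\<rho> g) = \<sigma>' y (\<rho>' g)" unfolding s' \<sigma>_def m \<mu>g \<nu>g T ..
      show "run (\<sigma>' y (\<rho>' g)) x y = run ?T x y" unfolding s' by (rule descend2_messages(1)[OF refl refl])
      show "cost (\<sigma>' y (\<rho>' g)) \<le> k"
        unfolding s' using descend2_messages(2)[of ?m x ?T "bob_message y ?T ?m" y] c by simp
    qed
    have "odd_prob (fold (apply_qstep x y) ss ((epr ^^ k) (shared_state N p (4 * a) (4 * b) \<rho> \<rho>'))) v
        = (\<Sum>g<N. if run (\<sigma>' y (\<rho>' g)) x y = v then p g else 0)"
    proof -
      have "inj_on \<rho>' {..<N}" unfolding \<rho>'_def using h by (intro inj_on_record) auto
      moreover have "\<forall>g<N. \<rho> g < 4 * a \<and> \<rho>' g < 4 * b \<and> even (\<rho>' g) \<and> 0 \<le> p g \<and>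
          \<sigma> x (\<rho> g) = \<sigma>' y (\<rho>' g) \<and> cost (\<sigma>' y (\<rho>' g)) \<le> k"
      proof (intro allI impI)
        fix g assume g: "g < N"
        have "even (\<rho>' g)" using h g step.prems by (simp add: \<rho>'_def)
        then show "\<rho> g < 4 * a \<and> \<rho>' g < 4 * b \<and> even (\<rho>' g) \<and> 0 \<le> p g \<and>
            \<sigma> x (\<rho> g) = \<sigma>' y (\<rho>' g) \<and> cost (\<sigma>' y (\<rho>' g)) \<le> k"
          using node(1,3)[OF g] \<rho>_less[OF g] \<rho>'_less[OF g] h g by simp
      qed
      ultimately show ?thesis by (intro simulatesD[OF ss x y])
    qed
    also have "\<dots> = (\<Sum>g<N. if run (\<tau>' y (\<phi>' g)) x y = v then p g else 0)"
      by (rule sum.cong[OF refl]) (simp only: lessThan_iff node(2))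
    finally show "odd_prob (fold (apply_qstep x y) tt ((epr ^^ (k + 2)) ?S)) v
        = (\<Sum>g<N. if run (\<tau>' y (\<phi>' g)) x y = v then p g else 0)"
      unfolding fold .
  qed
  then show ?case by auto
qed

lemma quantum_simulates_randomized:
  fixes P :: "bool stream \<Rightarrow> ('x, 'y) protocol"
  assumes fin: "finite X" "finite Y" "X \<noteq> {}" "Y \<noteq> {}" and cost: "\<And>r. cost (P r) \<le> c"
    and meas: "\<And>x y. x \<in> X \<Longrightarrow> y \<in> Y \<Longrightarrow> {r. run (P r) x y = F x y} \<in> sets coins"
    and prob: "\<And>x y. x \<in> X \<Longrightarrow> y \<in> Y \<Longrightarrow> measure coins {r. run (P r) x y = F x y} \<ge> q"
  shows "\<exists>Q :: ('x, 'y) qprotocol. qprotocol_ok X Y Q \<and> qcost Q \<le> c \<and>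
    (\<forall>x\<in>X. \<forall>y\<in>Y. q \<le> output_prob Q x y (F x y))"
proof -
  obtain N :: nat and p and T :: "nat \<Rightarrow> ('x, 'y) protocol" where p: "\<And>g. g < N \<Longrightarrow> 0 \<le> p g" "(\<Sum>g<N. p g) = 1"
    and T: "\<And>g. cost (T g) \<le> c"
    and good: "\<And>x y. x \<in> X \<Longrightarrow> y \<in> Y \<Longrightarrow> q \<le> (\<Sum>g<N. if run (T g) x y = F x y then p g else 0)"
    using finite_shared_randomness[where P = P, OF fin(1,2) cost meas prob] by blast
  define \<tau> :: "'x \<Rightarrow> nat \<Rightarrow> ('x, 'y) protocol" where "\<tau> = (\<lambda>x s. T s)"
  \<comment> \<open>Bob records the seed \<open>g\<close> as \<open>2 * g\<close>, with the lowest
    bit free for the output.\<close>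
  define \<tau>' :: "'y \<Rightarrow> nat \<Rightarrow> ('x, 'y) protocol" where "\<tau>' = (\<lambda>y l. T (l div 2))"
  obtain ss where ss: "simulates X Y c N (2 * N) \<tau> \<tau>' ss"
    using exists_simulation[of "2 * N" X Y c N \<tau> \<tau>'] by auto
  define \<psi> where "\<psi> = (epr ^^ c) (shared_state N p N (2 * N) (\<lambda>g. g) (\<lambda>g. 2 * g))"
  have \<psi>: "\<psi> \<in> carrier_mat (2 ^ c * N) (2 ^ c * (2 * N))"
    unfolding \<psi>_def by (rule eprs_carrier[OF shared_state_carrier])
  have ok: "qsteps_ok X Y (2 ^ c * N) (2 ^ c * (2 * N)) ss" "qubits ss = c"
    using ss by (simp_all add: simulates_def)
  have out: "odd_prob (fold (apply_qstep x y) ss \<psi>) v = (\<Sum>g<N. if run (T g) x y = v then p g else 0)"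
    if x: "x \<in> X" and y: "y \<in> Y" for x y v
  proof -
    have "\<forall>g<N. g < N \<and> 2 * g < 2 * N \<and> even (2 * g) \<and> 0 \<le> p g \<and> \<tau> x g = \<tau>' y (2 * g) \<and> cost (\<tau>' y (2 * g)) \<le> c"
      using p T by (simp add: \<tau>_def \<tau>'_def)
    moreover have "inj_on (\<lambda>g. 2 * g :: nat) {..<N}" by (simp add: inj_on_def)
    ultimately have "odd_prob (fold (apply_qstep x y) ss \<psi>) v = (\<Sum>g<N. if run (\<tau>' y (2 * g)) x y = v then p g else 0)"
      unfolding \<psi>_def by (intro simulatesD[OF ss x y])
    then show ?thesis by (simp add: \<tau>'_def)
  qed
  define Q :: "('x, 'y) qprotocol" where
    "Q = \<lparr>init_state = \<psi>, steps = ss, alice_measures = False, decide = odd\<rparr>"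
  have outp: "output_prob Q x y v = odd_prob (fold (apply_qstep x y) ss \<psi>) v" for x y v
    by (simp add: Q_def output_prob_def final_state_def odd_prob_def Let_def)
  \<comment> \<open>The norm is computed after the steps, which preserve it: there the probabilities
    of the two outputs add up to the total weight of the seeds. This needs one input, hence nonempty
    \<open>X\<close> and \<open>Y\<close>.\<close>
  have "hs \<psi> = 1"
  proof -
    obtain x y where xy: "x \<in> X" "y \<in> Y" using fin by blast
    have split: "odd_prob M True + odd_prob M False = hs M" for M
    proof -
      have "hs M = (\<Sum>i<dim_row M. \<Sum>j<dim_col M. (if odd j = True then (cmod (M $$ (i, j)))\<^sup>2 else 0) +
        (if odd j = False then (cmod (M $$ (i, j)))\<^sup>2 else 0))"
        unfolding hs_def by (intro sum.cong refl) auto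
      then show ?thesis by (simp only: odd_prob_def sum.distrib)
    qed
    have "hs \<psi> = hs (fold (apply_qstep x y) ss \<psi>)" by (rule hs_steps[OF ok(1) xy \<psi>, symmetric])
    also have "\<dots> = (\<Sum>g<N. (if run (T g) x y = True then p g else 0) + (if run (T g) x y = False then p g else 0))"
      unfolding split[symmetric] out[OF xy] sum.distrib ..
    also have "\<dots> = (\<Sum>g<N. p g)" by (intro sum.cong) auto
    finally show ?thesis by (simp add: p)
  qed
  then have "qprotocol_ok X Y Q"
    using ok(1) \<psi> by (simp add: Q_def qprotocol_ok_def hs_def)
  moreover have "qcost Q \<le> c" using ok(2) by (simp add: Q_def qcost_def qubits_def)
  ultimately show ?thesis using good out outp by (intro exI[of _ Q]) simp
qed

section \<open>Comparison of the complexities\<close>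

text \<open>\<open>LEAST\<close> is informative only if some protocol exists. A correct
  \<open>P\<close> yields both the upper bound and a protocol attaining the minimum.\<close>

lemma D_cc_attained:
  assumes "\<And>x y. x \<in> X \<Longrightarrow> y \<in> Y \<Longrightarrow> run P x y = F x y"
  shows "D_cc X Y F \<le> cost P"
    and "\<exists>P'. cost P' \<le> D_cc X Y F \<and> (\<forall>x\<in>X. \<forall>y\<in>Y. run P' x y = F x y)"
proof -
  have ex: "\<exists>P'. cost P' \<le> cost P \<and> (\<forall>x\<in>X. \<forall>y\<in>Y. run P' x y = F x y)"
    by (rule exI[of _ P]) (simp add: assms)
  then show "D_cc X Y F \<le> cost P" unfolding D_cc_def by (rule Least_le)
  from ex have "\<exists>c. \<exists>P'. cost P' \<le> c \<and> (\<forall>x\<in>X. \<forall>y\<in>Y. run P' x y = F x y)" by (rule exI)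
  from LeastI_ex[OF this] show "\<exists>P'. cost P' \<le> D_cc X Y F \<and> (\<forall>x\<in>X. \<forall>y\<in>Y. run P' x y = F x y)"
    unfolding D_cc_def .
qed

text \<open>A deterministic protocol is a randomized one whose tree does not depend on the coins,
  with success probability 1.\<close>

lemma R_cc_attained:
  assumes "\<And>x y. x \<in> X \<Longrightarrow> y \<in> Y \<Longrightarrow> run P x y = F x y" and \<epsilon>: "0 \<le> \<epsilon>"
  shows "R_cc \<epsilon> X Y F \<le> cost P"
    and "\<exists>P'. (\<forall>r. cost (P' r) \<le> R_cc \<epsilon> X Y F) \<and> (\<forall>x\<in>X. \<forall>y\<in>Y. {r. run (P' r) x y = F x y} \<in> sets coins \<and>
        measure coins {r. run (P' r) x y = F x y} \<ge> 1 - \<epsilon>)"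
proof -
  have U: "UNIV \<in> sets coins" "measure coins UNIV = 1"
    using sets.top[of coins] prob_space.prob_space[OF prob_space_coins] by simp_all
  have ex: "\<exists>P' :: bool stream \<Rightarrow> ('a, 'b) protocol. (\<forall>r. cost (P' r) \<le> cost P) \<and>
      (\<forall>x\<in>X. \<forall>y\<in>Y. {r. run (P' r) x y = F x y} \<in> sets coins \<and> measure coins {r. run (P' r) x y = F x y} \<ge> 1 - \<epsilon>)"
    by (rule exI[of _ "\<lambda>r. P"]) (use assms U in simp)
  then show "R_cc \<epsilon> X Y F \<le> cost P" unfolding R_cc_def by (rule Least_le)
  from ex have "\<exists>c. \<exists>P' :: bool stream \<Rightarrow> ('a, 'b) protocol. (\<forall>r. cost (P' r) \<le> c) \<and>
      (\<forall>x\<in>X. \<forall>y\<in>Y. {r. run (P' r) x y = F x y} \<in> sets coins \<and> measure coins {r. run (P' r) x y = F x y} \<ge> 1 - \<epsilon>)"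
    by (rule exI)
  from LeastI_ex[OF this] show "\<exists>P'. (\<forall>r. cost (P' r) \<le> R_cc \<epsilon> X Y F) \<and> (\<forall>x\<in>X. \<forall>y\<in>Y.
      {r. run (P' r) x y = F x y} \<in> sets coins \<and> measure coins {r. run (P' r) x y = F x y} \<ge> 1 - \<epsilon>)"
    unfolding R_cc_def .
qed

lemma Q_cc_attained:
  assumes "\<exists>Q :: ('x, 'y) qprotocol. qprotocol_ok X Y Q \<and> qcost Q \<le> c \<and>
    (\<forall>x\<in>X. \<forall>y\<in>Y. output_prob Q x y (F x y) \<ge> 1 - \<epsilon>)"
  shows "Q_cc \<epsilon> X Y F \<le> c"
    and "\<exists>Q :: ('x, 'y) qprotocol. qprotocol_ok X Y Q \<and> qcost Q \<le> Q_cc \<epsilon> X Y F \<and>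
      (\<forall>x\<in>X. \<forall>y\<in>Y. output_prob Q x y (F x y) \<ge> 1 - \<epsilon>)"
proof -
  show "Q_cc \<epsilon> X Y F \<le> c" using assms unfolding Q_cc_def by (rule Least_le)
  from assms have "\<exists>c. \<exists>Q :: ('x, 'y) qprotocol. qprotocol_ok X Y Q \<and> qcost Q \<le> c \<and>
    (\<forall>x\<in>X. \<forall>y\<in>Y. output_prob Q x y (F x y) \<ge> 1 - \<epsilon>)" by (rule exI)
  from LeastI_ex[OF this] show "\<exists>Q :: ('x, 'y) qprotocol. qprotocol_ok X Y Q \<and> qcost Q \<le> Q_cc \<epsilon> X Y F \<and>
      (\<forall>x\<in>X. \<forall>y\<in>Y. output_prob Q x y (F x y) \<ge> 1 - \<epsilon>)"
    unfolding Q_cc_def .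
qed

lemma powr_twelfth_le:
  fixes d s :: nat
  assumes "real d \<le> 3 * real s ^ 3"
  shows "real d powr (1 / 12) \<le> 3 * real s powr (1 / 4)"
proof (cases "s = 0")
  case True
  then show ?thesis using assms by simp
next
  case False
  have "real d powr (1 / 12) \<le> (3 * real s ^ 3) powr (1 / 12)"
    using assms by (intro powr_mono2) auto
  also have "\<dots> = 3 powr (1 / 12) * (real s ^ 3) powr (1 / 12)"
    by (rule powr_mult) 
  also have "real s ^ 3 = real s powr 3" using False by (simp add: powr_numeral)
  also have "(real s powr 3) powr (1 / 12) = real s powr (3 * (1 / 12))" by (rule powr_powr)
  also have "(3 :: real) powr (1 / 12) * real s powr (3 * (1 / 12)) \<le> 3 * real s powr (1 / 4)"
  proof (rule mult_mono)
    have "(3 :: real) powr (1 / 12) \<le> 3 powr 1" by (intro powr_mono) auto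
    then show "(3 :: real) powr (1 / 12) \<le> 3" by simp
  qed auto
  finally show ?thesis .
qed

theorem theorem1p1:
  shows "\<exists>c c' :: real. c > 0 \<and> c' > 0 \<and>
    (\<forall>n \<ge> 1. \<forall>f :: bool list \<Rightarrow> bool.
      let X = bits n \<times> (UNIV :: bool set); Y = bits n; F = and_or_problem f in
        D_cc X Y F \<ge> R_cc (1 / 3) X Y F \<and>
        R_cc (1 / 3) X Y F \<ge> Q_cc (1 / 3) X Y F \<and>
        real (Q_cc (1 / 3) X Y F) \<ge> c * real (block_sensitivity n f) powr (1 / 4) \<and>
        c * real (block_sensitivity n f) powr (1 / 4) \<ge> c' * real (D_cc X Y F) powr (1 / 12))"
\<comment> \<open>The 274 stems from \<open>quantum_lower_bound\<close>; 822 is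
  \<open>3 * 274\<close>, with the 3 from \<open>powr_twelfth_le\<close>.\<close>
proof (rule exI[of _ "1 / 274"], rule exI[of _ "1 / 822"], intro conjI allI impI)
  fix n :: nat and f :: "bool list \<Rightarrow> bool"
  define X Y F where "X = bits n \<times> (UNIV :: bool set)" and "Y = bits n" and "F = and_or_problem f"
  let ?s = "block_sensitivity n f"
  have fin: "finite X" "finite Y" using finite_bits by (simp_all add: X_def Y_def)
  have ne: "X \<noteq> {}" "Y \<noteq> {}" using char_vec_bits[of n "{}"] unfolding X_def Y_def by blast+
  obtain P where P: "real (cost P) \<le> 3 * real ?s ^ 3"
    "\<And>x y. x \<in> X \<Longrightarrow> y \<in> Y \<Longrightarrow> run P x y = F x y"
    using and_or_protocol[of n f] unfolding X_def Y_def F_def by blast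
  have D: "real (D_cc X Y F) \<le> 3 * real ?s ^ 3"
    using D_cc_attained(1)[of X Y P F, OF P(2)] P(1) by (simp add: order_trans[of "real (D_cc X Y F)" "real (cost P)"])
  \<comment> \<open>The decision tree protocol \<open>P\<close> need not be optimal; comparing the
    randomized complexity with \<open>D_cc\<close> takes a protocol of minimal cost.\<close>
  obtain P' where P': "cost P' \<le> D_cc X Y F" "\<And>x y. x \<in> X \<Longrightarrow> y \<in> Y \<Longrightarrow> run P' x y = F x y"
    using D_cc_attained(2)[of X Y P F, OF P(2)] by auto
  have RD: "R_cc (1 / 3) X Y F \<le> D_cc X Y F"
    using R_cc_attained(1)[of X Y P' F "1 / 3", OF P'(2)] P'(1) by simp
  obtain R where R: "\<And>r. cost (R r) \<le> R_cc (1 / 3) X Y F"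
    "\<And>x y. x \<in> X \<Longrightarrow> y \<in> Y \<Longrightarrow> {r. run (R r) x y = F x y} \<in> sets coins"
    "\<And>x y. x \<in> X \<Longrightarrow> y \<in> Y \<Longrightarrow> measure coins {r. run (R r) x y = F x y} \<ge> 1 - 1 / 3"
    using R_cc_attained(2)[of X Y P' F "1 / 3", OF P'(2)] by auto
  \<comment> \<open>Besides the comparison, the simulation supplies the quantum protocol that makes
    the minimum in \<open>Q_cc\<close> attained.\<close>
  note sim = quantum_simulates_randomized[OF fin ne R]
  note QR = Q_cc_attained(1)[OF sim]
  obtain Q where Q: "qprotocol_ok X Y Q" "qcost Q \<le> Q_cc (1 / 3) X Y F"
    "\<And>x y. x \<in> X \<Longrightarrow> y \<in> Y \<Longrightarrow> 1 - 1 / 3 \<le> output_prob Q x y (F x y)"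
    using Q_cc_attained(2)[OF sim] by auto
  have "real ?s powr (1 / 4) \<le> 274 * real (qcost Q)"
    by (rule quantum_lower_bound[OF Q(1)[unfolded X_def Y_def]]) (use Q(3) in \<open>simp add: X_def Y_def F_def\<close>)
  also have "\<dots> \<le> 274 * real (Q_cc (1 / 3) X Y F)" using Q(2) by simp
  finally have lower: "1 / 274 * real ?s powr (1 / 4) \<le> real (Q_cc (1 / 3) X Y F)" by simp
  have "1 / 822 * real (D_cc X Y F) powr (1 / 12) \<le> 1 / 274 * real ?s powr (1 / 4)"
    using powr_twelfth_le[OF D] by simp
  with RD QR lower show "let X = bits n \<times> (UNIV :: bool set); Y = bits n; F = and_or_problem f in
        D_cc X Y F \<ge> R_cc (1 / 3) X Y F \<and>
        R_cc (1 / 3) X Y F \<ge> Q_cc (1 / 3) X Y F \<and>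
        real (Q_cc (1 / 3) X Y F) \<ge> 1 / 274 * real (block_sensitivity n f) powr (1 / 4) \<and>
        1 / 274 * real (block_sensitivity n f) powr (1 / 4) \<ge> 1 / 822 * real (D_cc X Y F) powr (1 / 12)"
    unfolding Let_def X_def Y_def F_def by blast
qed simp_all

end
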